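(* Let $F_1,F_2:\mathbb{N}\to\mathbb{N}$ be non-decreasing functions with $F_2(n)\geq F_1(n)$ for all $n\in\mathbb N$, such that each $F\in\{F_1,F_2\}$ satisfies: (A) there exist $C,\epsilon>0$ such that for all $n\in\mathbb{N}$ with $n\ge 3$, $F(n)\geq \exp\left(C\,n\,(\log n)^2(\log\log n)^{1+\epsilon}\right)$; (B) there exist a real number $C_1>1$ and an integer $C_2>1$ such that for all $n\in\mathbb{N}$, $F(n)^{C_1}\leq F(C_2n)$. Then there exists a finitely generated conjugacy separable group $G$ such that $\mathrm{Rf}_G(n)\simeq F_1(n)$ and $\mathrm{Conj}_G(n)\simeq F_2(n)$.
   Context: $\mathbb{N}=\{1,2,3,\dots\}$. A group $G$ is conjugacy separable if for every pair of non-conjugate $g_1,g_2\in G$ there is a homomorphism $\varphi$ from $G$ onto a finite group such that $\varphi(g_1),\varphi(g_2)$ are non-conjugate (such a group is residually finite). For such $G$ put $\mathrm{Rf}_G(1)=1$ and $\mathrm{Rf}_G(g)=\min\{[G:N]: N \text{ normal of finite index in } G,\ g\notin N\}$ for $1\ne g\in G$; put $\mathrm{Conj}_G(g_1,g_2)=1$ if $g_1,g_2$ are conjugate in $G$, and otherwise $\mathrm{Conj}_G(g_1,g_2)=\min\{[G:N] : N\text{ normal of finite index in } G,\ g_1N \text{ and } g_2N \text{ not conjugate in } G/N\}$. For a finite generating set $S$ of $G$ with word norm $\|\cdot\|_S$ and $n\in\mathbb N$, $\mathrm{Rf}_G^S(n)=\max\{\mathrm{Rf}_G(g):\|g\|_S\le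 n\}$ and $\mathrm{Conj}_G^S(n)=\max\{\mathrm{Conj}_G(g_1,g_2): \|g_1\|_S\le n,\ \|g_2\|_S\leq n\}$. For non-decreasing $f,g:\mathbb{N}\to\mathbb{R}_{>0}$, write $f\prec g$ if there is a constant $c\in\mathbb{N}$ with $f(n)\leq g(cn)$ for all $n\in\mathbb N$, and $f\simeq g$ if $f\prec g$ and $g\prec f$. Up to $\simeq$ the functions $\mathrm{Rf}_G^S$ and $\mathrm{Conj}_G^S$ do not depend on the finite generating set $S$, and $\mathrm{Rf}_G(n)$, $\mathrm{Conj}_G(n)$ denote these functions for any choice of $S$. *)

theory Defs
  imports Complex_Main "HOL-Algebra.Generated_Groups"
begin

definition conjugate_in :: "('a, 'b) monoid_scheme \<Rightarrow> 'a \<Rightarrow> 'a \<Rightarrow> bool" where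
  "conjugate_in G x y \<longleftrightarrow>
     (\<exists>h\<in>carrier G. y = h \<otimes>\<^bsub>G\<^esub> x \<otimes>\<^bsub>G\<^esub> inv\<^bsub>G\<^esub> h)"

text \<open>The finite target group may be taken with carrier in \<^typ>\<open>nat\<close>, since every finite group
  is isomorphic to such a group.\<close>

definition conjugacy_separable :: "('a, 'b) monoid_scheme \<Rightarrow> bool" where
  "conjugacy_separable G \<longleftrightarrow>
     (\<forall>x\<in>carrier G. \<forall>y\<in>carrier G. \<not> conjugate_in G x y \<longrightarrow>
       (\<exists>(Q :: nat monoid) \<phi>. group Q \<and> finite (carrier Q) \<and> \<phi> \<in> epi G Q \<and>
          \<not> conjugate_in Q (\<phi> x) (\<phi> y)))"

definition finite_generating_set :: "('a, 'b) monoid_scheme \<Rightarrow> 'a set \<Rightarrow> bool" where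
  "finite_generating_set G S \<longleftrightarrow> finite S \<and> S \<subseteq> carrier G \<and> generate G S = carrier G"

definition word_norm :: "('a, 'b) monoid_scheme \<Rightarrow> 'a set \<Rightarrow> 'a \<Rightarrow> nat" where
  "word_norm G S g =
     (LEAST k. \<exists>ws. length ws = k \<and> set ws \<subseteq> S \<union> m_inv G ` S \<and>
        foldr (\<otimes>\<^bsub>G\<^esub>) ws \<one>\<^bsub>G\<^esub> = g)"

definition finite_index_normal :: "('a, 'b) monoid_scheme \<Rightarrow> 'a set \<Rightarrow> bool" where
  "finite_index_normal G N \<longleftrightarrow> N \<lhd> G \<and> finite (rcosets\<^bsub>G\<^esub> N)"

text \<open>The minima below are over nonempty sets whenever the group is conjugacy separable, which is
  the only case of interest; \<open>card (rcosets\<^bsub>G\<^esub> N)\<close> is the index of \<open>N\<close> in \<open>G\<close>.\<close>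

definition Rf_elem :: "('a, 'b) monoid_scheme \<Rightarrow> 'a \<Rightarrow> nat" where
  "Rf_elem G g =
     (if g = \<one>\<^bsub>G\<^esub> then 1
      else (LEAST k. \<exists>N. finite_index_normal G N \<and> g \<notin> N \<and> k = card (rcosets\<^bsub>G\<^esub> N)))"

definition Conj_elem :: "('a, 'b) monoid_scheme \<Rightarrow> 'a \<Rightarrow> 'a \<Rightarrow> nat" where
  "Conj_elem G x y =
     (if conjugate_in G x y then 1
      else (LEAST k. \<exists>N. finite_index_normal G N \<and>
              \<not> conjugate_in (G Mod N) (N #>\<^bsub>G\<^esub> x) (N #>\<^bsub>G\<^esub> y) \<and>
              k = card (rcosets\<^bsub>G\<^esub> N)))"

text \<open>As \<open>S\<close> is a finite generating set, only finitely many elements have norm at most \<open>n\<close>, so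
  that these maxima exist.\<close>

definition Rf_growth :: "('a, 'b) monoid_scheme \<Rightarrow> 'a set \<Rightarrow> nat \<Rightarrow> nat" where
  "Rf_growth G S n = Max {Rf_elem G g | g. g \<in> carrier G \<and> word_norm G S g \<le> n}"

definition Conj_growth :: "('a, 'b) monoid_scheme \<Rightarrow> 'a set \<Rightarrow> nat \<Rightarrow> nat" where
  "Conj_growth G S n =
     Max {Conj_elem G x y | x y. x \<in> carrier G \<and> y \<in> carrier G \<and>
            word_norm G S x \<le> n \<and> word_norm G S y \<le> n}"

text \<open>Growth functions have the positive integers as their domain, so values at \<open>0\<close> are ignored
  throughout.\<close>

definition growth_le :: "(nat \<Rightarrow> real) \<Rightarrow> (nat \<Rightarrow> real) \<Rightarrow> bool" where
  "growth_le f g \<longleftrightarrow> (\<exists>c\<ge>1. \<forall>n\<ge>1. f n \<le> g (c * n))"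

definition growth_equiv :: "(nat \<Rightarrow> real) \<Rightarrow> (nat \<Rightarrow> real) \<Rightarrow> bool" where
  "growth_equiv f g \<longleftrightarrow> growth_le f g \<and> growth_le g f"

definition fast_growing :: "(nat \<Rightarrow> nat) \<Rightarrow> bool" where
  "fast_growing F \<longleftrightarrow>
     (\<exists>C \<epsilon> :: real. C > 0 \<and> \<epsilon> > 0 \<and>
        (\<forall>n\<ge>3. real (F n) \<ge>
           exp (C * real n * (ln (real n))^2 * (ln (ln (real n))) powr (1 + \<epsilon>))))"

definition power_dominated :: "(nat \<Rightarrow> nat) \<Rightarrow> bool" where
  "power_dominated F \<longleftrightarrow>
     (\<exists>(C1 :: real) (C2 :: nat). C1 > 1 \<and> C2 > 1 \<and>
        (\<forall>n\<ge>1. real (F n) powr C1 \<le> real (F (C2 * n))))"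

end

theory Submission
  imports Defs "HOL-Library.Poly_Mapping" "HOL-Library.Z2" "HOL-Library.Function_Algebras"
    "HOL-Library.Countable_Set"
begin

text \<open>
  The group is center-by-metabelian in the style of P. Hall: commuting lamps \<open>a\<^sub>i\<close>, \<open>a'\<^sub>i\<close> of order two
  and commuting lamps \<open>c\<^sub>i\<close> of order two, permuted by a shift \<open>b\<close>, with central commutators
  \<open>[a\<^sub>i, c\<^sub>j] = s\<^bsub>i+j\<^esub>\<close> and \<open>[a'\<^sub>i, c\<^sub>j] = t\<^bsub>i+j\<^esub>\<close>, where \<open>s\<close> and \<open>t\<close> are arbitrary sequences in an
  elementary abelian 2-group. A finite quotient of order less than \<open>2 ^ 2 ^ r\<close> makes both sequences
  periodic with period an odd multiple of \<open>2 ^ r\<close>, and conversely 2-power periodic coordinates of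
  period \<open>M\<close> are visible in a quotient of order \<open>2 ^ O(M)\<close>.

  The sequences are chosen coordinatewise, with periods \<open>8 ^ t\<close>. For the scale \<open>j\<close> the element \<open>t\<^sub>k\<close>,
  \<open>k = 8 ^ (d * j)\<close>, is nonzero in coordinates whose periods run from \<open>log F1\<close> up to \<open>log F2\<close> of that
  scale; this determines the residual finiteness growth. In all of them but the last one, \<open>t\<^sub>k\<close> agrees
  with some \<open>s\<^sub>i\<close> for a far away \<open>i\<close>, so that \<open>a\<close> and \<open>a t\<^sub>k\<close> become conjugate in every quotient that does
  not see the last coordinate; there \<open>s\<close> vanishes, which determines the conjugacy growth.
\<close>

section \<open>Laurent polynomials over the field with two elements\<close>

text \<open>A finite quotient bounds only the 2-part of the shift period, and forces it up only at
  the price of a doubly exponential order. Hence the periods are powers of two and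
  \<open>F1\<close>, \<open>F2\<close> are compared on a doubly exponential scale. The upper bounds
  shape the construction, since they concern every element of a ball. A central element may vanish
  in all coordinates of short period and yet involve \<open>t_k\<close> of a smaller scale; to
  detect it at the price \<open>F1\<close> of its own scale, \<open>t_k\<close> must be nonzero at
  every \<open>F1\<close>-period between its first and its last one. This is the origin of the
  intermediate members of \<open>\<Theta>\<close>. For conjugacy, a conjugator known only modulo a
  period \<open>M\<close> must be corrected to an exact one, and the correction must not disturb
  coordinates of longer period. Their sequences therefore need zones of zeros, one around 0 and one
  at distance of order \<open>M\<close>; octal periods leave room for both. The second family of
  lamps makes each \<open>t_k\<close> a commutator without enlarging the conjugacy class of
  \<open>a\<close>: the central elements \<open>z\<close> for which \<open>a\<close> and
  \<open>a z\<close> are conjugate are exactly the values of \<open>S\<close>.\<close>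

declare add_bit_eq_xor [simp del] mult_bit_eq_and [simp del]

type_synonym laurent = "int \<Rightarrow>\<^sub>0 bit"

abbreviation keys :: "('a \<Rightarrow>\<^sub>0 'b::zero) \<Rightarrow> 'a set" where
  "keys \<equiv> Poly_Mapping.keys"

abbreviation lookup :: "('a \<Rightarrow>\<^sub>0 'b::zero) \<Rightarrow> 'a \<Rightarrow> 'b" where
  "lookup \<equiv> Poly_Mapping.lookup"

definition X :: "int \<Rightarrow> laurent" where
  "X k = Poly_Mapping.single k 1"

lemma X_add: "X (a + b) = X a * X b"
  by (simp add: X_def mult_single)

lemma X_0 [simp]: "X 0 = 1"
  by (simp add: X_def)

lemma X_inverse [simp]: "X a * X (- a) = 1" "X (- a) * X a = 1"
  by (simp_all flip: X_add)

lemma keys_X [simp]: "keys (X k) = {k}"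
  by (simp add: X_def)

lemma lookup_X: "lookup (X k) i = (if i = k then 1 else 0)"
  by (simp add: X_def lookup_single when_def)

lemma lookup_X_mult: "lookup (X p * f) k = lookup f (k - p)"
proof -
  have "lookup (X p * f) k = lookup (X p * f) k" ..
  have *: "lookup (X p * f) k = (\<Sum>l. lookup (X p) l * (\<Sum>q. lookup f q when k = l + q))"
    by (simp add: lookup_mult)
  have "(\<Sum>l. lookup (X p) l * (\<Sum>q. lookup f q when k = l + q)) =
    (\<Sum>l. (\<Sum>q. lookup f q when k = l + q) when l = p)"
    by (rule Sum_any.cong) (auto simp: lookup_X)
  also have "\<dots> = (\<Sum>q. lookup f q when k = p + q)"
    by simp
  also have "\<dots> = (\<Sum>q. lookup f q when q = k - p)"
    by (rule Sum_any.cong) (auto simp: when_def)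
  also have "\<dots> = lookup f (k - p)"
    by simp
  finally show ?thesis using * by simp
qed

lemma keys_X_mult: "keys (X p * f) = (+) p ` keys f"
  by (force simp: in_keys_iff lookup_X_mult image_iff)

lemma bit_add_self [simp]: "(x::bit) + x = 0"
  by (cases x) auto

lemma bit_add_eq_0: "(x::bit) + y = 0 \<longleftrightarrow> x = y"
  by (cases x; cases y) auto

lemma laurent_add_self [simp]: "(f::laurent) + f = 0"
  by (rule poly_mapping_eqI) (simp only: lookup_add bit_add_self lookup_zero)

lemma laurent_two [simp]: "(2::laurent) = 0"
  using laurent_add_self[of 1] by (simp only: one_add_one)

lemma laurent_add_self_left [simp]: "(f::laurent) + (f + g) = g"
  by (simp flip: add.assoc)

lemma laurent_add_eq_0: "(f::laurent) + g = 0 \<longleftrightarrow> f = g"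
proof
  assume "f + g = 0"
  moreover have "f = (f + g) + g" by (simp only: add.assoc laurent_add_self add_0_right)
  ultimately show "f = g" by simp
qed simp

lemma bool_fun_add_self [simp]: "(\<alpha> :: 'a \<Rightarrow> bit) + \<alpha> = 0"
  by (rule ext) (simp only: plus_fun_apply bit_add_self zero_fun_apply)

lemma laurent_square: "(f + g) ^ 2 = f ^ 2 + (g::laurent) ^ 2"
proof -
  have "(f + g) ^ 2 = f ^ 2 + g ^ 2 + (f * g + f * g)"
    by (simp add: power2_eq_square algebra_simps)
  then show ?thesis by simp
qed

text \<open>The Frobenius map of characteristic 2. It turns nilpotence of \<open>X q + 1\<close>
  into periodicity with a 2-power factor, and \<open>r = 1\<close> gives
  \<open>cyc (2 * M) = cyc M * cyc M\<close>.\<close>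

lemma X_frobenius: "(X k + 1) ^ (2 ^ r) = X (2 ^ r * k) + 1"
proof (induction r)
  case (Suc r)
  have "(X k + 1) ^ (2 ^ Suc r) = ((X k + 1) ^ (2 ^ r)) ^ 2"
    by (metis power_Suc2 power_mult)
  also have "\<dots> = X (2 ^ r * k) ^ 2 + 1"
    by (simp only: Suc laurent_square power_one)
  finally show ?case
    by (simp add: power2_eq_square ac_simps flip: X_add)
qed simp

lemma laurent_induct [case_names zero add]:
  assumes "P 0" "\<And>k f. P f \<Longrightarrow> P (X k + f)"
  shows "P (f::laurent)"
proof (induction f rule: update_induct)
  case const
  then show ?case using assms(1) by simp
next
  case (update f a b)
  then have "b = 1" by (cases b) auto
  moreover have "lookup f a = 0" using update by (simp add: in_keys_iff)
  ultimately have "Poly_Mapping.update a b f = X a + f"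
    by (intro poly_mapping_eqI) (auto simp: lookup_update lookup_add lookup_X)
  then show ?case using assms(2) update by simp
qed

lemma countable_laurent: "countable (UNIV :: laurent set)"
proof -
  have "(UNIV :: laurent set) \<subseteq> range (\<lambda>ks. sum_list (map X ks))"
  proof
    fix f :: laurent
    show "f \<in> range (\<lambda>ks. sum_list (map X ks))"
    proof (induction f rule: laurent_induct)
      case zero
      show ?case by (rule range_eqI[of _ _ "[]"]) simp
    next
      case (add k f)
      then obtain ks where "f = sum_list (map X ks)" by auto
      then show ?case by (intro range_eqI[of _ _ "k # ks"]) simp
    qed
  qed
  then show ?thesis
    by (rule countable_subset) simp
qed

lemma keys_mult_int: 
  assumes "keys f \<subseteq> {a..b}" "keys (g::laurent) \<subseteq> {c..d}"
  shows "keys (f * g) \<subseteq> {a + c..b + d}"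
  using keys_mult[of f g] assms by fastforce

lemma keys_X_mult_int:
  assumes "keys f \<subseteq> {a..b}"
  shows "keys (X p * f) \<subseteq> {p + a..p + b}"
  using assms by (auto simp: keys_X_mult)

section \<open>Divisibility by binomials and congruence modulo a period\<close>

definition cyc :: "nat \<Rightarrow> laurent" where
  "cyc P = X (int P) + 1"

lemma lookup_binomial_mult: "lookup ((X p + 1) * v) k = lookup v (k - p) + lookup v k"
  by (simp add: distrib_right lookup_add lookup_X_mult)

text \<open>The lowest exponent of \<open>v\<close>, and the highest one shifted by
  \<open>p\<close>, each arise only once in the product, so neither can cancel.\<close>

lemma keys_binomial_mult:
  assumes "p > 0" "keys ((X p + 1) * v) \<subseteq> {l..h}"
  shows "keys v \<subseteq> {l..h - p}"
proof (cases "v = 0")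
  case False
  then have ne: "keys v \<noteq> {}" by simp
  let ?m = "Min (keys v)" and ?M = "Max (keys v)"
  have m: "?m \<in> keys v" and M: "?M \<in> keys v" using ne by auto
  have "?m - p \<notin> keys v"
  proof
    assume "?m - p \<in> keys v"
    then have "?m \<le> ?m - p" by (intro Min_le) simp_all
    then show False using assms(1) by simp
  qed
  moreover have "?M + p \<notin> keys v"
  proof
    assume "?M + p \<in> keys v"
    then have "?M + p \<le> ?M" by (intro Max_ge) simp_all
    then show False using assms(1) by simp
  qed
  ultimately have "?m \<in> keys ((X p + 1) * v)" "?M + p \<in> keys ((X p + 1) * v)"
    using m M by (auto simp: in_keys_iff lookup_binomial_mult)
  then have "l \<le> ?m" "?M + p \<le> h" using assms(2) by auto
  moreover have "?m \<le> k" "k \<le> ?M" if "k \<in> keys v" for k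
    using that by simp_all
  ultimately show ?thesis
    unfolding subset_iff atLeastAtMost_iff by (metis add_le_imp_le_diff add_right_mono order_trans)
qed simp

lemma keys_binomial_mult_neg:
  assumes "p \<noteq> 0" "keys ((X p + 1) * v) \<subseteq> {l..h}"
  shows "keys v \<subseteq> {l..h}"
proof (cases "p > 0")
  case True
  then show ?thesis using keys_binomial_mult[OF True assms(2)] by auto
next
  case False
  have "(X (- p) + 1) * v = X (- p) * ((X p + 1) * v)"
    by (simp only: mult.assoc[symmetric] distrib_left X_inverse mult_1_right add.commute)
  then have "keys ((X (- p) + 1) * v) \<subseteq> {- p + l..- p + h}"
    using keys_X_mult_int[OF assms(2), of "- p"] by (simp only:)
  then have "keys v \<subseteq> {- p + l..h}"
    using keys_binomial_mult[of "- p" v "- p + l" "- p + h"] False assms(1) by simp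
  then show ?thesis using False by auto
qed

text \<open>The cofactor would be supported in an empty interval. This is how congruences between
  elements of small support become equalities.\<close>

lemma cyc_dvd_short:
  assumes "cyc P dvd f" "keys f \<subseteq> {l..<l + int P}"
  shows "f = 0"
proof (cases "P = 0")
  case False
  obtain v where v: "f = (X (int P) + 1) * v" using assms(1) by (auto simp: cyc_def dvd_def)
  have "keys f \<subseteq> {l..l + int P - 1}" using assms(2) by auto
  then have "keys v \<subseteq> {l..l + int P - 1 - int P}"
    using keys_binomial_mult[of "int P" v l "l + int P - 1"] v False by simp
  then have "v = 0" by simp
  then show ?thesis using v by simp
qed (use assms in auto)

text \<open>The geometric sum, by induction in both directions because \<open>l\<close> may be a
  negative Bezout coefficient.\<close>

lemma dvd_binomial_mult: "X k + 1 dvd X (l * k) + 1"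
proof (induction l rule: int_induct[where k = 0])
  case (step1 i)
  have "(i + 1) * k = k + i * k"
    by (simp add: algebra_simps)
  then have "X ((i + 1) * k) = X k * X (i * k)"
    by (simp only: X_add)
  then have "X ((i + 1) * k) + 1 = X k * (X (i * k) + 1) + (X k + 1)"
    by (simp add: algebra_simps)
  then show ?case by (simp only: dvd_add[OF dvd_mult[OF step1(2)] dvd_refl] dvd_mult[OF dvd_add[OF step1(2) dvd_refl]])
next
  case (step2 i)
  have "(i - 1) * k = - k + i * k"
    by (simp add: algebra_simps)
  then have "X ((i - 1) * k) = X (- k) * X (i * k)"
    by (simp only: X_add)
  then have "X ((i - 1) * k) + 1 = X (- k) * ((X (i * k) + 1) + (X k + 1))"
    by (simp add: algebra_simps)
  then show ?case by (simp only: dvd_add[OF dvd_mult[OF step2(2)] dvd_refl] dvd_mult[OF dvd_add[OF step2(2) dvd_refl]])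
qed simp

lemma cyc_dvd_X_diff:
  assumes "int P dvd a - b"
  shows "cyc P dvd X a + X b"
proof -
  obtain l where l: "a - b = int P * l" using assms by (rule dvdE)
  have "a = b + l * int P" using l by (simp add: algebra_simps)
  then have "X a + X b = X b * (X (l * int P) + 1)"
    by (simp only: X_add distrib_left mult_1_right)
  then show ?thesis using dvd_binomial_mult[of "int P" l] by (simp add: cyc_def)
qed

text \<open>The left end \<open>l\<close> is free: it is 0 for canonical residues, and far to the
  right when correction terms are moved into a zone of zeros.\<close>

lemma ex_short_representative:
  assumes "M > 0"
  obtains f' where "keys f' \<subseteq> {l..<l + int M}" "cyc M dvd f + f'"
proof -
  have "\<exists>f'. keys f' \<subseteq> {l..<l + int M} \<and> cyc M dvd f + f'"
  proof (induction f rule: laurent_induct)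
    case zero
    show ?case by (rule exI[of _ 0]) simp
  next
    case (add k f)
    then obtain f' where f': "keys f' \<subseteq> {l..<l + int M}" "cyc M dvd f + f'" by blast
    define k' where "k' = l + (k - l) mod int M"
    have k': "k' \<in> {l..<l + int M}" using assms by (simp add: k'_def)
    have "k - k' = (k - l) - (k - l) mod int M" by (simp add: k'_def)
    then have "int M dvd k - k'" by (simp only: dvd_minus_mod)
    then have "cyc M dvd (X k + X k') + (f + f')"
      by (rule dvd_add[OF cyc_dvd_X_diff f'(2)])
    moreover have "(X k + X k') + (f + f') = X k + f + (X k' + f')"
      by (simp only: ac_simps)
    moreover have "keys (X k' + f') \<subseteq> {l..<l + int M}"
      using keys_add[of "X k'" f'] k' f' by auto
    ultimately show ?case by (intro exI[of _ "X k' + f'"]) (simp only: simp_thms)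
  qed
  then show ?thesis using that by blast
qed

text \<open>The support estimate with the empty interval \<open>{1..0}\<close> shows that
  \<open>X p + 1\<close> is no zero divisor.\<close>

lemma binomial_cancel:
  assumes "p \<noteq> 0" "(X p + 1) * v = (X p + 1) * w"
  shows "v = w"
proof -
  have zero: "(X p + 1) * (v + w) = 0"
    unfolding distrib_left assms(2) by (rule laurent_add_self)
  have "keys (v + w) \<subseteq> {1..0}"
    by (rule keys_binomial_mult_neg[OF assms(1)]) (unfold zero keys_zero, rule empty_subsetI)
  then have "v + w = 0" by simp
  then show ?thesis by (simp only: laurent_add_eq_0)
qed

section \<open>Linear functionals given by sequences of bits\<close>

definition lin :: "(int \<Rightarrow> bit) \<Rightarrow> laurent \<Rightarrow> bit" where
  "lin v f = (\<Sum>k\<in>keys f. v k)"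

lemma lin_superset:
  assumes "finite A" "keys f \<subseteq> A"
  shows "lin v f = (\<Sum>k\<in>A. lookup f k * v k)"
proof -
  have "(\<Sum>k\<in>A. lookup f k * v k) = (\<Sum>k\<in>keys f. lookup f k * v k)"
    using assms by (intro sum.mono_neutral_right) (auto simp: in_keys_iff)
  also have "\<dots> = (\<Sum>k\<in>keys f. v k)"
    by (rule sum.cong) (auto simp: in_keys_iff)
  finally show ?thesis by (simp add: lin_def)
qed

lemma lin_add: "lin v (f + g) = lin v f + lin v g"
proof -
  have "lin v h = (\<Sum>k\<in>keys f \<union> keys g. lookup h k * v k)"
    if "keys h \<subseteq> keys f \<union> keys g" for h
    using that by (intro lin_superset) auto
  then show ?thesis
    using keys_add[of f g] by (simp add: lookup_add distrib_right sum.distrib)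
qed

lemma lin_0 [simp]: "lin v 0 = 0"
  by (simp add: lin_def)

lemma lin_X [simp]: "lin v (X k) = v k"
  by (simp add: lin_def)

lemma lin_X_mult: "lin v (X p * f) = lin (\<lambda>k. v (p + k)) f"
  by (simp add: lin_def keys_X_mult sum.reindex)

lemma lin_eq_0: "(\<And>k. k \<in> keys f \<Longrightarrow> v k = 0) \<Longrightarrow> lin v f = 0"
  by (simp add: lin_def)

text \<open>A periodic sequence gives \<open>X P * g\<close> and \<open>g\<close> the same value,
  and equal bits cancel.\<close>

lemma lin_cyc:
  assumes "\<And>k. v (k + int P) = v k" "cyc P dvd f"
  shows "lin v f = 0"
proof -
  obtain g where "f = (X (int P) + 1) * g" using assms(2) by (auto simp: cyc_def dvd_def)
  then have "lin v f = lin v (X (int P) * g) + lin v g" by (simp add: distrib_right lin_add)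
  also have "lin v (X (int P) * g) = lin v g"
    using assms(1) by (simp add: lin_X_mult add.commute)
  finally show ?thesis by simp
qed

lemma lin_cyc_cong:
  assumes "\<And>k. v (k + int P) = v k" "cyc P dvd f + g"
  shows "lin v f = lin v g"
  using lin_cyc[where v = v, OF assms] by (simp add: lin_add bit_add_eq_0)

section \<open>Detection by finite quotients\<close>

text \<open>Monotone in \<open>m\<close>, this replaces the minima: upper bounds exhibit one
  quotient, lower bounds restrict all of them.\<close>

definition detect :: "('a, 'b) monoid_scheme \<Rightarrow> 'a \<Rightarrow> nat \<Rightarrow> bool" where
  "detect G x m \<longleftrightarrow>
     (\<exists>N. finite_index_normal G N \<and> x \<notin> N \<and> card (rcosets\<^bsub>G\<^esub> N) \<le> m)"

definition conj_detect :: "('a, 'b) monoid_scheme \<Rightarrow> 'a \<Rightarrow> 'a \<Rightarrow> nat \<Rightarrow> bool" where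
  "conj_detect G x y m \<longleftrightarrow>
     (\<exists>N. finite_index_normal G N \<and> \<not> conjugate_in (G Mod N) (N #>\<^bsub>G\<^esub> x) (N #>\<^bsub>G\<^esub> y) \<and>
        card (rcosets\<^bsub>G\<^esub> N) \<le> m)"

lemma Rf_elem_le:
  assumes "detect G x m" "x \<noteq> \<one>\<^bsub>G\<^esub>"
  shows "Rf_elem G x \<le> m"
proof -
  obtain N where N: "finite_index_normal G N" "x \<notin> N" "card (rcosets\<^bsub>G\<^esub> N) \<le> m"
    using assms(1) by (auto simp: detect_def)
  have "Rf_elem G x \<le> card (rcosets\<^bsub>G\<^esub> N)"
    unfolding Rf_elem_def using assms(2) N by (auto intro!: Least_le)
  then show ?thesis using N by simp
qed

lemma Rf_elem_ge:
  assumes "\<exists>m. detect G x m" "x \<noteq> \<one>\<^bsub>G\<^esub>" "\<And>m. detect G x m \<Longrightarrow> L \<le> m"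
  shows "L \<le> Rf_elem G x"
proof -
  let ?P = "\<lambda>k. \<exists>N. finite_index_normal G N \<and> x \<notin> N \<and> k = card (rcosets\<^bsub>G\<^esub> N)"
  have "\<exists>k. ?P k" using assms(1) by (auto simp: detect_def)
  then have "?P (LEAST k. ?P k)" by (rule LeastI_ex)
  then have "detect G x (LEAST k. ?P k)" by (auto simp: detect_def)
  then have "L \<le> (LEAST k. ?P k)" by (rule assms(3))
  then show ?thesis using assms(2) by (simp add: Rf_elem_def)
qed

lemma Conj_elem_le:
  assumes "conj_detect G x y m" "\<not> conjugate_in G x y"
  shows "Conj_elem G x y \<le> m"
proof -
  obtain N where N: "finite_index_normal G N"
    "\<not> conjugate_in (G Mod N) (N #>\<^bsub>G\<^esub> x) (N #>\<^bsub>G\<^esub> y)" "card (rcosets\<^bsub>G\<^esub> N) \<le> m"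
    using assms(1) by (auto simp: conj_detect_def)
  have "Conj_elem G x y \<le> card (rcosets\<^bsub>G\<^esub> N)"
    unfolding Conj_elem_def using assms(2) N by (auto intro!: Least_le)
  then show ?thesis using N by simp
qed

lemma Conj_elem_ge:
  assumes "\<exists>m. conj_detect G x y m" "\<not> conjugate_in G x y"
    "\<And>m. conj_detect G x y m \<Longrightarrow> L \<le> m"
  shows "L \<le> Conj_elem G x y"
proof -
  let ?P = "\<lambda>k. \<exists>N. finite_index_normal G N \<and>
    \<not> conjugate_in (G Mod N) (N #>\<^bsub>G\<^esub> x) (N #>\<^bsub>G\<^esub> y) \<and> k = card (rcosets\<^bsub>G\<^esub> N)"
  have "\<exists>k. ?P k" using assms(1) by (auto simp: conj_detect_def)
  then have "?P (LEAST k. ?P k)" by (rule LeastI_ex)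
  then have "conj_detect G x y (LEAST k. ?P k)" by (auto simp: conj_detect_def)
  then have "L \<le> (LEAST k. ?P k)" by (rule assms(3))
  then show ?thesis using assms(2) by (simp add: Conj_elem_def)
qed

lemma conjugate_in_hom:
  assumes "group G" "group H" "f \<in> hom G H" "conjugate_in G x y" "x \<in> carrier G"
  shows "conjugate_in H (f x) (f y)"
proof -
  interpret group_hom G H f using assms by (simp add: group_hom_def group_hom_axioms_def)
  obtain h where h: "h \<in> carrier G" "y = h \<otimes>\<^bsub>G\<^esub> x \<otimes>\<^bsub>G\<^esub> inv\<^bsub>G\<^esub> h"
    using assms(4) by (auto simp: conjugate_in_def)
  then have "f y = f h \<otimes>\<^bsub>H\<^esub> f x \<otimes>\<^bsub>H\<^esub> inv\<^bsub>H\<^esub> f h" using assms(5) by simp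
  then show ?thesis using h by (auto simp: conjugate_in_def)
qed

lemma (in group) conjugate_in_iff:
  assumes "x \<in> carrier G" "y \<in> carrier G"
  shows "conjugate_in G x y \<longleftrightarrow> (\<exists>h\<in>carrier G. h \<otimes> x = y \<otimes> h)"
  unfolding conjugate_in_def using assms
  by (intro bex_cong refl) (metis inv_solve_right m_closed)

text \<open>Serves twice: for finite quotients, as \<open>conjugacy_separable\<close> asks for
  targets on \<open>nat\<close>, and for the group finally constructed.\<close>

definition nat_copy :: "('a, 'b) monoid_scheme \<Rightarrow> nat monoid" where
  "nat_copy G = (let f = to_nat_on (carrier G); g = from_nat_into (carrier G) in
     \<lparr>carrier = f ` carrier G, mult = (\<lambda>x y. f (g x \<otimes>\<^bsub>G\<^esub> g y)), one = f \<one>\<^bsub>G\<^esub>\<rparr>)"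

lemma nat_copy_iso:
  assumes "group G" "countable (carrier G)"
  shows "to_nat_on (carrier G) \<in> iso G (nat_copy G)"
proof -
  interpret group G by fact
  have "to_nat_on (carrier G) \<in> hom G (nat_copy G)"
    by (rule homI) (auto simp: nat_copy_def Let_def assms(2))
  moreover have "inj_on (to_nat_on (carrier G)) (carrier G)"
    using assms(2) by (rule inj_on_to_nat_on)
  ultimately show ?thesis
    by (auto simp: iso_def bij_betw_def nat_copy_def Let_def)
qed

lemma nat_copy_group:
  assumes "group G" "countable (carrier G)"
  shows "group (nat_copy G)"
proof -
  interpret group G by fact
  have iso: "G \<cong> nat_copy G" using nat_copy_iso[OF assms] by (auto simp: is_iso_def)
  have "monoid (nat_copy G)"
    by unfold_locales (auto simp: nat_copy_def Let_def assms(2) m_assoc)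
  then show ?thesis using iso_imp_group[OF iso] by simp
qed

lemma (in group) factor_hom:
  assumes "N \<lhd> G"
  shows "(\<lambda>x. N #> x) \<in> hom G (G Mod N)" "group (G Mod N)"
    "(\<lambda>x. N #> x) ` carrier G = carrier (G Mod N)"
  using assms normal.r_coset_hom_Mod normal.factorgroup_is_group
  by (blast, blast, auto simp: FactGroup_def RCOSETS_def)

text \<open>Cosets of a normal subgroup and an epimorphism with that kernel carry the same
  information, and a finite target can be moved to \<open>nat\<close>. In this form detection
  composes with epimorphisms.\<close>

lemma detect_iff_hom:
  fixes G (structure)
  assumes "group G" "x \<in> carrier G"
  shows "detect G x m \<longleftrightarrow> (\<exists>(Q::nat monoid) \<phi>. group Q \<and> finite (carrier Q) \<and> \<phi> \<in> epi G Q \<and>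
    \<phi> x \<noteq> \<one>\<^bsub>Q\<^esub> \<and> card (carrier Q) \<le> m)" (is "?L \<longleftrightarrow> ?R")
    and conj_detect_iff_hom: "y \<in> carrier G \<Longrightarrow>
    conj_detect G x y m \<longleftrightarrow> (\<exists>(Q::nat monoid) \<phi>. group Q \<and> finite (carrier Q) \<and> \<phi> \<in> epi G Q \<and>
    \<not> conjugate_in Q (\<phi> x) (\<phi> y) \<and> card (carrier Q) \<le> m)" (is "_ \<Longrightarrow> ?CL \<longleftrightarrow> ?CR")
proof -
  interpret group G by fact
  have quot: "\<exists>(Q::nat monoid) \<psi>. group Q \<and> finite (carrier Q) \<and> \<psi> \<in> iso (G Mod N) Q \<and>
      (\<lambda>z. \<psi> (N #> z)) \<in> epi G Q \<and> card (carrier Q) = card (rcosets N)"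
    if "finite_index_normal G N" for N
  proof -
    have N: "N \<lhd> G" "finite (rcosets N)" using that by (auto simp: finite_index_normal_def)
    define Q where "Q = nat_copy (G Mod N)"
    define \<psi> where "\<psi> = to_nat_on (carrier (G Mod N))"
    have fin: "finite (carrier (G Mod N))" using N by (simp add: FactGroup_def)
    have iso: "\<psi> \<in> iso (G Mod N) Q"
      unfolding \<psi>_def Q_def using factor_hom[OF N(1)] fin by (intro nat_copy_iso countable_finite) auto
    have grp: "group Q"
      unfolding Q_def using factor_hom[OF N(1)] fin by (intro nat_copy_group countable_finite) auto
    have bij: "bij_betw \<psi> (carrier (G Mod N)) (carrier Q)" using iso by (simp add: iso_def)
    have "(\<psi> \<circ> (\<lambda>x. N #> x)) \<in> epi G Q"
      using factor_hom[OF N(1)] iso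
      by (intro epi_compose[of _ _ "G Mod N"]) (auto simp: epi_def iso_def bij_betw_def)
    moreover have "card (carrier Q) = card (rcosets N)"
      using bij_betw_same_card[OF bij] by (simp add: FactGroup_def)
    moreover have "finite (carrier Q)" using bij fin by (metis bij_betw_finite)
    ultimately show ?thesis using grp iso by (auto simp: comp_def)
  qed
  have ker: "finite_index_normal G (kernel G Q \<phi>)" "card (rcosets (kernel G Q \<phi>)) = card (carrier Q)"
    "(\<lambda>X. the_elem (\<phi> ` X)) \<in> iso (G Mod kernel G Q \<phi>) Q"
    "z \<in> carrier G \<Longrightarrow> the_elem (\<phi> ` (kernel G Q \<phi> #> z)) = \<phi> z"
    if "group Q" "finite (carrier Q)" "\<phi> \<in> epi G Q" for Q :: "nat monoid" and \<phi> z
  proof -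
    interpret h: group_hom G Q \<phi>
      using that \<open>group G\<close> by (simp add: group_hom_def group_hom_axioms_def epi_def)
    show iso: "(\<lambda>X. the_elem (\<phi> ` X)) \<in> iso (G Mod kernel G Q \<phi>) Q"
      using that by (intro h.FactGroup_iso_set) (simp add: epi_def)
    then have bij: "bij_betw (\<lambda>X. the_elem (\<phi> ` X)) (rcosets (kernel G Q \<phi>)) (carrier Q)"
      by (simp add: iso_def FactGroup_def)
    then show "card (rcosets (kernel G Q \<phi>)) = card (carrier Q)" by (rule bij_betw_same_card)
    show "finite_index_normal G (kernel G Q \<phi>)"
      using bij that bij_betw_finite by (auto simp: finite_index_normal_def h.normal_kernel)
    show "the_elem (\<phi> ` (kernel G Q \<phi> #> z)) = \<phi> z" if "z \<in> carrier G"
    proof -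
      have "\<phi> ` (kernel G Q \<phi> #> z) = {\<phi> z}"
        using that h.subgroup_kernel subgroup.one_closed[of "kernel G Q \<phi>" G]
        by (auto simp: r_coset_def kernel_def image_iff)
      then show ?thesis by simp
    qed
  qed
  show "?L \<longleftrightarrow> ?R"
  proof
    assume ?L
    then obtain N where N: "finite_index_normal G N" "x \<notin> N" "card (rcosets N) \<le> m"
      by (auto simp: detect_def)
    then obtain Q \<psi> where Q: "group Q" "finite (carrier (Q::nat monoid))" "\<psi> \<in> iso (G Mod N) Q"
      "(\<lambda>z. \<psi> (N #> z)) \<in> epi G Q" "card (carrier Q) = card (rcosets N)"
      using quot by blast
    have Nn: "N \<lhd> G" using N by (simp add: finite_index_normal_def)
    have "\<psi> (N #> x) \<noteq> \<one>\<^bsub>Q\<^esub>"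
    proof
      assume "\<psi> (N #> x) = \<one>\<^bsub>Q\<^esub>"
      moreover have "\<psi> \<one>\<^bsub>G Mod N\<^esub> = \<one>\<^bsub>Q\<^esub>"
        using hom_one[of \<psi> "G Mod N" Q] Q(1,3) factor_hom(2)[OF Nn] by (simp add: iso_def)
      moreover have "N #> x \<in> carrier (G Mod N)" "\<one>\<^bsub>G Mod N\<^esub> \<in> carrier (G Mod N)"
        using factor_hom(3)[OF Nn] assms(2) monoid.one_closed[OF group.is_monoid[OF factor_hom(2)[OF Nn]]]
        by blast+
      ultimately have "N #> x = \<one>\<^bsub>G Mod N\<^esub>"
        using Q(3) inj_onD[of \<psi> "carrier (G Mod N)" "N #> x" "\<one>\<^bsub>G Mod N\<^esub>"]
        by (simp add: iso_def bij_betw_def)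
      then have "N #> x = N" by (simp add: FactGroup_def)
      then have "x \<in> N"
        using Nn assms(2) by (metis normal_imp_subgroup rcos_self)
      then show False using N by simp
    qed
    then show ?R using Q N(3) by (intro exI[of _ Q] exI[of _ "\<lambda>z. \<psi> (N #> z)"]) simp
  next
    assume ?R
    then obtain Q \<phi> where Q: "group Q" "finite (carrier (Q::nat monoid))" "\<phi> \<in> epi G Q"
      "\<phi> x \<noteq> \<one>\<^bsub>Q\<^esub>" "card (carrier Q) \<le> m" by blast
    then show ?L
      unfolding detect_def using ker[OF Q(1-3)]
      by (intro exI[of _ "kernel G Q \<phi>"]) (auto simp: kernel_def)
  qed
  show "?CL \<longleftrightarrow> ?CR" if y: "y \<in> carrier G"
  proof
    assume ?CL
    then obtain N where N: "finite_index_normal G N"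
      "\<not> conjugate_in (G Mod N) (N #> x) (N #> y)" "card (rcosets N) \<le> m"
      by (auto simp: conj_detect_def)
    then obtain Q \<psi> where Q: "group Q" "finite (carrier (Q::nat monoid))" "\<psi> \<in> iso (G Mod N) Q"
      "(\<lambda>z. \<psi> (N #> z)) \<in> epi G Q" "card (carrier Q) = card (rcosets N)"
      using quot by blast
    have Nn: "N \<lhd> G" using N by (simp add: finite_index_normal_def)
    note grp = factor_hom(2)[OF Nn]
    have inv: "inv_into (carrier (G Mod N)) \<psi> \<in> hom Q (G Mod N)"
      using group.iso_set_sym[OF grp Q(3)] by (simp add: iso_def)
    have mem: "N #> z \<in> carrier (G Mod N)" if "z \<in> carrier G" for z
      using factor_hom(3)[OF Nn] that by blast
    have "\<not> conjugate_in Q (\<psi> (N #> x)) (\<psi> (N #> y))"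
    proof
      assume "conjugate_in Q (\<psi> (N #> x)) (\<psi> (N #> y))"
      moreover have "\<psi> (N #> x) \<in> carrier Q"
        using Q(3) mem[OF assms(2)] by (auto simp: iso_def hom_def)
      ultimately have "conjugate_in (G Mod N) (inv_into (carrier (G Mod N)) \<psi> (\<psi> (N #> x)))
          (inv_into (carrier (G Mod N)) \<psi> (\<psi> (N #> y)))"
        using conjugate_in_hom[OF Q(1) grp inv] by blast
      moreover have "inj_on \<psi> (carrier (G Mod N))"
        using Q(3) by (simp add: iso_def bij_betw_def)
      ultimately show False using N(2) mem assms(2) y by simp
    qed
    then show ?CR using Q N(3) by (intro exI[of _ Q] exI[of _ "\<lambda>z. \<psi> (N #> z)"]) simp
  next
    assume ?CR
    then obtain Q \<phi> where Q: "group Q" "finite (carrier (Q::nat monoid))" "\<phi> \<in> epi G Q"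
      "\<not> conjugate_in Q (\<phi> x) (\<phi> y)" "card (carrier Q) \<le> m" by blast
    let ?N = "kernel G Q \<phi>"
    note ker = ker[OF Q(1-3)]
    have Nn: "?N \<lhd> G" using ker(1) by (simp add: finite_index_normal_def)
    have "\<not> conjugate_in (G Mod ?N) (?N #> x) (?N #> y)"
    proof
      assume "conjugate_in (G Mod ?N) (?N #> x) (?N #> y)"
      moreover have "?N #> x \<in> carrier (G Mod ?N)"
        using factor_hom(3)[OF Nn] assms(2) by blast
      ultimately have "conjugate_in Q (the_elem (\<phi> ` (?N #> x))) (the_elem (\<phi> ` (?N #> y)))"
        using conjugate_in_hom[OF factor_hom(2)[OF Nn] Q(1)] ker(3) by (auto simp: iso_def)
      then show False using Q(4) ker(4) assms(2) y by simp
    qed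
    then show ?CL
      unfolding conj_detect_def using ker(1,2) Q(5) by (intro exI[of _ ?N]) simp
  qed
qed

lemma detect_hom:
  assumes "group G" "group H" "f \<in> epi G H" "x \<in> carrier G" "detect H (f x) m"
  shows "detect G x m"
proof -
  have fx: "f x \<in> carrier H" using assms(3,4) by (auto simp: epi_def hom_def)
  obtain Q \<phi> where Q: "group Q" "finite (carrier (Q::nat monoid))" "\<phi> \<in> epi H Q"
      "\<phi> (f x) \<noteq> \<one>\<^bsub>Q\<^esub>" "card (carrier Q) \<le> m"
    using assms(5) detect_iff_hom[OF assms(2) fx] by blast
  then show ?thesis
    unfolding detect_iff_hom[OF assms(1,4)]
    using epi_compose[OF assms(3) Q(3)] by (intro exI[of _ Q] exI[of _ "\<phi> \<circ> f"]) simp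
qed

lemma conj_detect_hom:
  assumes "group G" "group H" "f \<in> epi G H" "x \<in> carrier G" "y \<in> carrier G"
    "conj_detect H (f x) (f y) m"
  shows "conj_detect G x y m"
proof -
  have fx: "f x \<in> carrier H" "f y \<in> carrier H" using assms(3-5) by (auto simp: epi_def hom_def)
  obtain Q \<phi> where Q: "group Q" "finite (carrier (Q::nat monoid))" "\<phi> \<in> epi H Q"
      "\<not> conjugate_in Q (\<phi> (f x)) (\<phi> (f y))" "card (carrier Q) \<le> m"
    using assms(6) conj_detect_iff_hom[OF assms(2) fx] by blast
  then show ?thesis
    unfolding conj_detect_iff_hom[OF assms(1,4,5)]
    using epi_compose[OF assms(3) Q(3)] by (intro exI[of _ Q] exI[of _ "\<phi> \<circ> f"]) simp
qed

lemma conjugacy_separableI: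
  assumes "group G"
    "\<And>x y. x \<in> carrier G \<Longrightarrow> y \<in> carrier G \<Longrightarrow> \<not> conjugate_in G x y \<Longrightarrow> \<exists>m. conj_detect G x y m"
  shows "conjugacy_separable G"
  unfolding conjugacy_separable_def
  using assms(2) conj_detect_iff_hom[OF assms(1)] by blast

section \<open>Congruences, words and growth\<close>

text \<open>The map \<open>f\<close> only has to separate the classes of \<open>R\<close>, not to be
  constant on them, so its finite range bounds the index without an exact count.\<close>

locale group_congruence = group G for G (structure) +
  fixes R :: "'a \<Rightarrow> 'a \<Rightarrow> bool" and f :: "'a \<Rightarrow> 'c" and F :: "'c set"
  assumes refl: "x \<in> carrier G \<Longrightarrow> R x x"
    and sym: "R x y \<Longrightarrow> R y x"
    and trans: "R x y \<Longrightarrow> R y z \<Longrightarrow> R x z"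
    and compat: "R x x' \<Longrightarrow> R y y' \<Longrightarrow> x \<in> carrier G \<Longrightarrow> x' \<in> carrier G \<Longrightarrow>
      y \<in> carrier G \<Longrightarrow> y' \<in> carrier G \<Longrightarrow> R (x \<otimes> y) (x' \<otimes> y')"
    and finite_F: "finite F"
    and f_in: "x \<in> carrier G \<Longrightarrow> f x \<in> F"
    and f_eq: "x \<in> carrier G \<Longrightarrow> y \<in> carrier G \<Longrightarrow> f x = f y \<Longrightarrow> R x y"
begin

definition K where "K = {x \<in> carrier G. R x \<one>}"

lemma K_normal: "K \<lhd> G"
proof (rule normal_invI)
  show sub: "subgroup K G"
  proof (rule subgroupI)
    show "K \<noteq> {}" using refl by (auto simp: K_def)
    show "inv x \<in> K" if "x \<in> K" for x
      using that compat[of "inv x" "inv x" \<one> x] refl sym by (auto simp: K_def)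
    show "x \<otimes> y \<in> K" if "x \<in> K" "y \<in> K" for x y
      using that compat[of x \<one> y \<one>] by (auto simp: K_def)
  qed (auto simp: K_def)
  show "h \<otimes> x \<otimes> inv h \<in> K" if "h \<in> carrier G" "x \<in> K" for h x
  proof -
    have x: "x \<in> carrier G" "R x \<one>" using that by (auto simp: K_def)
    have "R (h \<otimes> x) (h \<otimes> \<one>)" by (rule compat) (use x that refl in auto)
    then have "R (h \<otimes> x \<otimes> inv h) (h \<otimes> \<one> \<otimes> inv h)"
      by (intro compat) (use x that refl in auto)
    then show ?thesis using x that by (auto simp: K_def)
  qed
qed

lemma K_coset_eq:
  assumes "x \<in> carrier G" "y \<in> carrier G"
  shows "K #> x = K #> y \<longleftrightarrow> R x y"
proof -
  have sub: "subgroup K G" using K_normal by (rule normal_imp_subgroup)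
  show ?thesis
  proof
    assume "K #> x = K #> y"
    then have "x \<in> K #> y" using rcos_self[OF assms(1) sub] by simp
    then obtain k where k: "k \<in> K" "x = k \<otimes> y" by (auto simp: r_coset_def)
    then have "R (k \<otimes> y) (\<one> \<otimes> y)"
      by (intro compat) (use assms refl in \<open>auto simp: K_def\<close>)
    then show "R x y" using k assms by simp
  next
    assume "R x y"
    then have "R (x \<otimes> inv y) (y \<otimes> inv y)"
      by (intro compat) (use assms refl in auto)
    then have "x \<otimes> inv y \<in> K" using assms by (simp add: K_def)
    moreover have "x = (x \<otimes> inv y) \<otimes> y" using assms by (simp add: m_assoc)
    ultimately have "x \<in> K #> y" by (auto simp: r_coset_def)
    then show "K #> x = K #> y" using repr_independence[OF _ assms(2) sub] by simp
  qed
qed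

lemma card_K_cosets: "finite (rcosets K)" "card (rcosets K) \<le> card F"
proof -
  have "rcosets K \<subseteq> (\<lambda>v. K #> inv_into (carrier G) f v) ` F"
  proof
    fix U assume "U \<in> rcosets K"
    then obtain x where x: "x \<in> carrier G" "U = K #> x" by (auto simp: RCOSETS_def)
    let ?y = "inv_into (carrier G) f (f x)"
    have "?y \<in> carrier G" "f ?y = f x" using x by (auto simp: inv_into_into f_inv_into_f)
    then have "R x ?y" using x(1) by (intro f_eq) auto
    then have "U = K #> ?y" using K_coset_eq x \<open>?y \<in> carrier G\<close> by simp
    then show "U \<in> (\<lambda>v. K #> inv_into (carrier G) f v) ` F" using f_in[OF x(1)] by blast
  qed
  then show "finite (rcosets K)" "card (rcosets K) \<le> card F"
    using finite_F by (auto intro: finite_subset surj_card_le)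
qed

lemma K_finite_index: "finite_index_normal G K"
  by (simp add: finite_index_normal_def K_normal card_K_cosets)

lemma detectI:
  assumes "x \<in> carrier G" "\<not> R x \<one>" "card F \<le> m"
  shows "detect G x m"
  unfolding detect_def using assms K_finite_index card_K_cosets
  by (intro exI[of _ K]) (auto simp: K_def)

lemma conj_detectI:
  assumes "x \<in> carrier G" "y \<in> carrier G" "\<And>h. h \<in> carrier G \<Longrightarrow> \<not> R (h \<otimes> x) (y \<otimes> h)"
    "card F \<le> m"
  shows "conj_detect G x y m"
proof -
  have grp: "group (G Mod K)" and hom: "(\<lambda>x. K #> x) \<in> hom G (G Mod K)"
    and onto: "(\<lambda>x. K #> x) ` carrier G = carrier (G Mod K)"
    using factor_hom[OF K_normal] by auto
  have mem: "K #> z \<in> carrier (G Mod K)" if "z \<in> carrier G" for z using onto that by blast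
  have "\<not> conjugate_in (G Mod K) (K #> x) (K #> y)"
  proof
    assume "conjugate_in (G Mod K) (K #> x) (K #> y)"
    then obtain H where H: "H \<in> carrier (G Mod K)"
      "H \<otimes>\<^bsub>G Mod K\<^esub> (K #> x) = (K #> y) \<otimes>\<^bsub>G Mod K\<^esub> H"
      using group.conjugate_in_iff[OF grp mem mem] assms by blast
    then obtain h where h: "h \<in> carrier G" "H = K #> h" using onto by blast
    have "K #> (h \<otimes> x) = K #> (y \<otimes> h)"
      using H(2) hom_mult[OF hom] h assms(1,2) by simp
    then have "R (h \<otimes> x) (y \<otimes> h)" using K_coset_eq h assms by simp
    then show False using assms(3) h by blast
  qed
  then show ?thesis
    unfolding conj_detect_def using K_finite_index card_K_cosets assms(4)
    by (intro exI[of _ K]) auto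
qed

end

section \<open>Word norms and change of generators\<close>

definition is_word :: "('a, 'b) monoid_scheme \<Rightarrow> 'a set \<Rightarrow> 'a list \<Rightarrow> bool" where
  "is_word G S ws \<longleftrightarrow> set ws \<subseteq> S \<union> m_inv G ` S"

definition eval_word :: "('a, 'b) monoid_scheme \<Rightarrow> 'a list \<Rightarrow> 'a" where
  "eval_word G ws = foldr (\<otimes>\<^bsub>G\<^esub>) ws \<one>\<^bsub>G\<^esub>"

lemma word_norm_le:
  "is_word G S ws \<Longrightarrow> word_norm G S (eval_word G ws) \<le> length ws"
  unfolding word_norm_def is_word_def eval_word_def by (rule Least_le) blast

context group
begin

lemma is_word_carrier: "S \<subseteq> carrier G \<Longrightarrow> is_word G S ws \<Longrightarrow> set ws \<subseteq> carrier G"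
  by (auto simp: is_word_def)

lemma eval_word_closed: "set ws \<subseteq> carrier G \<Longrightarrow> eval_word G ws \<in> carrier G"
  by (induction ws) (auto simp: eval_word_def)

lemma eval_word_Cons: "eval_word G (w # ws) = w \<otimes> eval_word G ws"
  by (simp add: eval_word_def)

lemma eval_word_append:
  "set vs \<subseteq> carrier G \<Longrightarrow> set ws \<subseteq> carrier G \<Longrightarrow>
     eval_word G (vs @ ws) = eval_word G vs \<otimes> eval_word G ws"
proof (induction vs)
  case Nil
  then show ?case using eval_word_closed by (simp add: eval_word_def)
next
  case (Cons v vs)
  then show ?case using eval_word_closed by (auto simp: eval_word_Cons m_assoc)
qed

lemma generate_imp_word:
  assumes "S \<subseteq> carrier G" "g \<in> generate G S"
  shows "\<exists>ws. is_word G S ws \<and> eval_word G ws = g"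
  using assms(2)
proof induction
  case one
  show ?case by (rule exI[of _ "[]"]) (simp add: is_word_def eval_word_def)
next
  case (incl h)
  then show ?case using assms(1)
    by (intro exI[of _ "[h]"]) (auto simp: is_word_def eval_word_def)
next
  case (inv h)
  then show ?case using assms(1)
    by (intro exI[of _ "[inv h]"]) (auto simp: is_word_def eval_word_def)
next
  case (eng h1 h2)
  then obtain ws1 ws2 where "is_word G S ws1" "eval_word G ws1 = h1"
    "is_word G S ws2" "eval_word G ws2 = h2" by blast
  then show ?case using is_word_carrier[OF assms(1)]
    by (intro exI[of _ "ws1 @ ws2"]) (auto simp: eval_word_append is_word_def)
qed

context
  fixes S assumes S: "finite_generating_set G S"
begin

lemma gen_carrier: "S \<subseteq> carrier G"
  using S by (simp add: finite_generating_set_def)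

lemma ex_word_norm:
  assumes "g \<in> carrier G"
  shows "\<exists>ws. is_word G S ws \<and> eval_word G ws = g \<and> length ws = word_norm G S g"
proof -
  let ?P = "\<lambda>k. \<exists>ws. length ws = k \<and> set ws \<subseteq> S \<union> m_inv G ` S \<and> foldr (\<otimes>) ws \<one> = g"
  have "\<exists>k. ?P k"
    using generate_imp_word[OF gen_carrier] S assms
    unfolding finite_generating_set_def is_word_def eval_word_def by metis
  then have "?P (word_norm G S g)" unfolding word_norm_def by (rule LeastI_ex)
  then show ?thesis by (auto simp: is_word_def eval_word_def)
qed

lemma word_norm_mult:
  assumes "g \<in> carrier G" "h \<in> carrier G"
  shows "word_norm G S (g \<otimes> h) \<le> word_norm G S g + word_norm G S h"
proof -
  obtain vs ws where w: "is_word G S vs" "eval_word G vs = g" "length vs = word_norm G S g"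
    "is_word G S ws" "eval_word G ws = h" "length ws = word_norm G S h"
    using ex_word_norm assms by metis
  then have "is_word G S (vs @ ws)" "eval_word G (vs @ ws) = g \<otimes> h"
    using eval_word_append is_word_carrier[OF gen_carrier] by (auto simp: is_word_def)
  then show ?thesis using word_norm_le[of G S "vs @ ws"] w by simp
qed

lemma word_norm_one: "word_norm G S \<one> = 0"
  using word_norm_le[of G S "[]"] by (simp add: is_word_def eval_word_def)

lemma finite_ball: "finite {g \<in> carrier G. word_norm G S g \<le> n}"
proof -
  have "finite (S \<union> m_inv G ` S)" using S by (simp add: finite_generating_set_def)
  then have "finite {ws. set ws \<subseteq> S \<union> m_inv G ` S \<and> length ws \<le> n}"
    by (rule finite_lists_length_le)
  moreover have "{g \<in> carrier G. word_norm G S g \<le> n} \<subseteq>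
      eval_word G ` {ws. set ws \<subseteq> S \<union> m_inv G ` S \<and> length ws \<le> n}"
  proof
    fix g assume "g \<in> {g \<in> carrier G. word_norm G S g \<le> n}"
    then obtain ws where "is_word G S ws" "eval_word G ws = g" "length ws \<le> n"
      using ex_word_norm[of g] by auto
    then show "g \<in> eval_word G ` {ws. set ws \<subseteq> S \<union> m_inv G ` S \<and> length ws \<le> n}"
      by (auto simp: is_word_def)
  qed
  ultimately show ?thesis by (meson finite_imageI finite_subset)
qed

lemma Rf_growth_le:
  assumes "\<And>g. g \<in> carrier G \<Longrightarrow> word_norm G S g \<le> n \<Longrightarrow> Rf_elem G g \<le> m"
  shows "Rf_growth G S n \<le> m"
proof -
  have eq: "{Rf_elem G g |g. g \<in> carrier G \<and> word_norm G S g \<le> n} =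
    Rf_elem G ` {g \<in> carrier G. word_norm G S g \<le> n}" by auto
  show ?thesis
    unfolding Rf_growth_def eq using finite_ball[of n] assms word_norm_one
    by (subst Max_le_iff) (auto intro!: exI[of _ \<one>])
qed

lemma Rf_growth_ge:
  assumes "g \<in> carrier G" "word_norm G S g \<le> n"
  shows "Rf_elem G g \<le> Rf_growth G S n"
proof -
  have eq: "{Rf_elem G g |g. g \<in> carrier G \<and> word_norm G S g \<le> n} =
    Rf_elem G ` {g \<in> carrier G. word_norm G S g \<le> n}" by auto
  show ?thesis
    unfolding Rf_growth_def eq using finite_ball[of n] assms by (intro Max_ge) auto
qed

lemma conj_set_eq:
  "{Conj_elem G x y |x y. x \<in> carrier G \<and> y \<in> carrier G \<and> word_norm G S x \<le> n \<and>
      word_norm G S y \<le> n} =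
   (\<lambda>(x, y). Conj_elem G x y) ` ({g \<in> carrier G. word_norm G S g \<le> n} \<times>
      {g \<in> carrier G. word_norm G S g \<le> n})"
  by (auto simp: image_iff)

lemma Conj_growth_le:
  assumes "\<And>x y. x \<in> carrier G \<Longrightarrow> y \<in> carrier G \<Longrightarrow> word_norm G S x \<le> n \<Longrightarrow>
    word_norm G S y \<le> n \<Longrightarrow> Conj_elem G x y \<le> m"
  shows "Conj_growth G S n \<le> m"
  unfolding Conj_growth_def conj_set_eq using finite_ball[of n] assms word_norm_one
  by (subst Max_le_iff) (auto intro!: exI[of _ \<one>])

lemma Conj_growth_ge:
  assumes "x \<in> carrier G" "y \<in> carrier G" "word_norm G S x \<le> n" "word_norm G S y \<le> n"
  shows "Conj_elem G x y \<le> Conj_growth G S n"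
  unfolding Conj_growth_def conj_set_eq using finite_ball[of n] assms
  by (intro Max_ge finite_imageI finite_cartesian_product image_eqI[of _ _ "(x, y)"]) auto

end

lemma word_norm_compare:
  assumes S: "finite_generating_set G S" and T: "finite_generating_set G T"
  obtains C where "C \<ge> 1" "\<And>g. g \<in> carrier G \<Longrightarrow> word_norm G T g \<le> C * word_norm G S g"
proof -
  define C where "C = Suc (Max (insert 0 (word_norm G T ` (S \<union> m_inv G ` S))))"
  have fin: "finite (S \<union> m_inv G ` S)" using S by (simp add: finite_generating_set_def)
  have C: "word_norm G T s \<le> C" if "s \<in> S \<union> m_inv G ` S" for s
    unfolding C_def using fin that by (intro le_SucI Max_ge) auto
  have sub: "S \<union> m_inv G ` S \<subseteq> carrier G"
    using gen_carrier[OF S] by auto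
  have *: "word_norm G T (eval_word G ws) \<le> C * length ws" if "is_word G S ws" for ws
    using that
  proof (induction ws)
    case Nil
    then show ?case using word_norm_one[OF T] by (simp add: eval_word_def)
  next
    case (Cons w ws)
    then have w: "w \<in> S \<union> m_inv G ` S" "is_word G S ws" by (auto simp: is_word_def)
    then have "word_norm G T (eval_word G (w # ws)) \<le>
        word_norm G T w + word_norm G T (eval_word G ws)"
      unfolding eval_word_Cons using sub is_word_carrier[OF gen_carrier[OF S] w(2)]
      by (intro word_norm_mult[OF T] eval_word_closed) auto
    also have "\<dots> \<le> C + C * length ws"
      using C[OF w(1)] Cons.IH[OF w(2)] by simp
    finally show ?case by simp
  qed
  show ?thesis
  proof (rule that[of C])
    show "C \<ge> 1" by (simp add: C_def)
    show "word_norm G T g \<le> C * word_norm G S g" if g: "g \<in> carrier G" for g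
      using ex_word_norm[OF S g] * by metis
  qed
qed

text \<open>Word norms of two finite generating sets differ by bounded factors, which dilate the
  argument. One generating set \<open>S0\<close> thus suffices for the estimates.\<close>

lemma growth_equiv_RfI:
  fixes F :: "nat \<Rightarrow> nat"
  assumes S0: "finite_generating_set G S0" and F1: "\<And>n. n \<ge> 1 \<Longrightarrow> F n \<ge> 1"
    and up: "c \<ge> 1" "\<And>n g. n \<ge> 1 \<Longrightarrow> g \<in> carrier G \<Longrightarrow> g \<noteq> \<one> \<Longrightarrow> word_norm G S0 g \<le> n \<Longrightarrow>
      detect G g (F (c * n))"
    and low: "c' \<ge> 1" "\<And>n. n \<ge> 1 \<Longrightarrow> \<exists>g\<in>carrier G. g \<noteq> \<one> \<and> word_norm G S0 g \<le> c' * n \<and>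
      (\<forall>m. detect G g m \<longrightarrow> F n \<le> m)"
    and S: "finite_generating_set G S"
  shows "growth_equiv (\<lambda>n. real (Rf_growth G S n)) (\<lambda>n. real (F n))"
proof -
  obtain C1 where C1: "C1 \<ge> 1" "\<And>g. g \<in> carrier G \<Longrightarrow> word_norm G S0 g \<le> C1 * word_norm G S g"
    using word_norm_compare[OF S S0] by metis
  obtain C2 where C2: "C2 \<ge> 1" "\<And>g. g \<in> carrier G \<Longrightarrow> word_norm G S g \<le> C2 * word_norm G S0 g"
    using word_norm_compare[OF S0 S] by metis
  have "Rf_growth G S n \<le> F (c * C1 * n)" if n: "n \<ge> 1" for n
  proof (rule Rf_growth_le[OF S])
    fix g assume g: "g \<in> carrier G" "word_norm G S g \<le> n"
    then have "word_norm G S0 g \<le> C1 * n" using C1(2)[OF g(1)] by (meson le_trans mult_le_mono2)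
    then show "Rf_elem G g \<le> F (c * C1 * n)"
      using up(2)[of "C1 * n" g] g n C1(1) F1[of "c * C1 * n"] up(1)
      by (cases "g = \<one>") (auto simp: Rf_elem_def[of G \<one>] mult.assoc intro: Rf_elem_le)
  qed
  moreover have "F n \<le> Rf_growth G S (C2 * c' * n)" if n: "n \<ge> 1" for n
  proof -
    obtain g where g: "g \<in> carrier G" "g \<noteq> \<one>" "word_norm G S0 g \<le> c' * n"
      "\<And>m. detect G g m \<Longrightarrow> F n \<le> m" using low(2)[OF n] by blast
    \<comment> \<open>Without some detecting quotient the \<open>LEAST\<close> in
      \<open>Rf_elem\<close> would say nothing; the upper bound supplies one.\<close>
    have "\<exists>m. detect G g m" using up(2)[of "c' * n" g] g n low(1) by auto
    then have "F n \<le> Rf_elem G g" using g by (intro Rf_elem_ge)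
    also have "word_norm G S g \<le> C2 * c' * n"
      using C2(2)[OF g(1)] g(3) by (metis le_trans mult.assoc mult_le_mono2)
    then have "Rf_elem G g \<le> Rf_growth G S (C2 * c' * n)"
      by (rule Rf_growth_ge[OF S g(1)])
    finally show ?thesis .
  qed
  ultimately show ?thesis
    unfolding growth_equiv_def growth_le_def using up(1) low(1) C1(1) C2(1)
    by (intro conjI exI[of _ "c * C1"] exI[of _ "C2 * c'"]) (auto simp: Suc_le_eq)
qed

lemma growth_equiv_ConjI:
  fixes F :: "nat \<Rightarrow> nat"
  assumes S0: "finite_generating_set G S0" and F1: "\<And>n. n \<ge> 1 \<Longrightarrow> F n \<ge> 1"
    and up: "c \<ge> 1" "\<And>n x y. n \<ge> 1 \<Longrightarrow> x \<in> carrier G \<Longrightarrow> y \<in> carrier G \<Longrightarrow>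
      \<not> conjugate_in G x y \<Longrightarrow> word_norm G S0 x \<le> n \<Longrightarrow> word_norm G S0 y \<le> n \<Longrightarrow>
      conj_detect G x y (F (c * n))"
    and low: "c' \<ge> 1" "\<And>n. n \<ge> 1 \<Longrightarrow> \<exists>x\<in>carrier G. \<exists>y\<in>carrier G. \<not> conjugate_in G x y \<and>
      word_norm G S0 x \<le> c' * n \<and> word_norm G S0 y \<le> c' * n \<and>
      (\<forall>m. conj_detect G x y m \<longrightarrow> F n \<le> m)"
    and S: "finite_generating_set G S"
  shows "growth_equiv (\<lambda>n. real (Conj_growth G S n)) (\<lambda>n. real (F n))"
proof -
  obtain C1 where C1: "C1 \<ge> 1" "\<And>g. g \<in> carrier G \<Longrightarrow> word_norm G S0 g \<le> C1 * word_norm G S g"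
    using word_norm_compare[OF S S0] by metis
  obtain C2 where C2: "C2 \<ge> 1" "\<And>g. g \<in> carrier G \<Longrightarrow> word_norm G S g \<le> C2 * word_norm G S0 g"
    using word_norm_compare[OF S0 S] by metis
  have "Conj_growth G S n \<le> F (c * C1 * n)" if n: "n \<ge> 1" for n
  proof (rule Conj_growth_le[OF S])
    fix x y assume g: "x \<in> carrier G" "y \<in> carrier G" "word_norm G S x \<le> n" "word_norm G S y \<le> n"
    then have "word_norm G S0 x \<le> C1 * n" "word_norm G S0 y \<le> C1 * n"
      using C1(2) by (meson le_trans mult_le_mono2)+
    then have "conj_detect G x y (F (c * C1 * n))" if "\<not> conjugate_in G x y"
      using up(2)[of "C1 * n" x y] g n C1(1) that by (simp add: mult.assoc)
    moreover have "F (c * C1 * n) \<ge> 1" using n C1(1) up(1) by (intro F1) simp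
    ultimately show "Conj_elem G x y \<le> F (c * C1 * n)"
      by (cases "conjugate_in G x y") (simp add: Conj_elem_def, simp add: Conj_elem_le)
  qed
  moreover have "F n \<le> Conj_growth G S (C2 * c' * n)" if n: "n \<ge> 1" for n
  proof -
    obtain x y where g: "x \<in> carrier G" "y \<in> carrier G" "\<not> conjugate_in G x y"
      "word_norm G S0 x \<le> c' * n" "word_norm G S0 y \<le> c' * n"
      "\<And>m. conj_detect G x y m \<Longrightarrow> F n \<le> m" using low(2)[OF n] by blast
    have "\<exists>m. conj_detect G x y m" using up(2)[of "c' * n" x y] g n low(1) by auto
    then have "F n \<le> Conj_elem G x y" using g by (intro Conj_elem_ge)
    also have "word_norm G S x \<le> C2 * c' * n" "word_norm G S y \<le> C2 * c' * n"
      using C2(2) g(1,2,4,5) by (metis le_trans mult.assoc mult_le_mono2)+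
    then have "Conj_elem G x y \<le> Conj_growth G S (C2 * c' * n)"
      by (rule Conj_growth_ge[OF S g(1,2)])
    finally show ?thesis .
  qed
  ultimately show ?thesis
    unfolding growth_equiv_def growth_le_def using up(1) low(1) C1(1) C2(1)
    by (intro conjI exI[of _ "c * C1"] exI[of _ "C2 * c'"]) (auto simp: Suc_le_eq)
qed

end

lemma eval_word_hom:
  assumes "group G" "group H" "f \<in> hom G H" "set ws \<subseteq> carrier G"
  shows "eval_word H (map f ws) = f (eval_word G ws)"
  using assms(4)
proof (induction ws)
  case Nil
  show ?case using hom_one[OF assms(3,1,2)] by (simp add: eval_word_def)
next
  case (Cons w ws)
  interpret G: group G by fact
  interpret H: group H by fact
  show ?case
    using Cons hom_mult[OF assms(3)] G.eval_word_closed[of ws]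
    by (simp add: G.eval_word_Cons H.eval_word_Cons)
qed

lemma word_norm_hom:
  assumes "group G" "group H" "f \<in> hom G H" "finite_generating_set G S" "g \<in> carrier G"
  shows "word_norm H (f ` S) (f g) \<le> word_norm G S g"
proof -
  interpret group_hom G H f using assms by (simp add: group_hom_def group_hom_axioms_def)
  have S: "S \<subseteq> carrier G" using assms(4) by (simp add: finite_generating_set_def)
  obtain ws where ws: "is_word G S ws" "eval_word G ws = g" "length ws = word_norm G S g"
    using G.ex_word_norm[OF assms(4,5)] by blast
  have "f (inv\<^bsub>G\<^esub> s) = inv\<^bsub>H\<^esub> f s" if "s \<in> S" for s using that S by auto
  then have "f ` (m_inv G ` S) = m_inv H ` f ` S"
    by (simp add: image_image cong: image_cong)
  moreover have "f ` set ws \<subseteq> f ` (S \<union> m_inv G ` S)"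
    using ws(1) by (intro image_mono) (simp add: is_word_def)
  ultimately have "is_word H (f ` S) (map f ws)"
    by (simp add: is_word_def image_Un)
  moreover have "eval_word H (map f ws) = f g"
    using eval_word_hom[OF assms(1-3)] G.is_word_carrier[OF S ws(1)] ws(2) by simp
  ultimately show ?thesis using word_norm_le[of H "f ` S" "map f ws"] ws(3) by simp
qed

lemma finite_generating_set_epi:
  assumes "group G" "group H" "f \<in> epi G H" "finite_generating_set G S"
  shows "finite_generating_set H (f ` S)"
proof -
  have f: "f \<in> hom G H" "f ` carrier G = carrier H" using assms(3) by (auto simp: epi_def)
  interpret group_hom G H f using assms f by (simp add: group_hom_def group_hom_axioms_def)
  have S: "S \<subseteq> carrier G" "finite S" "generate G S = carrier G"
    using assms(4) by (auto simp: finite_generating_set_def)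
  have "f g \<in> generate H (f ` S)" if "g \<in> generate G S" for g
    using that
  proof induction
    case (inv h)
    then show ?case using S(1) generate.inv[of "f h" "f ` S" H] by auto
  next
    case (eng h1 h2)
    then have "h1 \<in> carrier G" "h2 \<in> carrier G" using S by auto
    then show ?case using eng by (auto intro: generate.eng)
  qed (auto intro: generate.one generate.incl)
  then have "f ` generate G S \<subseteq> generate H (f ` S)" by (rule image_subsetI)
  then have "carrier H \<subseteq> generate H (f ` S)" unfolding S(3) f(2) .
  moreover have fS: "f ` S \<subseteq> carrier H" using S(1) by auto
  moreover have "generate H (f ` S) \<subseteq> carrier H"
    using fS by (rule H.generate_incl)
  ultimately show ?thesis using S by (auto simp: finite_generating_set_def)
qed

section \<open>Center-by-metabelian groups\<close>

lemma X_mult_cancel: "X p * v * (X (- p) * w) = v * w"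
proof -
  have "X p * v * (X (- p) * w) = (X p * X (- p)) * (v * w)"
    by (simp only: ac_simps)
  then show ?thesis by simp
qed

lemma keys_inject: "keys f = keys g \<Longrightarrow> f = (g :: laurent)"
  by (rule poly_mapping_eqI) (metis bit_not_zero_iff in_keys_iff)

lemma ex_odd_part:
  assumes "m > (0::nat)"
  shows "\<exists>s q. m = q * 2 ^ s \<and> odd q"
  using assms
proof (induction m rule: less_induct)
  case (less m)
  show ?case
  proof (cases "odd m")
    case True
    then show ?thesis by (intro exI[of _ 0] exI[of _ m]) simp
  next
    case False
    then obtain k where k: "m = 2 * k" by auto
    with less.prems have "k > 0" "k < m" by auto
    then obtain s q where "k = q * 2 ^ s" "odd q" using less.IH by blast
    then show ?thesis using k by (intro exI[of _ "Suc s"] exI[of _ q]) simp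
  qed
qed

type_synonym heis_elem = "int \<times> laurent \<times> laurent \<times> laurent \<times> (nat \<times> nat \<Rightarrow> bit)"

locale heis =
  fixes sv tv :: "nat \<times> nat \<Rightarrow> int \<Rightarrow> bit"
begin

definition S :: "laurent \<Rightarrow> nat \<times> nat \<Rightarrow> bit" where "S f = (\<lambda>\<xi>. lin (sv \<xi>) f)"
definition T :: "laurent \<Rightarrow> nat \<times> nat \<Rightarrow> bit" where "T f = (\<lambda>\<xi>. lin (tv \<xi>) f)"

lemma S_add: "S (f + g) = S f + S g" and T_add: "T (f + g) = T f + T g"
  by (simp_all add: S_def T_def lin_add fun_eq_iff)

lemma S_0 [simp]: "S 0 = 0" and T_0 [simp]: "T 0 = 0"
  by (simp_all add: S_def T_def fun_eq_iff)

text \<open>Only the span of the two families is taken, not all functions: this keeps the group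
  countable and generated by four elements.\<close>

definition A :: "(nat \<times> nat \<Rightarrow> bit) set" where
  "A = range (\<lambda>(f, g). S f + T g)"

lemma A_S: "S f \<in> A" and A_T: "T f \<in> A"
  unfolding A_def by (rule range_eqI[of _ _ "(f, 0)"], simp) (rule range_eqI[of _ _ "(0, f)"], simp)

lemma A_0 [simp]: "0 \<in> A"
  using A_S[of 0] by simp

lemma A_add: "\<alpha> \<in> A \<Longrightarrow> \<beta> \<in> A \<Longrightarrow> \<alpha> + \<beta> \<in> A"
proof -
  assume "\<alpha> \<in> A" "\<beta> \<in> A"
  then obtain f g f' g' where "\<alpha> = S f + T g" "\<beta> = S f' + T g'" by (auto simp: A_def)
  then have "\<alpha> + \<beta> = (\<lambda>(f, g). S f + T g) (f + f', g + g')" by (simp add: S_add T_add ac_simps)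
  then show ?thesis unfolding A_def by (rule range_eqI)
qed

definition mul :: "heis_elem \<Rightarrow> heis_elem \<Rightarrow> heis_elem" where
  "mul = (\<lambda>(p, u, u', g, \<alpha>) (q, v, v', h, \<beta>).
     (p + q, u + X p * v, u' + X p * v', g + X (- p) * h,
      \<alpha> + \<beta> + S (u * (X (- p) * h)) + T (u' * (X (- p) * h))))"

lemma mul_simp [simp]:
  "mul (p, u, u', g, \<alpha>) (q, v, v', h, \<beta>) =
     (p + q, u + X p * v, u' + X p * v', g + X (- p) * h,
      \<alpha> + \<beta> + S (u * (X (- p) * h)) + T (u' * (X (- p) * h)))"
  by (simp add: mul_def)

text \<open>In \<open>(p, u, u', g, \<alpha>)\<close> the polynomials \<open>u\<close>, \<open>u'\<close>, \<open>g\<close> record the lamps \<open>a\<^sub>i\<close>, \<open>a'\<^sub>i\<close>, \<open>c\<^sub>i\<close>; the shift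
  acts on the lamps \<open>c\<^sub>i\<close> in the opposite direction, so that \<open>S (u * g)\<close> is shift invariant.\<close>

definition G :: "heis_elem monoid" where
  "G = \<lparr>carrier = {(p, u, u', g, \<alpha>). \<alpha> \<in> A}, mult = mul, one = (0, 0, 0, 0, 0)\<rparr>"

lemma G_simps [simp]:
  "(p, u, u', g, \<alpha>) \<in> carrier G \<longleftrightarrow> \<alpha> \<in> A"
  "x \<otimes>\<^bsub>G\<^esub> y = mul x y" "\<one>\<^bsub>G\<^esub> = (0, 0, 0, 0, 0)"
  by (simp_all add: G_def)

text \<open>The central term is a cocycle because \<open>X p\<close> on the \<open>a\<close>-side
  and \<open>X (- p)\<close> on the \<open>c\<close>-side cancel in each product.\<close>

lemma mul_assoc: "mul (mul x y) z = mul x (mul y z)"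
proof -
  obtain p u u' g \<alpha> where x: "x = (p, u, u', g, \<alpha>)" by (cases x) auto
  obtain q v v' h \<beta> where y: "y = (q, v, v', h, \<beta>)" by (cases y) auto
  obtain r w w' k \<gamma> where z: "z = (r, w, w', k, \<gamma>)" by (cases z) auto
  have e: "(v0 + X p * w0) * (X (- (p + q)) * k) = v0 * (X (- p) * (X (- q) * k)) + w0 * (X (- q) * k)"
    for v0 w0
  proof -
    have "X (- (p + q)) = X (- p) * X (- q)"
      by (simp flip: X_add)
    then have "(v0 + X p * w0) * (X (- (p + q)) * k) =
        v0 * (X (- p) * (X (- q) * k)) + X p * w0 * (X (- p) * (X (- q) * k))"
      by (simp only: distrib_right mult.assoc)
    then show ?thesis by (simp only: X_mult_cancel)
  qed
  have neg: "X (- (p + q)) = X (- p) * X (- q)"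
    by (simp flip: X_add)
  show ?thesis
    unfolding x y z mul_simp prod.inject
    by (intro conjI) (simp_all only: e distrib_left S_add T_add, simp_all only: X_add neg ac_simps)
qed

lemma group_G: "group G"
proof (rule groupI)
  fix x y z assume "x \<in> carrier G" "y \<in> carrier G" "z \<in> carrier G"
  then show "x \<otimes>\<^bsub>G\<^esub> y \<in> carrier G"
    by (cases x; cases y) (auto intro!: A_add A_S A_T)
  show "x \<otimes>\<^bsub>G\<^esub> y \<otimes>\<^bsub>G\<^esub> z = x \<otimes>\<^bsub>G\<^esub> (y \<otimes>\<^bsub>G\<^esub> z)" by (simp add: mul_assoc)
next
  show "\<one>\<^bsub>G\<^esub> \<in> carrier G" by simp
  fix x assume x: "x \<in> carrier G"
  then obtain p u u' g \<alpha> where x_eq: "x = (p, u, u', g, \<alpha>)" and \<alpha>: "\<alpha> \<in> A"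
    by (cases x) auto
  show "\<one>\<^bsub>G\<^esub> \<otimes>\<^bsub>G\<^esub> x = x" by (simp add: x_eq)
  let ?y = "(- p, X (- p) * u, X (- p) * u', X p * g, \<alpha> + S (u * g) + T (u' * g))"
  have e: "X (- p) * w * (X p * g) = w * g" for w
    using X_mult_cancel[of "- p" w g] by simp
  have "\<alpha> + S (u * g) + T (u' * g) + \<alpha> + S (u * g) + T (u' * g) =
      (\<alpha> + \<alpha>) + (S (u * g) + S (u * g)) + (T (u' * g) + T (u' * g))"
    by (simp only: ac_simps)
  then have "?y \<otimes>\<^bsub>G\<^esub> x = \<one>\<^bsub>G\<^esub>"
    by (simp add: x_eq e)
  moreover have "?y \<in> carrier G" using \<alpha> by (simp add: A_add A_S A_T)
  ultimately show "\<exists>y\<in>carrier G. y \<otimes>\<^bsub>G\<^esub> x = \<one>\<^bsub>G\<^esub>" by blast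
qed

sublocale G: group G by (rule group_G)

lemma countable_G: "countable (carrier G)"
proof -
  have "carrier G \<subseteq> (\<lambda>(p, u, u', g, v, v'). (p, u, u', g, S v + T v')) `
      (UNIV \<times> UNIV \<times> UNIV \<times> UNIV \<times> UNIV \<times> UNIV)"
    by (auto simp: A_def image_iff)
  then show ?thesis
    by (rule countable_subset) (intro countable_image countable_SIGMA countable_laurent, auto)
qed

definition cen :: "(nat \<times> nat \<Rightarrow> bit) \<Rightarrow> heis_elem" where "cen \<alpha> = (0, 0, 0, 0, \<alpha>)"

lemma cen_add: "cen \<alpha> \<otimes>\<^bsub>G\<^esub> cen \<beta> = cen (\<alpha> + \<beta>)"
  by (simp add: cen_def)

lemma cen_closed: "\<alpha> \<in> A \<Longrightarrow> cen \<alpha> \<in> carrier G"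
  by (simp add: cen_def)

text \<open>In a quotient with fewer than \<open>2 ^ 2 ^ r\<close> elements two of the configurations
  \<open>\<Sum>l\<in>D. Y ^ l\<close>, \<open>D \<subseteq> {..<2 ^ r}\<close>, \<open>Y = X q - 1\<close>, \<open>q\<close> odd, are identified; as \<open>Y\<close> acts
  nilpotently on the image of the centre, already \<open>Y ^ 2 ^ r = X (q * 2 ^ r) - 1\<close> acts trivially.\<close>

lemma small_quotient_periodic:
  fixes Q :: "('q, 'e) monoid_scheme"
  assumes Q: "group Q" "finite (carrier Q)" "card (carrier Q) < 2 ^ (2 ^ r)" and \<phi>: "\<phi> \<in> hom G Q"
  obtains q where "odd q" "\<And>k. \<phi> (cen (S (X (k + int (q * 2 ^ r))))) = \<phi> (cen (S (X k)))"
    "\<And>k. \<phi> (cen (T (X (k + int (q * 2 ^ r))))) = \<phi> (cen (T (X k)))"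
proof -
  interpret Q: group Q by fact
  interpret h: group_hom G Q \<phi>
    using \<phi> group_G Q(1) by (simp add: group_hom_def group_hom_axioms_def)
  have cenS: "cen (S f) \<in> carrier G" and cenT: "cen (T f) \<in> carrier G" for f
    by (simp_all add: cen_closed A_S A_T)
  \<comment> \<open>Quantifying over all multiples makes \<open>J\<close> an ideal at once;
    membership of a polynomial says that it acts trivially on the image of the centre.\<close>
  define J where "J = {f. \<forall>g. \<phi> (cen (S (f * g))) = \<one>\<^bsub>Q\<^esub> \<and> \<phi> (cen (T (f * g))) = \<one>\<^bsub>Q\<^esub>}"
  have cen_hom: "\<phi> (cen (\<alpha> + \<beta>)) = \<phi> (cen \<alpha>) \<otimes>\<^bsub>Q\<^esub> \<phi> (cen \<beta>)" if "\<alpha> \<in> A" "\<beta> \<in> A" for \<alpha> \<beta>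
    using that h.hom_mult[of "cen \<alpha>" "cen \<beta>"] cen_closed by (simp only: cen_add)
  have J_add: "f + g \<in> J" if "f \<in> J" "g \<in> J" for f g
    using that by (simp add: J_def distrib_right S_add T_add cen_hom A_S A_T)
  have J_mult: "f * g \<in> J" if "f \<in> J" for f g
    using that by (auto simp: J_def mult.assoc)
  have J_mult': "g * f \<in> J" if "f \<in> J" for f g
    using J_mult[OF that, of g] by (simp only: mult.commute)
  define c where "c f = ((0, 0, 0, f, 0) :: heis_elem)" for f
  have c_closed: "c f \<in> carrier G" for f by (simp add: c_def)
  have c_add: "c f \<otimes>\<^bsub>G\<^esub> c g = c (f + g)" for f g by (simp add: c_def)
  \<comment> \<open>Moving \<open>c f\<close> past the lamps \<open>g\<close> of either family costs
    \<open>S (f * g)\<close> or \<open>T (f * g)\<close>; killing \<open>c f\<close> therefore kills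
    all of these.\<close>
  have c_J: "f \<in> J" if f: "\<phi> (c f) = \<one>\<^bsub>Q\<^esub>" for f
  proof -
    have "\<phi> (cen z) = \<one>\<^bsub>Q\<^esub>"
      if x: "x \<in> carrier G" "z \<in> A" "x \<otimes>\<^bsub>G\<^esub> c f = cen z \<otimes>\<^bsub>G\<^esub> (c f \<otimes>\<^bsub>G\<^esub> x)" for x z
    proof -
      have "\<phi> (x \<otimes>\<^bsub>G\<^esub> c f) = \<phi> x"
        using h.hom_mult[OF x(1) c_closed[of f]] f h.hom_closed[OF x(1)] by simp
      moreover have "\<phi> (cen z \<otimes>\<^bsub>G\<^esub> (c f \<otimes>\<^bsub>G\<^esub> x)) = \<phi> (cen z) \<otimes>\<^bsub>Q\<^esub> \<phi> x"
        using h.hom_mult[OF cen_closed[OF x(2)] G.m_closed[OF c_closed[of f] x(1)]]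
          h.hom_mult[OF c_closed[of f] x(1)] f h.hom_closed[OF x(1)] by simp
      ultimately have "\<phi> (cen z) \<otimes>\<^bsub>Q\<^esub> \<phi> x = \<phi> x" using x(3) by simp
      then show ?thesis
        using h.hom_closed[OF x(1)] h.hom_closed[OF cen_closed[OF x(2)]] Q.r_cancel_one by simp
    qed
    from this[of "(0, g, 0, 0, 0)" "S (f * g)" for g] this[of "(0, 0, g, 0, 0)" "T (f * g)" for g]
    show ?thesis by (simp add: J_def c_def cen_def A_S A_T mult.commute)
  qed
  define B where "B k = ((int k, 0, 0, 0, 0) :: heis_elem)" for k
  have B_closed: "B k \<in> carrier G" for k by (simp add: B_def)
  have B_add: "B k \<otimes>\<^bsub>G\<^esub> B l = B (k + l)" for k l by (simp add: B_def)
  \<comment> \<open>Pigeonhole on powers of the shift gives some period \<open>m\<close> of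
    uncontrolled size. Only its odd part \<open>q\<close> is kept; the power of two is bounded
    afterwards by counting.\<close>
  have "\<not> inj (\<lambda>k. \<phi> (B k))"
    using finite_subset[of "range (\<lambda>k. \<phi> (B k))" "carrier Q"] Q(2) B_closed h.hom_closed
    by (metis finite_imageD image_subsetI infinite_UNIV_nat)
  then obtain k l where kl: "k < l" "\<phi> (B k) = \<phi> (B l)"
    unfolding inj_def by (metis linorder_neqE_nat)
  define m where "m = l - k"
  have "\<phi> (B k) \<otimes>\<^bsub>Q\<^esub> \<phi> (B m) = \<phi> (B k)"
    using h.hom_mult[OF B_closed[of k] B_closed[of m]] kl by (simp add: B_add m_def del: G_simps)
  then have Bm: "\<phi> (B m) = \<one>\<^bsub>Q\<^esub>"
    using Q.l_cancel_one h.hom_closed B_closed by (metis)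
  have "B m \<otimes>\<^bsub>G\<^esub> c 1 = c (X (- int m)) \<otimes>\<^bsub>G\<^esub> B m" by (simp add: B_def c_def)
  then have "\<phi> (B m) \<otimes>\<^bsub>Q\<^esub> \<phi> (c 1) = \<phi> (c (X (- int m))) \<otimes>\<^bsub>Q\<^esub> \<phi> (B m)"
    using h.hom_mult B_closed c_closed by metis
  then have "\<phi> (c 1) = \<phi> (c (X (- int m)))" using Bm h.hom_closed c_closed by simp
  moreover have c_self: "\<phi> (c f) \<otimes>\<^bsub>Q\<^esub> \<phi> (c f) = \<one>\<^bsub>Q\<^esub>" for f
  proof -
    have "c f \<otimes>\<^bsub>G\<^esub> c f = \<one>\<^bsub>G\<^esub>" by (simp add: c_def)
    then show ?thesis using h.hom_mult[OF c_closed c_closed, of f f] h.hom_one by (simp only:)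
  qed
  ultimately have "\<phi> (c (X (- int m) + 1)) = \<one>\<^bsub>Q\<^esub>"
    using h.hom_mult[OF c_closed c_closed, of "X (- int m)" 1] by (simp add: c_add del: G_simps)
  then have "X (int m) * (X (- int m) + 1) \<in> J" by (intro J_mult' c_J)
  then have Jm: "X (int m) + 1 \<in> J" by (simp add: distrib_left add.commute)
  have "m > 0" using kl by (simp add: m_def)
  then obtain s q where m: "m = q * 2 ^ s" and odd: "odd q" using ex_odd_part by blast
  define Y where "Y = X (int q) + 1"
  have Ypow: "Y ^ (2 ^ e) = X (int (q * 2 ^ e)) + 1" for e
    unfolding Y_def X_frobenius by (simp add: mult.commute)
  have J_s: "Y ^ (2 ^ s) \<in> J" using Jm unfolding Ypow m .
  define y where "y D = (\<Sum>l\<in>D. Y ^ l)" for D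
  have "\<not> inj_on (\<lambda>D. \<phi> (c (y D))) (Pow {..<2 ^ r})"
  proof
    assume "inj_on (\<lambda>D. \<phi> (c (y D))) (Pow {..<2 ^ r})"
    then have "card (Pow {..<(2::nat) ^ r}) \<le> card (carrier Q)"
      using Q(2) c_closed h.hom_closed by (intro card_inj_on_le) auto
    then show False using Q(3) by (simp add: card_Pow)
  qed
  then obtain D D' where D: "D \<subseteq> {..<2 ^ r}" "D' \<subseteq> {..<2 ^ r}" "D \<noteq> D'" "\<phi> (c (y D)) = \<phi> (c (y D'))"
    by (auto simp: inj_on_def)
  have "\<phi> (c (y D + y D')) = \<one>\<^bsub>Q\<^esub>"
    using h.hom_mult[OF c_closed c_closed, of "y D" "y D'"] D(4)
      c_self by (simp add: c_add del: G_simps)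
  then have yJ: "y D + y D' \<in> J" by (rule c_J)
  \<comment> \<open>Terms common to both sets cancel in characteristic 2, which leaves a nonempty
    sum of distinct powers of \<open>Y\<close>.\<close>
  define E where "E = (D - D') \<union> (D' - D)"
  have fin: "finite D" "finite D'" "finite E"
    using finite_subset[OF D(1)] finite_subset[OF D(2)] by (simp_all add: E_def)
  have "y D = y (D \<inter> D') + y (D - D')" "y D' = y (D \<inter> D') + y (D' - D)"
    using fin sum.Int_Diff[of D "(^) Y" D'] sum.Int_Diff[of D' "(^) Y" D]
    by (simp_all add: y_def Int_commute)
  moreover have "y E = y (D - D') + y (D' - D)"
    unfolding y_def E_def using fin by (intro sum.union_disjoint) auto
  ultimately have "y D + y D' = y E + (y (D \<inter> D') + y (D \<inter> D'))"
    by (simp only: ac_simps)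
  then have yE: "y E \<in> J" using yJ by simp
  have Ene: "E \<noteq> {}" using D(3) by (auto simp: E_def)
  define l0 where "l0 = Min E"
  have l0: "l0 \<in> E" "l0 < 2 ^ r" using Min_in[OF fin(3) Ene] D(1,2) by (auto simp: l0_def E_def)
  have "Y ^ Suc l0 dvd y (E - {l0})"
    unfolding y_def
  proof (intro dvd_sum le_imp_power_dvd)
    fix l assume "l \<in> E - {l0}"
    then have "l0 \<le> l" "l \<noteq> l0" using Min_le[OF fin(3)] by (auto simp: l0_def)
    then show "Suc l0 \<le> l" by simp
  qed
  then obtain w where w: "y (E - {l0}) = Y ^ Suc l0 * w" by (auto simp: dvd_def)
  have yE_eq: "y E = Y ^ l0 + Y ^ Suc l0 * w"
    using sum.remove[OF fin(3) l0(1), of "(^) Y"] w by (simp add: y_def)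
  define e where "e = (LEAST e. Y ^ e \<in> J)"
  have e: "Y ^ e \<in> J" unfolding e_def using J_s by (rule LeastI)
  \<comment> \<open>Otherwise a suitable power of \<open>Y\<close> turns the lowest term of
    \<open>y E\<close> into \<open>Y ^ (e - 1)\<close> and the rest into a multiple of
    \<open>Y ^ e\<close>, against the minimality of \<open>e\<close>.\<close>
  have "e \<le> l0"
  proof (rule ccontr)
    assume "\<not> e \<le> l0"
    then obtain d where d: "e = Suc (d + l0)"
      by (metis add.commute less_iff_Suc_add not_le)
    have "Y ^ d * y E = Y ^ (d + l0) + Y ^ e * w"
      unfolding yE_eq d by (simp add: distrib_left power_add ac_simps)
    then have "Y ^ (d + l0) = Y ^ d * y E + Y ^ e * w"
      by (metis add.assoc laurent_add_self add_0_right)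
    then have "Y ^ (d + l0) \<in> J" using J_add[OF J_mult'[OF yE] J_mult[OF e]] by simp
    then have "e \<le> d + l0" unfolding e_def by (rule Least_le)
    then show False using d by simp
  qed
  then have "e \<le> 2 ^ r" using l0(2) by simp
  then have "Y ^ e * Y ^ (2 ^ r - e) = Y ^ (2 ^ r)" by (simp flip: power_add)
  then have final: "X (int (q * 2 ^ r)) + 1 \<in> J" using J_mult[OF e] unfolding Ypow[symmetric] by metis
  have cancel: "\<phi> (cen \<alpha>) = \<phi> (cen \<beta>)" if "\<alpha> \<in> A" "\<beta> \<in> A" "\<phi> (cen (\<alpha> + \<beta>)) = \<one>\<^bsub>Q\<^esub>" for \<alpha> \<beta>
  proof -
    have "\<phi> (cen ((\<alpha> + \<beta>) + \<beta>)) = \<phi> (cen \<beta>)"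
      using that cen_hom[OF A_add[OF that(1,2)] that(2)] h.hom_closed cen_closed by simp
    moreover have "(\<alpha> + \<beta>) + \<beta> = \<alpha>" by (simp only: add.assoc bool_fun_add_self add_0_right)
    ultimately show ?thesis by simp
  qed
  have shift: "X (k + int (q * 2 ^ r)) + X k = (X (int (q * 2 ^ r)) + 1) * X k" for k
    unfolding X_add distrib_right by (simp add: mult.commute)
  have "\<phi> (cen (S (X (k + int (q * 2 ^ r))))) = \<phi> (cen (S (X k)))" for k
    using final unfolding J_def by (intro cancel A_S) (simp only: shift S_add[symmetric] mem_Collect_eq)
  moreover have "\<phi> (cen (T (X (k + int (q * 2 ^ r))))) = \<phi> (cen (T (X k)))" for k
    using final unfolding J_def by (intro cancel A_T) (simp only: shift T_add[symmetric] mem_Collect_eq)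
  ultimately show ?thesis using that odd by blast
qed

end

section \<open>Congruence quotients\<close>

lemma cyc_dvd_cyc: "M dvd P \<Longrightarrow> cyc M dvd cyc P"
  using dvd_binomial_mult[of "int M" "int (P div M)"] by (simp add: cyc_def flip: of_nat_mult)

lemma cyc_dvd_trans_add:
  "cyc P dvd f + g \<Longrightarrow> cyc P dvd g + h \<Longrightarrow> cyc P dvd f + (h::laurent)"
proof -
  assume "cyc P dvd f + g" "cyc P dvd g + h"
  then have "cyc P dvd (f + g) + (g + h)" by (rule dvd_add)
  moreover have "(f + g) + (g + h) = f + h" by (simp only: add.assoc laurent_add_self_left)
  ultimately show ?thesis by (simp only:)
qed

lemma cyc_dvd_mult_cong:
  assumes "cyc P dvd f + f'" "cyc P dvd g + g'"
  shows "cyc P dvd f * g + f' * g'"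
proof -
  have "cyc P dvd (f + f') * g + f' * (g + g')" 
    by (rule dvd_add[OF dvd_mult2[OF assms(1)] dvd_mult[OF assms(2)]])
  moreover have "(f + f') * g + f' * (g + g') = f * g + (f' * g + (f' * g + f' * g'))"
    by (simp only: distrib_left distrib_right add.assoc)
  ultimately show ?thesis by (simp only: laurent_add_self_left)
qed

lemma dvd_two_power: "d dvd (2::nat) ^ k \<Longrightarrow> \<exists>i. d = 2 ^ i"
proof (induction k arbitrary: d)
  case 0
  then show ?case by (intro exI[of _ 0]) simp
next
  case (Suc k)
  show ?case
  proof (cases "even d")
    case True
    then obtain e where e: "d = 2 * e" by auto
    then have "e dvd 2 ^ k" using Suc.prems by simp
    then obtain i where "e = 2 ^ i" using Suc.IH by blast
    then show ?thesis using e by (intro exI[of _ "Suc i"]) simp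
  next
    case False
    then have "coprime d 2" by simp
    then have "d dvd 2 ^ k" using Suc.prems by (simp add: coprime_dvd_mult_right_iff)
    then show ?thesis by (rule Suc.IH)
  qed
qed

definition res :: "nat \<Rightarrow> laurent \<Rightarrow> laurent" where
  "res P f = (SOME f'. keys f' \<subseteq> {0..<int P} \<and> cyc P dvd f + f')"

lemma res:
  assumes "P > 0"
  shows "keys (res P f) \<subseteq> {0..<int P}" "cyc P dvd f + res P f"
proof -
  have "\<exists>f'. keys f' \<subseteq> {0..<int P} \<and> cyc P dvd f + f'"
    using ex_short_representative[OF assms, of 0 f] by auto
  then have "keys (res P f) \<subseteq> {0..<int P} \<and> cyc P dvd f + res P f"
    unfolding res_def by (rule someI_ex)
  then show "keys (res P f) \<subseteq> {0..<int P}" "cyc P dvd f + res P f" by auto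
qed

lemma res_cong:
  assumes "P > 0" "keys (res P f) = keys (res P g)"
  shows "cyc P dvd f + g"
  using cyc_dvd_trans_add[OF res(2)[OF assms(1), of f], of g] res(2)[OF assms(1), of g]
    keys_inject[OF assms(2)]
  by (simp only: add.commute)

context heis
begin

text \<open>The centre is compared on \<open>Y\<close> only. Periodicity of the sequences in
  \<open>Y\<close> makes this compatible with products; for \<open>Y = {}\<close> every modulus is
  allowed.\<close>

definition cong :: "nat \<Rightarrow> (nat \<times> nat) set \<Rightarrow> heis_elem \<Rightarrow> heis_elem \<Rightarrow> bool" where
  "cong P Y = (\<lambda>(p, u, u', g, \<alpha>) (q, v, v', h, \<beta>). int P dvd p - q \<and> cyc P dvd u + v \<and>
     cyc P dvd u' + v' \<and> cyc P dvd g + h \<and> (\<forall>\<xi>\<in>Y. \<alpha> \<xi> = \<beta> \<xi>))"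

lemma cong_simp [simp]:
  "cong P Y (p, u, u', g, \<alpha>) (q, v, v', h, \<beta>) \<longleftrightarrow> int P dvd p - q \<and> cyc P dvd u + v \<and>
     cyc P dvd u' + v' \<and> cyc P dvd g + h \<and> (\<forall>\<xi>\<in>Y. \<alpha> \<xi> = \<beta> \<xi>)"
  by (simp add: cong_def)

definition cls :: "nat \<Rightarrow> (nat \<times> nat) set \<Rightarrow> heis_elem \<Rightarrow> int \<times> int set \<times> int set \<times> int set \<times> (nat \<times> nat) set"
  where "cls P Y = (\<lambda>(p, u, u', g, \<alpha>).
     (p mod int P, keys (res P u), keys (res P u'), keys (res P g), {\<xi>\<in>Y. \<alpha> \<xi> = 1}))"

definition cls_set :: "nat \<Rightarrow> (nat \<times> nat) set \<Rightarrow> (int \<times> int set \<times> int set \<times> int set \<times> (nat \<times> nat) set) set"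
  where "cls_set P Y = {0..<int P} \<times> Pow {0..<int P} \<times> Pow {0..<int P} \<times> Pow {0..<int P} \<times> Pow Y"

lemma card_cls_set: "finite Y \<Longrightarrow> card (cls_set P Y) = P * 2 ^ (3 * P + card Y)"
  by (simp add: cls_set_def card_cartesian_product card_Pow power_add power_mult mult.commute
      eval_nat_numeral)

lemma finite_cls_set: "finite Y \<Longrightarrow> finite (cls_set P Y)"
  by (simp add: cls_set_def)

lemma cong_sym: "cong P Y x y \<Longrightarrow> cong P Y y x"
  by (cases x; cases y) (auto simp: add.commute dvd_diff_commute)

lemma cong_trans: "cong P Y x y \<Longrightarrow> cong P Y y z \<Longrightarrow> cong P Y x z"
proof (cases x; cases y; cases z)
  fix p u u' g \<alpha> q v v' h \<beta> r w w' k \<gamma>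
  assume *: "x = (p, u, u', g, \<alpha>)" "y = (q, v, v', h, \<beta>)" "z = (r, w, w', k, \<gamma>)"
    and "cong P Y x y" "cong P Y y z"
  then show "cong P Y x z"
    using dvd_add[of "int P" "p - q" "q - r"] cyc_dvd_trans_add[of P u v w]
      cyc_dvd_trans_add[of P u' v' w'] cyc_dvd_trans_add[of P g h k] by simp
qed

definition periodic :: "nat \<Rightarrow> (nat \<times> nat) set \<Rightarrow> bool" where
  "periodic M Y \<longleftrightarrow> (\<forall>\<xi>\<in>Y. \<forall>k. sv \<xi> (k + int M) = sv \<xi> k \<and> tv \<xi> (k + int M) = tv \<xi> k)"

lemma periodic_lin:
  assumes "periodic M Y" "\<xi> \<in> Y" "cyc M dvd f + g"
  shows "S f \<xi> = S g \<xi>" "T f \<xi> = T g \<xi>"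
  using assms lin_cyc_cong[of "sv \<xi>" M f g] lin_cyc_cong[of "tv \<xi>" M f g]
  by (auto simp: S_def T_def periodic_def)

lemma periodic_mult: "periodic M Y \<Longrightarrow> periodic (M * k) Y"
proof (induction k)
  case (Suc k)
  have "\<forall>\<xi>\<in>Y. \<forall>i. sv \<xi> ((i + int (M * k)) + int M) = sv \<xi> i \<and> tv \<xi> ((i + int (M * k)) + int M) = tv \<xi> i"
    using Suc unfolding periodic_def by simp
  then show ?case unfolding periodic_def by (simp add: algebra_simps)
qed (simp add: periodic_def)

lemma cong_mul:
  assumes per: "periodic P Y" and "cong P Y x x'" "cong P Y y y'"
  shows "cong P Y (mul x y) (mul x' y')"
proof -
  obtain p u u' g \<alpha> where x: "x = (p, u, u', g, \<alpha>)" by (cases x) auto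
  obtain q v v' h \<beta> where y: "y = (q, v, v', h, \<beta>)" by (cases y) auto
  obtain p1 u1 u1' g1 \<alpha>1 where x': "x' = (p1, u1, u1', g1, \<alpha>1)" by (cases x') auto
  obtain q1 v1 v1' h1 \<beta>1 where y': "y' = (q1, v1, v1', h1, \<beta>1)" by (cases y') auto
  have c: "int P dvd p - p1" "cyc P dvd u + u1" "cyc P dvd u' + u1'" "cyc P dvd g + g1"
      "\<forall>\<xi>\<in>Y. \<alpha> \<xi> = \<alpha>1 \<xi>"
    and d: "int P dvd q - q1" "cyc P dvd v + v1" "cyc P dvd v' + v1'" "cyc P dvd h + h1"
      "\<forall>\<xi>\<in>Y. \<beta> \<xi> = \<beta>1 \<xi>"
    using assms(2,3) by (simp_all add: x y x' y')
  have X: "cyc P dvd X p + X p1" "cyc P dvd X (- p) + X (- p1)"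
    using c(1) by (auto intro!: cyc_dvd_X_diff simp: dvd_diff_commute)
  have "int P dvd (p - p1) + (q - q1)" using c d by (intro dvd_add)
  then have 1: "int P dvd (p + q) - (p1 + q1)" by (simp add: algebra_simps)
  have add: "cyc P dvd (a + b) + (a' + b')" if "cyc P dvd a + a'" "cyc P dvd b + b'" for a b a' b'
  proof -
    have "(a + b) + (a' + b') = (a + a') + (b + b')" by (simp only: ac_simps)
    then show ?thesis using dvd_add[OF that] by (simp only:)
  qed
  have h: "cyc P dvd X (- p) * h + X (- p1) * h1" using cyc_dvd_mult_cong[OF X(2) d(4)] .
  show ?thesis
    unfolding x y x' y' mul_simp cong_simp
    using 1 add[OF c(2) cyc_dvd_mult_cong[OF X(1) d(2)]] add[OF c(3) cyc_dvd_mult_cong[OF X(1) d(3)]]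
      add[OF c(4) h] c(5) d(5) periodic_lin[OF per _ cyc_dvd_mult_cong[OF c(2) h]]
      periodic_lin[OF per _ cyc_dvd_mult_cong[OF c(3) h]]
    by simp
qed

lemma periodic_empty [simp]: "periodic P {}"
  by (simp add: periodic_def)

lemma cls_in: "P > 0 \<Longrightarrow> cls P Y x \<in> cls_set P Y"
  using res(1)[of P] by (cases x) (simp add: cls_def cls_set_def)

lemma cls_eq_cong:
  assumes "P > 0" "cls P Y x = cls P Y y"
  shows "cong P Y x y"
proof -
  obtain p u u' g \<alpha> where x: "x = (p, u, u', g, \<alpha>)" by (cases x) auto
  obtain q v v' h \<beta> where y: "y = (q, v, v', h, \<beta>)" by (cases y) auto
  have "p mod int P = q mod int P" "{\<xi>\<in>Y. \<alpha> \<xi> = 1} = {\<xi>\<in>Y. \<beta> \<xi> = 1}"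
    and "keys (res P u) = keys (res P v)" "keys (res P u') = keys (res P v')"
    "keys (res P g) = keys (res P h)"
    using assms(2) by (simp_all add: x y cls_def)
  moreover have "\<alpha> \<xi> = \<beta> \<xi>" if "\<xi> \<in> Y" for \<xi>
  proof -
    have "\<xi> \<in> {\<xi>\<in>Y. \<alpha> \<xi> = 1} \<longleftrightarrow> \<xi> \<in> {\<xi>\<in>Y. \<beta> \<xi> = 1}"
      using \<open>{\<xi>\<in>Y. \<alpha> \<xi> = 1} = {\<xi>\<in>Y. \<beta> \<xi> = 1}\<close> by (simp only:)
    then have "\<alpha> \<xi> = 1 \<longleftrightarrow> \<beta> \<xi> = 1" using that by simp
    then show ?thesis by (metis bit_not_one_iff)
  qed
  ultimately show ?thesis
    using res_cong[OF assms(1)] by (simp add: x y mod_eq_dvd_iff)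
qed

text \<open>Two moduli at once: \<open>P\<close> resolves the coordinates in \<open>Y\<close>, while
  \<open>P0\<close> ignores the centre and can be any positive number. For an element with shift
  \<open>p \<noteq> 0\<close> it will be \<open>\<bar>p\<bar>\<close>, which makes the twisted
  equations exactly solvable.\<close>

lemma group_congruence:
  assumes "periodic P Y" "finite Y" "P > 0" "P0 > 0"
  shows "group_congruence G (\<lambda>x y. cong P Y x y \<and> cong P0 {} x y) (\<lambda>x. (cls P Y x, cls P0 {} x))
    (cls_set P Y \<times> cls_set P0 {})"
proof (intro group_congruence.intro group_G group_congruence_axioms.intro)
  fix x :: heis_elem
  show "cong P Y x x \<and> cong P0 {} x x" by (cases x) simp
next
  fix x y :: heis_elem
  show "cong P Y x y \<and> cong P0 {} x y \<Longrightarrow> cong P Y y x \<and> cong P0 {} y x"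
    using cong_sym by blast
  show "cong P Y x z \<and> cong P0 {} x z" if "cong P Y x y \<and> cong P0 {} x y"
      "cong P Y y z \<and> cong P0 {} y z" for z
    using that cong_trans by blast
  show "cong P Y x y \<and> cong P0 {} x y"
    if "(cls P Y x, cls P0 {} x) = (cls P Y y, cls P0 {} y)"
    using that cls_eq_cong assms(3,4) by simp
  show "cong P Y (x \<otimes>\<^bsub>G\<^esub> y) (x' \<otimes>\<^bsub>G\<^esub> y') \<and> cong P0 {} (x \<otimes>\<^bsub>G\<^esub> y) (x' \<otimes>\<^bsub>G\<^esub> y')"
    if "cong P Y x x' \<and> cong P0 {} x x'" "cong P Y y y' \<and> cong P0 {} y y'" for x' y'
    using that cong_mul[OF assms(1)] cong_mul[OF periodic_empty] by simp
  show "(cls P Y x, cls P0 {} x) \<in> cls_set P Y \<times> cls_set P0 {}"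
    using cls_in assms(3,4) by simp
  show "finite (cls_set P Y \<times> cls_set P0 {})"
    using finite_cls_set assms(2) by simp
qed

definition cls_bound :: "nat \<Rightarrow> nat \<Rightarrow> nat \<Rightarrow> nat" where
  "cls_bound P y P0 = P * 2 ^ (3 * P + y) * (P0 * 2 ^ (3 * P0))"

lemma detect_cong:
  assumes "periodic P Y" "finite Y" "P > 0" "x \<in> carrier G" "\<not> cong P Y x \<one>\<^bsub>G\<^esub>"
  shows "detect G x (cls_bound P (card Y) 1)"
  using group_congruence.detectI[OF group_congruence[OF assms(1-3), of 1] assms(4)] assms(2,5)
  by (simp add: card_cartesian_product card_cls_set cls_bound_def)

lemma conj_detect_cong:
  assumes "periodic P Y" "finite Y" "P > 0" "P0 > 0" "x \<in> carrier G" "y \<in> carrier G"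
    "\<And>h. h \<in> carrier G \<Longrightarrow> cong P Y (h \<otimes>\<^bsub>G\<^esub> x) (y \<otimes>\<^bsub>G\<^esub> h) \<Longrightarrow>
      cong P0 {} (h \<otimes>\<^bsub>G\<^esub> x) (y \<otimes>\<^bsub>G\<^esub> h) \<Longrightarrow> False"
  shows "conj_detect G x y (cls_bound P (card Y) P0)"
proof (rule group_congruence.conj_detectI[OF group_congruence[OF assms(1-4)] assms(5,6)])
  show "\<not> (cong P Y (h \<otimes>\<^bsub>G\<^esub> x) (y \<otimes>\<^bsub>G\<^esub> h) \<and> cong P0 {} (h \<otimes>\<^bsub>G\<^esub> x) (y \<otimes>\<^bsub>G\<^esub> h))"
    if "h \<in> carrier G" for h
    using assms(7)[OF that] by blast
  show "card (cls_set P Y \<times> cls_set P0 {}) \<le> cls_bound P (card Y) P0"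
    using assms(2) by (simp add: card_cartesian_product card_cls_set cls_bound_def)
qed

end

text \<open>Solving \<open>(1 - X p) w = v + X q u\<close> exactly: the congruence modulo \<open>\<bar>p\<bar>\<close> gives solvability, and a
  solution modulo \<open>2 M\<close> is then congruent to the exact one modulo \<open>M\<close>, because
  \<open>cyc (2 * M) = (cyc M)\<^sup>2\<close>.\<close>

lemma twisted_solution:
  assumes p: "p \<noteq> 0" "\<bar>p\<bar> < int M" and M: "M = 2 ^ m"
    and mod_p: "cyc (nat \<bar>p\<bar>) dvd (X p + 1) * w + (v + X q * u)"
    and mod_M: "cyc (2 * M) dvd (X p + 1) * w + (v + X q * u)"
    and n: "\<bar>q\<bar> \<le> n" "keys u \<subseteq> {- n..n}" "keys v \<subseteq> {- n..n}"
  obtains w' where "(X p + 1) * w' = v + X q * u" "cyc M dvd w + w'" "keys w' \<subseteq> {- 2 * n..2 * n}"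
proof -
  have "cyc (nat \<bar>p\<bar>) dvd X p + 1"
    using cyc_dvd_X_diff[of "nat \<bar>p\<bar>" p 0] p by simp
  then have "cyc (nat \<bar>p\<bar>) dvd (X p + 1) * w" by (rule dvd_mult2)
  then have "cyc (nat \<bar>p\<bar>) dvd v + X q * u" using mod_p by (simp add: dvd_add_right_iff)
  moreover have "X p + 1 dvd cyc (nat \<bar>p\<bar>)"
    using dvd_binomial_mult[of p "sgn p"] p(1) by (simp add: cyc_def abs_sgn mult.commute)
  ultimately have "X p + 1 dvd v + X q * u" by (rule dvd_trans[rotated])
  then obtain w' where w': "v + X q * u = (X p + 1) * w'" by (auto simp: dvd_def)
  have "keys (v + X q * u) \<subseteq> {- 2 * n..2 * n}"
    using keys_add[of v "X q * u"] keys_X_mult_int[OF n(2), of q] n by fastforce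
  then have keys: "keys w' \<subseteq> {- 2 * n..2 * n}"
    using keys_binomial_mult_neg[OF p(1), of w'] w' by simp
  \<comment> \<open>As a divisor of \<open>2 * M\<close> this is a power of two, and it is below
    \<open>M\<close> because \<open>\<bar>p\<bar>\<close> is; hence it divides
    \<open>M\<close>.\<close>
  define d where "d = gcd (nat \<bar>p\<bar>) (2 * M)"
  have "d dvd 2 ^ Suc m" unfolding d_def M power_Suc by (rule gcd_dvd2)
  then obtain i where i: "d = 2 ^ i" using dvd_two_power by blast
  have dp: "d dvd nat \<bar>p\<bar>" by (simp add: d_def)
  then have "d \<le> nat \<bar>p\<bar>" using p(1) by (intro dvd_imp_le) auto
  then have "2 ^ i < (2::nat) ^ m" using p(2) i M by linarith
  then have "i < m" by (simp add: power_less_imp_less_exp)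
  then have dM: "d dvd M" unfolding i M by (intro le_imp_power_dvd) simp
  have "d > 0" by (simp add: i)
  \<comment> \<open>Modulo \<open>cyc (2 * M)\<close> the exponent \<open>a * p\<close> becomes
    \<open>d\<close>, so the factor \<open>X p + 1\<close> can be traded for
    \<open>X d + 1\<close>.\<close>
  obtain a b where ab: "int d = a * p + b * int (2 * M)"
  proof -
    obtain a b where "a * p + b * int (2 * M) = gcd p (int (2 * M))"
      using bezout_int by blast
    moreover have "int d = gcd p (int (2 * M))"
      unfolding d_def gcd_int_int_eq[symmetric] by (simp del: of_nat_mult)
    ultimately have "int d = a * p + b * int (2 * M)" by (simp only:)
    then show ?thesis using that by blast
  qed
  have "cyc (2 * M) dvd (X p + 1) * (w + w')"
    using mod_M w' by (simp add: distrib_left)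
  then have "cyc (2 * M) dvd (X (a * p) + 1) * (w + w')"
    by (rule dvd_trans) (rule mult_dvd_mono[OF dvd_binomial_mult dvd_refl])
  moreover have "cyc (2 * M) dvd X (int d) + X (a * p)"
    using ab by (intro cyc_dvd_X_diff) simp
  then have "cyc (2 * M) dvd (X (int d) + X (a * p)) * (w + w')" by (rule dvd_mult2)
  ultimately have "cyc (2 * M) dvd (X (int d) + X (a * p)) * (w + w') + (X (a * p) + 1) * (w + w')"
    by (intro dvd_add)
  moreover have "(X (int d) + X (a * p)) + (X (a * p) + 1) = X (int d) + 1"
    by (simp only: add.assoc laurent_add_self_left)
  ultimately have "cyc (2 * M) dvd (X (int d) + 1) * (w + w')"
    by (simp only: distrib_right[symmetric])
  then obtain z where "(X (int d) + 1) * (w + w') = cyc (2 * M) * z" by (auto simp: dvd_def)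
  \<comment> \<open>One factor \<open>cyc M\<close> is a multiple of \<open>X d + 1\<close>, which
    can then be cancelled; the other survives as the modulus.\<close>
  moreover have "cyc (2 * M) = cyc M * cyc M"
    using X_frobenius[of "int M" 1] by (simp add: cyc_def power2_eq_square)
  moreover obtain y where "cyc M = (X (int d) + 1) * y"
    using cyc_dvd_cyc[OF dM] by (auto simp: cyc_def dvd_def)
  ultimately have "(X (int d) + 1) * (w + w') = (X (int d) + 1) * (y * (cyc M * z))"
    by (simp add: mult.assoc)
  then have "w + w' = y * (cyc M * z)"
    by (rule binomial_cancel[rotated]) (use \<open>d > 0\<close> in simp)
  moreover have "cyc M dvd y * (cyc M * z)" by (intro dvd_mult dvd_triv_left)
  ultimately have "cyc M dvd w + w'" by (simp only:)
  then show ?thesis by (rule that[OF w'[symmetric] _ keys])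
qed

section \<open>Generators and supports\<close>

context heis
begin

definition gens :: "heis_elem set" where
  "gens = {(0, 1, 0, 0, 0), (0, 0, 1, 0, 0), (0, 0, 0, 1, 0), (1, 0, 0, 0, 0)}"

lemma gens_carrier: "gens \<subseteq> carrier G"
  by (auto simp: gens_def)

lemma inv_G: "y \<in> carrier G \<Longrightarrow> x \<in> carrier G \<Longrightarrow> mul y x = (0, 0, 0, 0, 0) \<Longrightarrow> m_inv G x = y"
  using G.inv_equality[of y x] by simp

lemma inv_gens:
  "m_inv G (0, 1, 0, 0, 0) = (0, 1, 0, 0, 0)" "m_inv G (0, 0, 1, 0, 0) = (0, 0, 1, 0, 0)"
  "m_inv G (0, 0, 0, 1, 0) = (0, 0, 0, 1, 0)" "m_inv G (1, 0, 0, 0, 0) = (- 1, 0, 0, 0, 0)"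
  by (rule inv_G; simp)+

lemma gens_inv: "gens \<union> m_inv G ` gens = insert (- 1, 0, 0, 0, 0) gens"
  by (auto simp: gens_def inv_gens)

lemma generate_gens: "generate G gens = carrier G"
proof
  let ?H = "generate G gens"
  show "?H \<subseteq> carrier G" using gens_carrier by (rule G.generate_incl)
  have mult: "mul x y \<in> ?H" if "x \<in> ?H" "y \<in> ?H" for x y
    using generate.eng[OF that] by simp
  have one: "(0, 0, 0, 0, 0) \<in> ?H" using generate.one[of G gens] by simp
  have a: "(0, 1, 0, 0, 0) \<in> ?H" "(0, 0, 1, 0, 0) \<in> ?H" "(0, 0, 0, 1, 0) \<in> ?H"
    and b: "(1, 0, 0, 0, 0) \<in> ?H"
    by (rule generate.incl, simp add: gens_def)+
  have b': "(- 1, 0, 0, 0, 0) \<in> ?H"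
    using generate.inv[of "(1, 0, 0, 0, 0)" gens G] by (simp add: gens_def inv_gens)
  have B: "(k, 0, 0, 0, 0) \<in> ?H" for k :: int
  proof (induction k rule: int_induct[where k = 0])
    case (step1 i)
    then show ?case using mult[OF step1(2) b] by simp
  next
    case (step2 i)
    then show ?case using mult[OF step2(2) b'] by simp
  qed (rule one)
  have lamp: "(0, X k, 0, 0, 0) \<in> ?H" "(0, 0, X k, 0, 0) \<in> ?H" "(0, 0, 0, X k, 0) \<in> ?H" for k
    using mult[OF mult[OF B[of k] a(1)] B[of "- k"]] mult[OF mult[OF B[of k] a(2)] B[of "- k"]]
      mult[OF mult[OF B[of "- k"] a(3)] B[of k]] by simp_all
  have conf: "(0, f, 0, 0, 0) \<in> ?H" "(0, 0, f, 0, 0) \<in> ?H" "(0, 0, 0, f, 0) \<in> ?H" for f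
  proof (induction f rule: laurent_induct)
    case (add k f)
    { case 1 then show ?case using mult[OF lamp(1)[of k] add(1)] by simp }
    { case 2 then show ?case using mult[OF lamp(2)[of k] add(2)] by simp }
    { case 3 then show ?case using mult[OF lamp(3)[of k] add(3)] by simp }
  qed (simp_all add: one)
  \<comment> \<open>A configuration and \<open>c_0\<close> are both involutions, so the square of
    their product is their commutator.\<close>
  have ST: "(0, 0, 0, 0, S f) \<in> ?H" "(0, 0, 0, 0, T f) \<in> ?H" for f
    using mult[OF mult[OF conf(1)[of f] a(3)] mult[OF conf(1)[of f] a(3)]]
      mult[OF mult[OF conf(2)[of f] a(3)] mult[OF conf(2)[of f] a(3)]] by (simp_all add: S_add T_add)
  show "carrier G \<subseteq> ?H"
  proof
    fix x assume "x \<in> carrier G"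
    then obtain p u u' g v v' where x: "x = (p, u, u', g, S v + T v')"
      by (cases x) (auto simp: A_def)
    have "mul (mul (mul (0, 0, 0, 0, S v) (0, 0, 0, 0, T v')) (mul (0, 0, 0, g, 0)
        (mul (0, u, 0, 0, 0) (0, 0, u', 0, 0)))) (p, 0, 0, 0, 0) \<in> ?H"
      by (intro mult ST conf B)
    then show "x \<in> ?H" by (simp add: x)
  qed
qed

lemma finite_generating_gens: "finite_generating_set G gens"
  using gens_carrier generate_gens by (simp add: finite_generating_set_def) (simp add: gens_def)

text \<open>\<open>S\<close> and \<open>T\<close> may have kernels, so the bound refers to some
  representation of the central element.\<close>

definition A_window :: "int \<Rightarrow> (nat \<times> nat \<Rightarrow> bit) set" where
  "A_window n = {S f + T g | f g. keys f \<subseteq> {- n..n} \<and> keys g \<subseteq> {- n..n}}"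

definition window :: "int \<Rightarrow> heis_elem \<Rightarrow> bool" where
  "window n = (\<lambda>(p, u, u', g, \<alpha>). \<bar>p\<bar> \<le> n \<and> keys u \<subseteq> {- n..n} \<and> keys u' \<subseteq> {- n..n} \<and>
     keys g \<subseteq> {- n..n} \<and> \<alpha> \<in> A_window n)"

lemma window_simp [simp]:
  "window n (p, u, u', g, \<alpha>) \<longleftrightarrow> \<bar>p\<bar> \<le> n \<and> keys u \<subseteq> {- n..n} \<and> keys u' \<subseteq> {- n..n} \<and>
     keys g \<subseteq> {- n..n} \<and> \<alpha> \<in> A_window n"
  by (simp add: window_def)

lemma A_window_mono: "n \<le> m \<Longrightarrow> A_window n \<subseteq> A_window m"
  unfolding A_window_def by fastforce

lemma window_mono:
  assumes "n \<le> m" "window n x"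
  shows "window m x"
proof -
  obtain p u u' g \<alpha> where x: "x = (p, u, u', g, \<alpha>)" by (cases x) auto
  have "keys f \<subseteq> {- m..m}" if "keys f \<subseteq> {- n..n}" for f :: laurent
    using that by (rule subset_trans) (use assms(1) in auto)
  then show ?thesis using assms A_window_mono[OF assms(1)] by (simp add: x) blast
qed

lemma A_window_add:
  assumes "\<alpha> \<in> A_window n" "\<beta> \<in> A_window n"
  shows "\<alpha> + \<beta> \<in> A_window n"
proof -
  obtain f g f' g' where "\<alpha> = S f + T g" "\<beta> = S f' + T g'"
    and k: "keys f \<subseteq> {- n..n}" "keys g \<subseteq> {- n..n}" "keys f' \<subseteq> {- n..n}" "keys g' \<subseteq> {- n..n}"
    using assms by (auto simp: A_window_def)
  then have "\<alpha> + \<beta> = S (f + f') + T (g + g')" by (simp add: S_add T_add ac_simps)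
  moreover have "keys (f + f') \<subseteq> {- n..n}" "keys (g + g') \<subseteq> {- n..n}"
    using keys_add[of f f'] keys_add[of g g'] k by blast+
  ultimately show ?thesis unfolding A_window_def by blast
qed

lemma A_window_S: "keys f \<subseteq> {- n..n} \<Longrightarrow> S f \<in> A_window n"
  and A_window_T: "keys f \<subseteq> {- n..n} \<Longrightarrow> T f \<in> A_window n"
proof -
  assume f: "keys f \<subseteq> {- n..n}"
  have "S f = S f + T 0" "T f = S 0 + T f" by simp_all
  moreover have "keys (0 :: laurent) \<subseteq> {- n..n}" by simp
  ultimately show "S f \<in> A_window n" "T f \<in> A_window n"
    unfolding A_window_def using f by blast+
qed

text \<open>Multiplying on the left by a lamp of the first or second family adds only
  \<open>S g\<close> or \<open>T g\<close>, with \<open>g\<close> already in the window. Thus the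
  central support grows linearly with the word as well.\<close>

lemma window_step:
  assumes "w \<in> gens \<union> m_inv G ` gens" "window n x" "n \<ge> 0"
  shows "window (n + 1) (mul w x)"
proof -
  obtain p u u' g \<alpha> where x: "x = (p, u, u', g, \<alpha>)" by (cases x) auto
  have w: "\<bar>p\<bar> \<le> n" "keys u \<subseteq> {- n..n}" "keys u' \<subseteq> {- n..n}" "keys g \<subseteq> {- n..n}" "\<alpha> \<in> A_window n"
    using assms(2) by (simp_all add: x)
  have mono: "keys f \<subseteq> {- (n + 1)..n + 1}" if "keys f \<subseteq> {- n..n}" for f :: laurent
    using that by (rule subset_trans) auto
  have add: "keys (1 + f) \<subseteq> {- (n + 1)..n + 1}" if "keys f \<subseteq> {- n..n}" for f :: laurent
    using keys_add[of 1 f] mono[OF that] assms(3) by auto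
  have shift: "keys (X k * f) \<subseteq> {- (n + 1)..n + 1}" if "keys f \<subseteq> {- n..n}" "\<bar>k\<bar> \<le> 1" for f k
    using keys_X_mult_int[OF that(1), of k] by (rule subset_trans) (use that(2) in auto)
  have A: "\<alpha> \<in> A_window (n + 1)" "S g \<in> A_window (n + 1)" "T g \<in> A_window (n + 1)"
    using A_window_mono[of n "n + 1"] w A_window_S A_window_T by auto
  show ?thesis
    using assms(1) w mono[OF w(2)] mono[OF w(3)] mono[OF w(4)] add[OF w(2)] add[OF w(3)] add[OF w(4)]
      A A_window_add[OF A(1,2)] A_window_add[OF A(1,3)] shift[OF w(2)] shift[OF w(3)] shift[OF w(4)]
    unfolding gens_inv unfolding gens_def by (elim insertE emptyE) (simp_all add: x)
qed

lemma word_window: "is_word G gens ws \<Longrightarrow> window (int (length ws)) (eval_word G ws)"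
proof (induction ws)
  case Nil
  have "0 \<in> A_window 0" using A_window_S[of 0 0] by simp
  then show ?case by (simp add: eval_word_def)
next
  case (Cons w ws)
  then show ?case
    using window_step[of w "int (length ws)" "eval_word G ws"]
    by (simp add: is_word_def G.eval_word_Cons add.commute)
qed

lemma norm_window:
  assumes "x \<in> carrier G" "word_norm G gens x \<le> n"
  shows "window (int n) x"
proof -
  obtain ws where ws: "is_word G gens ws" "eval_word G ws = x" "length ws = word_norm G gens x"
    using G.ex_word_norm[OF finite_generating_gens assms(1)] by blast
  then have "window (int (word_norm G gens x)) x" using word_window by metis
  then show ?thesis
    by (rule window_mono[rotated]) (use assms(2) in simp)
qed

lemma norm_mul:
  assumes "x \<in> carrier G" "y \<in> carrier G"
  shows "word_norm G gens (mul x y) \<le> word_norm G gens x + word_norm G gens y"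
  using G.word_norm_mult[OF finite_generating_gens assms] by simp

lemma norm_gen: "x \<in> gens \<union> m_inv G ` gens \<Longrightarrow> word_norm G gens x \<le> 1"
proof -
  assume x: "x \<in> gens \<union> m_inv G ` gens"
  then have "x \<in> carrier G" using gens_carrier by auto
  then have "eval_word G [x] = x" by (simp add: eval_word_def del: G_simps)
  then show ?thesis using word_norm_le[of G gens "[x]"] x by (simp add: is_word_def)
qed

lemma norm_shift: "word_norm G gens (int k, 0, 0, 0, 0) \<le> k" "word_norm G gens (- int k, 0, 0, 0, 0) \<le> k"
proof (induction k)
  case 0
  show "word_norm G gens (int 0, 0, 0, 0, 0) \<le> 0" "word_norm G gens (- int 0, 0, 0, 0, 0) \<le> 0"
    using G.word_norm_one[OF finite_generating_gens] by simp_all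
next
  case (Suc k)
  have g: "word_norm G gens (1, 0, 0, 0, 0) \<le> 1" "word_norm G gens (- 1, 0, 0, 0, 0) \<le> 1"
    by (rule norm_gen, unfold gens_inv, simp add: gens_def)+
  have eq: "mul (1, 0, 0, 0, 0) (int k, 0, 0, 0, 0) = (int (Suc k), 0, 0, 0, 0)"
    "mul (- 1, 0, 0, 0, 0) (- int k, 0, 0, 0, 0) = (- int (Suc k), 0, 0, 0, 0)"
    by simp_all
  have mem: "(p, 0, 0, 0, 0) \<in> carrier G" for p by simp
  show "word_norm G gens (int (Suc k), 0, 0, 0, 0) \<le> Suc k"
    using norm_mul[OF mem mem, of 1 "int k"] g(1) Suc(1) unfolding eq by linarith
  show "word_norm G gens (- int (Suc k), 0, 0, 0, 0) \<le> Suc k"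
    using norm_mul[OF mem mem, of "- 1" "- int k"] g(2) Suc(2) unfolding eq by linarith
qed

text \<open>The central element is the square of the product of the lamp \<open>a'_k\<close> and
  \<open>c_0\<close>, a product of norm at most \<open>2 * k + 2\<close>.\<close>

lemma norm_T:
  "word_norm G gens (cen (T (X (int k)))) \<le> 4 * k + 4"
  "word_norm G gens (mul (0, 1, 0, 0, 0) (cen (T (X (int k))))) \<le> 4 * k + 5"
  "word_norm G gens (0, 1, 0, 0, 0) \<le> 1"
proof -
  have g: "word_norm G gens (0, 0, 1, 0, 0) \<le> 1" "word_norm G gens (0, 0, 0, 1, 0) \<le> 1"
    "word_norm G gens (0, 1, 0, 0, 0) \<le> 1"
    by (rule norm_gen, simp add: gens_def)+
  then show "word_norm G gens (0, 1, 0, 0, 0) \<le> 1" by simp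
  have "word_norm G gens (0, 0, X (int k), 0, 0) \<le> 2 * k + 1"
    using norm_mul[of "(int k, 0, 0, 0, 0)" "mul (0, 0, 1, 0, 0) (- int k, 0, 0, 0, 0)"]
      norm_mul[of "(0, 0, 1, 0, 0)" "(- int k, 0, 0, 0, 0)"] norm_shift[of k] g(1) by simp
  then have l: "word_norm G gens (0, 0, X (int k), 1, T (X (int k))) \<le> 2 * k + 2"
    using norm_mul[of "(0, 0, X (int k), 0, 0)" "(0, 0, 0, 1, 0)"] g(2) by simp
  then show t: "word_norm G gens (cen (T (X (int k)))) \<le> 4 * k + 4"
    using norm_mul[of "(0, 0, X (int k), 1, T (X (int k)))" "(0, 0, X (int k), 1, T (X (int k)))"]
    by (simp add: A_T cen_def)
  show "word_norm G gens (mul (0, 1, 0, 0, 0) (cen (T (X (int k))))) \<le> 4 * k + 5"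
    using norm_mul[of "(0, 1, 0, 0, 0)" "cen (T (X (int k)))"] cen_closed[OF A_T] g(3) t by simp
qed

text \<open>A conjugator may be multiplied on the right by powers of \<open>x\<close>, which changes
  its shift by multiples of \<open>fst x\<close>. This normalises the shift before the twisted
  equations are solved.\<close>

lemma commuting_shift:
  assumes per: "periodic P Y" "periodic P0 Y0" and x: "x \<in> carrier G" "y \<in> carrier G" "h \<in> carrier G"
    and h: "cong P Y (mul h x) (mul y h)" "cong P0 Y0 (mul h x) (mul y h)"
    and q: "q = fst h + l * fst x"
  shows "\<exists>h\<in>carrier G. fst h = q \<and> cong P Y (mul h x) (mul y h) \<and> cong P0 Y0 (mul h x) (mul y h)"
proof -
  have step: "\<exists>h'\<in>carrier G. fst h' = fst h + fst z \<and> cong P Y (mul h' x) (mul y h') \<and>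
      cong P0 Y0 (mul h' x) (mul y h')"
    if h: "h \<in> carrier G" "cong P Y (mul h x) (mul y h)" "cong P0 Y0 (mul h x) (mul y h)"
      and z: "z \<in> carrier G" "mul z x = mul x z" for h z
  proof (intro bexI conjI)
    have eq: "mul (mul h z) x = mul (mul h x) z" "mul y (mul h z) = mul (mul y h) z"
      using z by (simp_all add: mul_assoc)
    have refl: "cong P Y z z" "cong P0 Y0 z z" by (cases z, simp)+
    show "cong P Y (mul (mul h z) x) (mul y (mul h z))" "cong P0 Y0 (mul (mul h z) x) (mul y (mul h z))"
      unfolding eq by (intro cong_mul per h refl)+
    show "fst (mul h z) = fst h + fst z" by (cases h; cases z) simp
    show "mul h z \<in> carrier G" using G.m_closed[OF h(1) z(1)] by simp
  qed
  have "m_inv G x \<in> carrier G" "mul (m_inv G x) x = (0, 0, 0, 0, 0)" "mul x (m_inv G x) = (0, 0, 0, 0, 0)"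
    using G.l_inv[OF x(1)] G.r_inv[OF x(1)] x(1) by simp_all
  moreover from this(2) have "fst (m_inv G x) = - fst x"
    by (cases "m_inv G x"; cases x) simp
  ultimately have inv: "m_inv G x \<in> carrier G" "mul (m_inv G x) x = mul x (m_inv G x)"
      "fst (m_inv G x) = - fst x"
    by simp_all
  show ?thesis
    using q
  proof (induction l arbitrary: q rule: int_induct[where k = 0])
    case base
    then show ?case using x h by auto
  next
    case (step1 i)
    have "q - fst x = fst h + i * fst x" using step1.prems by (simp add: algebra_simps)
    then obtain h' where h': "h' \<in> carrier G" "fst h' = q - fst x" "cong P Y (mul h' x) (mul y h')"
      "cong P0 Y0 (mul h' x) (mul y h')" using step1.IH by blast
    then show ?case using step[OF h'(1,3,4) x(1) refl] by simp
  next
    case (step2 i)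
    have "q + fst x = fst h + i * fst x" using step2.prems by (simp add: algebra_simps)
    then obtain h' where h': "h' \<in> carrier G" "fst h' = q + fst x" "cong P Y (mul h' x) (mul y h')"
      "cong P0 Y0 (mul h' x) (mul y h')" using step2.IH by blast
    then show ?case using step[OF h'(1,3,4) inv(1,2)] inv(3) by simp
  qed
qed

end

section \<open>Lifting conjugacy from a congruence quotient\<close>

context heis
begin

text \<open>Off \<open>Y\<close> the data of \<open>x\<close> and \<open>y\<close> are invisible, so only the correction terms matter: they are
  moved to the empty region \<open>{4 * M..7 * M}\<close> if \<open>p = 0\<close>, and have small support if \<open>p \<noteq> 0\<close>.\<close>

lemma conjugate_lift:
  assumes per: "periodic M Y" and M: "M = 2 ^ m" "2 * n < int M" "n \<ge> 0"
    and near: "\<And>\<xi> k. \<xi> \<notin> Y \<Longrightarrow> \<bar>k\<bar> \<le> 5 * n \<Longrightarrow> sv \<xi> k = 0 \<and> tv \<xi> k = 0"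
    and far: "\<And>\<xi> k. \<xi> \<notin> Y \<Longrightarrow> 4 * int M \<le> k \<Longrightarrow> k \<le> 7 * int M \<Longrightarrow> sv \<xi> k = 0 \<and> tv \<xi> k = 0"
    and x: "x \<in> carrier G" "window n x" and y: "y \<in> carrier G" "window n y"
    and h: "h \<in> carrier G" "cong (2 * M) Y (mul h x) (mul y h)"
      "cong (nat (max 1 \<bar>fst x\<bar>)) {} (mul h x) (mul y h)"
  shows "conjugate_in G x y"
proof -
  obtain p u u' g \<alpha> where x_eq: "x = (p, u, u', g, \<alpha>)" by (cases x) auto
  obtain p1 u1 u1' g1 \<alpha>1 where y_eq: "y = (p1, u1, u1', g1, \<alpha>1)" by (cases y) auto
  have w: "\<bar>p\<bar> \<le> n" "keys u \<subseteq> {- n..n}" "keys u' \<subseteq> {- n..n}" "keys g \<subseteq> {- n..n}" "\<alpha> \<in> A_window n"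
    "\<bar>p1\<bar> \<le> n" "keys u1 \<subseteq> {- n..n}" "keys u1' \<subseteq> {- n..n}" "keys g1 \<subseteq> {- n..n}" "\<alpha>1 \<in> A_window n"
    using x(2) y(2) by (simp_all add: x_eq y_eq)
  have per2: "periodic (2 * M) Y" using periodic_mult[OF per, of 2] by (simp add: mult.commute)
  have cyc2: "cyc M dvd f" if "cyc (2 * M) dvd f" for f
    using cyc_dvd_cyc[of M "2 * M"] that by (auto intro: dvd_trans)
  have off: "S f \<xi> = 0" "T f \<xi> = 0" if "\<xi> \<notin> Y" "keys f \<subseteq> {- (5 * n)..5 * n}" for f \<xi>
  proof -
    have "sv \<xi> k = 0 \<and> tv \<xi> k = 0" if "k \<in> keys f" for k
      using subsetD[OF \<open>keys f \<subseteq> {- (5 * n)..5 * n}\<close> that] by (intro near[OF \<open>\<xi> \<notin> Y\<close>]) auto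
    then show "S f \<xi> = 0" "T f \<xi> = 0" by (simp_all add: S_def T_def lin_eq_0)
  qed
  have off_far: "S f \<xi> = 0" "T f \<xi> = 0" if "\<xi> \<notin> Y" "keys f \<subseteq> {4 * int M..7 * int M}" for f \<xi>
  proof -
    have "sv \<xi> k = 0 \<and> tv \<xi> k = 0" if "k \<in> keys f" for k
      using subsetD[OF \<open>keys f \<subseteq> {4 * int M..7 * int M}\<close> that] by (intro far[OF \<open>\<xi> \<notin> Y\<close>]) auto
    then show "S f \<xi> = 0" "T f \<xi> = 0" by (simp_all add: S_def T_def lin_eq_0)
  qed
  have off_A: "\<beta> \<xi> = 0" if \<xi>: "\<xi> \<notin> Y" and \<beta>: "\<beta> \<in> A_window n" for \<beta> \<xi>
  proof -
    obtain f f' where f: "\<beta> = S f + T f'" "keys f \<subseteq> {- n..n}" "keys f' \<subseteq> {- n..n}"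
      using \<beta> by (auto simp: A_window_def)
    have "{- n..n} \<subseteq> {- (5 * n)..5 * n}" using M(3) by auto
    then have "keys f \<subseteq> {- (5 * n)..5 * n}" "keys f' \<subseteq> {- (5 * n)..5 * n}"
      using f(2,3) by (meson subset_trans)+
    then show ?thesis using off(1)[OF \<xi>, of f] off(2)[OF \<xi>, of f'] f by simp
  qed
  obtain q0 v0 v0' k0 \<gamma>0 where h0: "h = (q0, v0, v0', k0, \<gamma>0)" by (cases h) auto
  have "int (2 * M) dvd (q0 + p) - (p1 + q0)" using h(2) by (simp add: h0 x_eq y_eq)
  then have "int (2 * M) dvd p - p1" by (simp add: algebra_simps)
  moreover have "\<bar>p - p1\<bar> < int (2 * M)" using w(1,6) M(2,3) by simp
  ultimately have p1: "p1 = p" using dvd_imp_le_int[of "p - p1" "int (2 * M)"] by force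
  show ?thesis
  proof (cases "p = 0")
    case True
    obtain q v v' k \<gamma> where h_eq: "(q, v, v', k, \<gamma>) \<in> carrier G" "cong (2 * M) Y (mul (q, v, v', k, \<gamma>) x) (mul y (q, v, v', k, \<gamma>))"
      using h h0 by metis
    have c: "cyc (2 * M) dvd (v + X q * u) + (u1 + v)" "cyc (2 * M) dvd (v' + X q * u') + (u1' + v')"
        "cyc (2 * M) dvd (k + X (- q) * g) + (g1 + k)"
      and cA: "\<And>\<xi>. \<xi> \<in> Y \<Longrightarrow> (\<gamma> + \<alpha> + S (v * (X (- q) * g)) + T (v' * (X (- q) * g))) \<xi> =
         (\<alpha>1 + \<gamma> + S (u1 * k) + T (u1' * k)) \<xi>"
      using h_eq(2) by (simp_all add: x_eq y_eq p1 True)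
    have c': "cyc (2 * M) dvd f + e" if "cyc (2 * M) dvd (d + f) + (e + d)" for d e f :: laurent
    proof -
      have "(d + f) + (e + d) = (f + e) + (d + d)" by (simp only: ac_simps)
      then show ?thesis using that by simp
    qed
    define q' where "q' = (q + int M) mod int (2 * M) - int M"
    have M0: "M > 0" using M(1) by simp
    have q': "- int M \<le> q'" "q' < int M"
      using pos_mod_bound[of "int (2 * M)" "q + int M"] pos_mod_sign[of "int (2 * M)" "q + int M"] M0
      by (simp_all add: q'_def)
    have "int (2 * M) dvd (q + int M) - (q + int M) mod int (2 * M)" by (rule dvd_minus_mod)
    then have qq': "int (2 * M) dvd q - q'" by (simp add: q'_def algebra_simps)
    \<comment> \<open>With \<open>\<bar>r'\<bar> \<le> M\<close> and \<open>2 * n < M\<close> both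
      supports fit into one interval of length \<open>2 * M\<close>. This is why \<open>q\<close> is
      replaced by its balanced residue \<open>q'\<close>.\<close>
    have exact: "X r' * f = e" if "cyc (2 * M) dvd X r * f + e" "keys f \<subseteq> {- n..n}" "keys e \<subseteq> {- n..n}"
      "int (2 * M) dvd r - r'" "\<bar>r'\<bar> \<le> int M" for r r' f e
    proof -
      have "cyc (2 * M) dvd X r' * f + X r * f"
        using dvd_mult2[OF cyc_dvd_X_diff[OF that(4)], of f] by (simp only: distrib_right add.commute)
      then have "cyc (2 * M) dvd X r' * f + e" by (rule cyc_dvd_trans_add) (rule that(1))
      moreover have "keys (X r' * f + e) \<subseteq> {min r' 0 - n..<(min r' 0 - n) + int (2 * M)}"
      proof
        fix i assume "i \<in> keys (X r' * f + e)"
        then have "i \<in> {r' + - n..r' + n} \<union> {- n..n}"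
          using keys_add[of "X r' * f" e] keys_X_mult_int[OF that(2), of r'] that(3) by blast
        then show "i \<in> {min r' 0 - n..<(min r' 0 - n) + int (2 * M)}"
          using that(5) M(2,3) by (auto simp: min_def)
      qed
      ultimately have "X r' * f + e = 0" by (rule cyc_dvd_short)
      then show ?thesis by (simp only: laurent_add_eq_0)
    qed
    have e: "X q' * u = u1" "X q' * u' = u1'" "X (- q') * g = g1"
      using exact[OF c'[OF c(1)] w(2,7) qq'] exact[OF c'[OF c(2)] w(3,8) qq']
        exact[OF c'[OF c(3)] w(4,9), of "- q'"] q' qq' by (auto simp: dvd_diff_commute)
    \<comment> \<open>For \<open>p = 0\<close> the lamp equations do not involve \<open>v\<close>,
      \<open>v'\<close>, \<open>k\<close>, so any representatives modulo \<open>M\<close> will do.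
      From \<open>{5 * M..<6 * M}\<close>, products with supports of radius \<open>n < M\<close>
      stay in \<open>{4 * M..7 * M}\<close>.\<close>
    have rep: "\<exists>f'. keys f' \<subseteq> {5 * int M..<5 * int M + int M} \<and> cyc M dvd f + f'" for f
      using ex_short_representative[OF M0, of "5 * int M" f] by blast
    obtain z where z: "keys z \<subseteq> {5 * int M..<5 * int M + int M}" "cyc M dvd v + z" using rep by blast
    obtain z' where z': "keys z' \<subseteq> {5 * int M..<5 * int M + int M}" "cyc M dvd v' + z'" using rep by blast
    obtain l where l: "keys l \<subseteq> {5 * int M..<5 * int M + int M}" "cyc M dvd k + l" using rep by blast
    have supp: "keys (f * f') \<subseteq> {4 * int M..7 * int M}"
      if "keys f \<subseteq> {5 * int M..<5 * int M + int M}" "keys f' \<subseteq> {- n..n}" for f f' :: laurent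
    proof -
      have "keys f \<subseteq> {5 * int M..6 * int M}" using that(1) by auto
      from keys_mult_int[OF this that(2)] show ?thesis
        by (rule subset_trans) (use M(2,3) in auto)
    qed
    have gm: "cyc M dvd X (- q) * g + g1" using cyc2[OF c'[OF c(3)]] .
    have "\<alpha> + S (z * g1) + T (z' * g1) = \<alpha>1 + S (u1 * l) + T (u1' * l)"
    proof
      fix \<xi>
      show "(\<alpha> + S (z * g1) + T (z' * g1)) \<xi> = (\<alpha>1 + S (u1 * l) + T (u1' * l)) \<xi>"
      proof (cases "\<xi> \<in> Y")
        case True
        have "S (v * (X (- q) * g)) \<xi> = S (z * g1) \<xi>" "T (v' * (X (- q) * g)) \<xi> = T (z' * g1) \<xi>"
          using periodic_lin[OF per True cyc_dvd_mult_cong[OF z(2) gm]]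
            periodic_lin[OF per True cyc_dvd_mult_cong[OF z'(2) gm]] by simp_all
        moreover have "S (u1 * k) \<xi> = S (u1 * l) \<xi>" "T (u1' * k) \<xi> = T (u1' * l) \<xi>"
          using periodic_lin[OF per True cyc_dvd_mult_cong[of M u1 u1, OF _ l(2)]]
            periodic_lin[OF per True cyc_dvd_mult_cong[of M u1' u1', OF _ l(2)]] by simp_all
        ultimately have "\<gamma> \<xi> + (\<alpha> + S (z * g1) + T (z' * g1)) \<xi> = \<gamma> \<xi> + (\<alpha>1 + S (u1 * l) + T (u1' * l)) \<xi>"
          using cA[OF True] by (simp add: ac_simps)
        then show ?thesis by (simp only: add_left_cancel)
      next
        case False
        then show ?thesis
          using off_A[OF False w(5)] off_A[OF False w(10)] off_far[OF False supp[OF z(1) w(9)]]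
            off_far[OF False supp[OF z'(1) w(9)]] off_far[OF False supp[OF l(1) w(7)]]
            off_far[OF False supp[OF l(1) w(8)]] by (simp add: mult.commute)
      qed
    qed
    then have "mul (q', z, z', l, 0) x = mul y (q', z, z', l, 0)"
      using e by (simp add: x_eq y_eq p1 True add.commute)
    moreover have "(q', z, z', l, 0) \<in> carrier G" by simp
    ultimately show ?thesis using G.conjugate_in_iff[OF x(1) y(1)] by (metis G_simps(2))
  next
    case False
    \<comment> \<open>After reduction by powers of \<open>x\<close> the shift is below
      \<open>\<bar>p\<bar> \<le> n\<close>, so translating by it keeps supports of order
      \<open>n\<close>.\<close>
    define q where "q = q0 mod \<bar>p\<bar>"
    have q: "0 \<le> q" "q < \<bar>p\<bar>" using False by (simp_all add: q_def)
    have "q = fst h + (- (q0 div \<bar>p\<bar>) * sgn p) * fst x"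
    proof -
      have "q = q0 - \<bar>p\<bar> * (q0 div \<bar>p\<bar>)" by (simp add: q_def minus_mult_div_eq_mod)
      then show ?thesis by (simp add: h0 x_eq abs_sgn mult_ac)
    qed
    from commuting_shift[OF per2 periodic_empty x(1) y(1) h(1) h(2,3) this]
    obtain v v' k \<gamma> where hc: "cong (2 * M) Y (mul (q, v, v', k, \<gamma>) x) (mul y (q, v, v', k, \<gamma>))"
      "cong (nat (max 1 \<bar>p\<bar>)) {} (mul (q, v, v', k, \<gamma>) x) (mul y (q, v, v', k, \<gamma>))"
      by (auto simp: x_eq)
    have max: "max 1 \<bar>p\<bar> = \<bar>p\<bar>" using False by auto
    have re: "(d + f) + (e + X r * d) = (X r + 1) * d + (e + f)" for d e f r
      unfolding distrib_right mult_1_left by (simp only: ac_simps)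
    have c: "cyc (2 * M) dvd (X p + 1) * v + (u1 + X q * u)" "cyc (2 * M) dvd (X p + 1) * v' + (u1' + X q * u')"
        "cyc (2 * M) dvd (X (- p) + 1) * k + (g1 + X (- q) * g)"
      and d: "cyc (nat \<bar>p\<bar>) dvd (X p + 1) * v + (u1 + X q * u)"
        "cyc (nat \<bar>p\<bar>) dvd (X p + 1) * v' + (u1' + X q * u')"
        "cyc (nat \<bar>- p\<bar>) dvd (X (- p) + 1) * k + (g1 + X (- q) * g)"
      and cA: "\<And>\<xi>. \<xi> \<in> Y \<Longrightarrow> (\<gamma> + \<alpha> + S (v * (X (- q) * g)) + T (v' * (X (- q) * g))) \<xi> =
         (\<alpha>1 + \<gamma> + S (u1 * (X (- p) * k)) + T (u1' * (X (- p) * k))) \<xi>"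
      using hc unfolding x_eq y_eq p1 mul_simp cong_simp re max abs_minus_cancel by blast+
    have pM: "\<bar>p\<bar> < int M" "\<bar>- p\<bar> < int M" using w(1) M(2,3) by auto
    have qn: "\<bar>q\<bar> \<le> n" "\<bar>- q\<bar> \<le> n" using q w(1) by auto
    obtain z where z: "(X p + 1) * z = u1 + X q * u" "cyc M dvd v + z" "keys z \<subseteq> {- 2 * n..2 * n}"
      using twisted_solution[OF False pM(1) M(1) d(1) c(1) qn(1) w(2,7)] by blast
    obtain z' where z': "(X p + 1) * z' = u1' + X q * u'" "cyc M dvd v' + z'" "keys z' \<subseteq> {- 2 * n..2 * n}"
      using twisted_solution[OF False pM(1) M(1) d(2) c(2) qn(1) w(3,8)] by blast
    have "- p \<noteq> 0" using False by simp
    from twisted_solution[OF this pM(2) M(1) d(3) c(3) qn(2) w(4,9)]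
    obtain l where l: "(X (- p) + 1) * l = g1 + X (- q) * g" "cyc M dvd k + l" "keys l \<subseteq> {- 2 * n..2 * n}"
      by blast
    \<comment> \<open>The radii add up to \<open>4 * n\<close>: a solution has \<open>2 * n\<close>,
      the other factor \<open>n\<close>, and the translation at most \<open>n\<close>. This lies in
      the zone of zeros of radius \<open>5 * n\<close>.\<close>
    have supp1: "keys (f * (X (- q) * g)) \<subseteq> {- (5 * n)..5 * n}" if "keys f \<subseteq> {- 2 * n..2 * n}" for f
      using keys_mult_int[OF that keys_X_mult_int[OF w(4), of "- q"]]
      by (rule subset_trans) (use qn in auto)
    have supp2: "keys (f * (X (- p) * l)) \<subseteq> {- (5 * n)..5 * n}" if "keys f \<subseteq> {- n..n}" for f
      using keys_mult_int[OF that keys_X_mult_int[OF l(3), of "- p"]]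
      by (rule subset_trans) (use w(1) in auto)
    have A: "\<alpha> + S (z * (X (- q) * g)) + T (z' * (X (- q) * g)) =
        \<alpha>1 + S (u1 * (X (- p) * l)) + T (u1' * (X (- p) * l))"
    proof
      fix \<xi>
      show "(\<alpha> + S (z * (X (- q) * g)) + T (z' * (X (- q) * g))) \<xi> =
        (\<alpha>1 + S (u1 * (X (- p) * l)) + T (u1' * (X (- p) * l))) \<xi>"
      proof (cases "\<xi> \<in> Y")
        case True
        have triv: "cyc M dvd f + f" for f by simp
        have l': "cyc M dvd X (- p) * k + X (- p) * l" by (rule cyc_dvd_mult_cong[OF triv l(2)])
        have "S (v * (X (- q) * g)) \<xi> = S (z * (X (- q) * g)) \<xi>"
          "T (v' * (X (- q) * g)) \<xi> = T (z' * (X (- q) * g)) \<xi>"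
          "S (u1 * (X (- p) * k)) \<xi> = S (u1 * (X (- p) * l)) \<xi>"
          "T (u1' * (X (- p) * k)) \<xi> = T (u1' * (X (- p) * l)) \<xi>"
          by (intro periodic_lin[OF per True] cyc_dvd_mult_cong triv z(2) z'(2) l')+
        then have "\<gamma> \<xi> + (\<alpha> + S (z * (X (- q) * g)) + T (z' * (X (- q) * g))) \<xi> =
            \<gamma> \<xi> + (\<alpha>1 + S (u1 * (X (- p) * l)) + T (u1' * (X (- p) * l))) \<xi>"
          using cA[OF True] by (simp add: ac_simps)
        then show ?thesis by (simp only: add_left_cancel)
      next
        case False
        then show ?thesis
          using off_A[OF False w(5)] off_A[OF False w(10)] off(1)[OF False supp1[OF z(3)]]
            off(2)[OF False supp1[OF z'(3)]] off(1)[OF False supp2[OF w(7)]]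
            off(2)[OF False supp2[OF w(8)]] by simp
      qed
    qed
    have solve: "d + e = f + X r * d" if "(X r + 1) * d = f + e" for d e f r
    proof -
      have eq: "X r * d + d = f + e" using that by (simp add: distrib_right)
      have "d + e = X r * d + ((X r * d + d) + e)" by (simp add: add.assoc)
      also have "\<dots> = X r * d + (f + (e + e))" by (simp only: eq add.assoc)
      finally show ?thesis by (simp add: add.commute)
    qed
    have "mul (q, z, z', l, 0) x = mul y (q, z, z', l, 0)"
      unfolding x_eq y_eq p1 mul_simp prod.inject
      using solve[OF z(1)] solve[OF z'(1)] solve[OF l(1)] A by simp
    moreover have "(q, z, z', l, 0) \<in> carrier G" by simp
    ultimately show ?thesis using G.conjugate_in_iff[OF x(1) y(1)] by (metis G_simps(2))
  qed
qed

end

section \<open>Towers of periodic functionals\<close>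

text \<open>The octal number with \<open>t\<close> digits 2. Truncations agree modulo smaller powers
  of 8, and the leading digit 2 keeps the point away from 0 and below the zone starting at
  \<open>4 * 8 ^ (t - 1)\<close>.\<close>

fun chk :: "nat \<Rightarrow> int" where
  "chk 0 = 0"
| "chk (Suc t) = chk t + 2 * 8 ^ t"

lemma chk_eq: "7 * chk t = 2 * 8 ^ t - 2"
  by (induction t) simp_all

lemma chk_bounds: "2 * 8 ^ t \<le> chk (Suc t)" "chk (Suc t) < 3 * 8 ^ t" "0 \<le> chk t"
proof -
  have "(1::int) \<le> 8 ^ t" by simp
  then show "2 * 8 ^ t \<le> chk (Suc t)" "chk (Suc t) < 3 * 8 ^ t" "0 \<le> chk t"
    using chk_eq[of t] unfolding chk.simps by linarith+
qed

lemma chk_mod: "s \<le> t \<Longrightarrow> 8 ^ s dvd chk t - chk s"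
proof (induction t)
  case (Suc t)
  show ?case
  proof (cases "s = Suc t")
    case False
    then have "8 ^ s dvd (chk t - chk s) + 2 * 8 ^ t"
      using Suc by (intro dvd_add dvd_mult le_imp_power_dvd) auto
    then show ?thesis by (simp add: algebra_simps)
  qed simp
qed simp

lemma not_dvd_between: "0 < x \<Longrightarrow> x < m \<Longrightarrow> \<not> m dvd (x::int)"
  by (rule zdvd_not_zless)

text \<open>\<open>\<tau> e\<close> and \<open>\<rho> e\<close> will be the integer parts of
  \<open>log_8 (log_2 F1)\<close> and \<open>log_8 (log_2 F2)\<close> at an argument of order
  \<open>8 ^ (d * e)\<close>. The margin 3 in \<open>\<tau>_ge\<close> makes positions small
  compared with their periods.\<close>

locale tower =
  fixes d :: nat and \<tau> \<rho> :: "nat \<Rightarrow> nat"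
  assumes d: "d \<ge> 1" and \<tau>_mono: "strict_mono \<tau>" and \<tau>_ge: "\<And>e. d * e + 3 \<le> \<tau> e"
    and \<rho>_mono: "mono \<rho>" and \<tau>_le_\<rho>: "\<And>j. \<tau> j \<le> \<rho> j"
begin

definition pos :: "nat \<Rightarrow> int" where "pos j = 8 ^ (d * j)"

text \<open>The last period \<open>\<rho> j\<close> governs conjugacy of the witness of scale
  \<open>j\<close>. The periods \<open>\<tau> e\<close> below it make that witness visible to every
  later scale \<open>e\<close> at the price belonging to \<open>e\<close>.\<close>

definition \<Theta> :: "nat \<Rightarrow> nat set" where
  "\<Theta> j = insert (\<rho> j) {\<tau> e | e. j \<le> e \<and> \<tau> e < \<rho> j}"

text \<open>The check point \<open>pos j + chk t\<close> is the residue modulo \<open>8 ^ t\<close> of the 2-adic integer \<open>pos j - 2/7\<close>: it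
  is the same point for all periods, but has absolute value of the order of \<open>8 ^ t\<close>.\<close>

definition tv :: "nat \<times> nat \<Rightarrow> int \<Rightarrow> bit" where
  "tv = (\<lambda>(j, t) k. of_bool (t \<in> \<Theta> j \<and> 8 ^ t dvd k - pos j))"

definition sv :: "nat \<times> nat \<Rightarrow> int \<Rightarrow> bit" where
  "sv = (\<lambda>(j, t) k. of_bool (t \<in> \<Theta> j \<and> t < \<rho> j \<and> 8 ^ t dvd k - pos j - chk t))"

sublocale heis sv tv .

lemma tv_iff: "tv (j, t) k = 1 \<longleftrightarrow> t \<in> \<Theta> j \<and> 8 ^ t dvd k - pos j"
  and tv_iff_0: "tv (j, t) k = 0 \<longleftrightarrow> \<not> (t \<in> \<Theta> j \<and> 8 ^ t dvd k - pos j)"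
  and sv_iff_0: "sv (j, t) k = 0 \<longleftrightarrow> \<not> (t \<in> \<Theta> j \<and> t < \<rho> j \<and> 8 ^ t dvd k - pos j - chk t)"
  by (simp_all add: tv_def sv_def)

lemma pos_gt_0: "pos j > 0"
  by (simp add: pos_def)

lemma pos_le_iff: "pos i \<le> pos j \<longleftrightarrow> i \<le> j"
  using d by (simp add: pos_def)

lemma pos_inject: "pos i = pos j \<longleftrightarrow> i = j"
  using pos_le_iff[of i j] pos_le_iff[of j i] by auto

lemma \<Theta>_bounds:
  assumes "t \<in> \<Theta> j"
  shows "\<tau> j \<le> t" "t \<le> \<rho> j" "d * j + 3 \<le> t"
proof -
  show 1: "\<tau> j \<le> t"
    using assms \<tau>_le_\<rho>[of j] strict_mono_less_eq[OF \<tau>_mono] by (auto simp: \<Theta>_def)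
  show "t \<le> \<rho> j" using assms by (auto simp: \<Theta>_def)
  show "d * j + 3 \<le> t" using 1 \<tau>_ge[of j] by simp
qed

lemma pos_small:
  assumes "d * j + 3 \<le> t"
  shows "64 * pos j \<le> 8 ^ (t - 1)"
proof -
  have "(8::int) ^ (d * j + 2) \<le> 8 ^ (t - 1)" using assms by (intro power_increasing) auto
  then show ?thesis by (simp add: pos_def power_add)
qed

text \<open>Positions are powers of 8, so one beyond \<open>8 ^ t\<close> vanishes modulo
  \<open>8 ^ Suc t\<close>. Large scales thus collapse to 0 and cannot collide with the positions of
  small ones.\<close>

lemma pos_cases: "pos j \<le> 8 ^ t \<or> 8 ^ Suc t dvd pos j"
  using le_imp_power_dvd[of "Suc t" "d * j" "8::int"] power_increasing[of "d * j" t "8::int"]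
  by (cases "d * j \<le> t") (simp_all add: pos_def)

lemma power_pred: "t > 0 \<Longrightarrow> (8::int) ^ t = 8 * 8 ^ (t - 1)"
  by (cases t) simp_all

lemma near_tv:
  assumes "t \<in> \<Theta> j" "\<bar>k\<bar> \<le> 8 ^ (t - 1)"
  shows "tv (j, t) k = of_bool (k = pos j)"
proof -
  have t: "t > 0" and p: "64 * pos j \<le> 8 ^ (t - 1)"
    using \<Theta>_bounds(3)[OF assms(1)] pos_small by auto
  have "k = pos j" if "8 ^ t dvd k - pos j"
  proof (rule ccontr)
    assume "k \<noteq> pos j"
    then have "(8::int) ^ t \<le> \<bar>k - pos j\<bar>" using dvd_imp_le_int[OF _ that] by simp
    then show False using assms(2) p power_pred[OF t] pos_gt_0[of j] by linarith
  qed
  then show ?thesis using assms(1) by (auto simp: tv_def)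
qed

text \<open>The check point lies strictly between \<open>8 ^ (t - 1)\<close> and
  \<open>4 * 8 ^ (t - 1)\<close>, and its translates by multiples of \<open>8 ^ t\<close> miss the
  interval around 0.\<close>

lemma near_sv:
  assumes "t \<in> \<Theta> j" "\<bar>k\<bar> \<le> 8 ^ (t - 1)"
  shows "sv (j, t) k = 0"
proof -
  have t: "t > 0" and p: "64 * pos j \<le> 8 ^ (t - 1)"
    using \<Theta>_bounds(3)[OF assms(1)] pos_small by auto
  have c: "2 * 8 ^ (t - 1) \<le> chk t" "chk t < 3 * 8 ^ (t - 1)"
    using chk_bounds(1,2)[of "t - 1"] t by simp_all
  have "\<not> 8 ^ t dvd - (k - pos j - chk t)"
    using assms(2) p c power_pred[OF t] pos_gt_0[of j] by (intro not_dvd_between) linarith+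
  then have "\<not> 8 ^ t dvd k - pos j - chk t" unfolding dvd_minus_iff .
  then show ?thesis by (simp add: sv_iff_0)
qed

text \<open>It suffices to look modulo \<open>8 ^ Suc s\<close>: there positions reduce to 0 or to
  at most \<open>8 ^ s\<close>, and check points to values below \<open>4 * 8 ^ s\<close>. The
  interval treated here is the zone of zeros far from the origin.\<close>

lemma far_tv_sv:
  assumes "s < t" "4 * 8 ^ s \<le> k" "k \<le> 7 * 8 ^ s"
  shows "tv (j, t) k = 0" "sv (j, t) k = 0"
proof -
  have dv: "8 ^ Suc s dvd x" if "8 ^ t dvd x" for x :: int
    using that le_imp_power_dvd[of "Suc s" t "8::int"] assms(1) by (auto intro: dvd_trans)
  have "(8::int) ^ s > 0" by simp
  have 1: "\<not> 8 ^ Suc s dvd l - pos j" if "8 ^ s < l" "l \<le> 7 * 8 ^ s" for l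
    using pos_cases[of j s]
  proof
    assume "pos j \<le> 8 ^ s"
    then show ?thesis using that pos_gt_0[of j] by (intro not_dvd_between) auto
  next
    assume "8 ^ Suc s dvd pos j"
    moreover have "\<not> 8 ^ Suc s dvd l"
      using that \<open>(8::int) ^ s > 0\<close> by (intro not_dvd_between) auto
    ultimately show ?thesis by (metis dvd_add diff_add_cancel)
  qed
  show "tv (j, t) k = 0"
    using 1[of k] dv[of "k - pos j"] assms(2,3) \<open>(8::int) ^ s > 0\<close> by (auto simp: tv_iff_0)
  have c: "2 * 8 ^ s \<le> chk (Suc s)" "chk (Suc s) < 3 * 8 ^ s" by (rule chk_bounds)+
  have "\<not> 8 ^ t dvd k - pos j - chk t"
  proof
    assume "8 ^ t dvd k - pos j - chk t"
    from dvd_add[OF dv[OF this] chk_mod[OF Suc_leI[OF assms(1)]]]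
    have "8 ^ Suc s dvd (k - pos j - chk t) + (chk t - chk (Suc s))" .
    moreover have "(k - pos j - chk t) + (chk t - chk (Suc s)) = (k - chk (Suc s)) - pos j" by linarith
    ultimately have "8 ^ Suc s dvd (k - chk (Suc s)) - pos j" by (simp only:)
    moreover have "8 ^ s < k - chk (Suc s)" "k - chk (Suc s) \<le> 7 * 8 ^ s"
      using c assms(2,3) \<open>(8::int) ^ s > 0\<close> by linarith+
    ultimately show False using 1 by blast
  qed
  then show "sv (j, t) k = 0" by (simp add: sv_iff_0)
qed

lemma pos_cong_imp_eq:
  assumes "8 ^ t dvd pos i - pos j" "d * j + 3 \<le> t"
  shows "i = j"
proof -
  have t: "t > 0" and p: "64 * pos j \<le> 8 ^ (t - 1)" using assms(2) pos_small by auto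
  have j: "pos j < 8 ^ t" using p power_pred[OF t] pos_gt_0[of j] by linarith
  show ?thesis
    using pos_cases[of i "t - 1"]
  proof
    assume "pos i \<le> 8 ^ (t - 1)"
    then have "\<bar>pos i - pos j\<bar> < 8 ^ t"
      using p power_pred[OF t] pos_gt_0[of i] pos_gt_0[of j] by linarith
    then have "pos i - pos j = 0" using assms(1) dvd_imp_le_int[of "pos i - pos j" "8 ^ t"] by fastforce
    then show ?thesis by (simp add: pos_inject)
  next
    assume "8 ^ Suc (t - 1) dvd pos i"
    then have "8 ^ t dvd pos i" using t by simp
    then have "8 ^ t dvd pos j" using assms(1) by (metis dvd_diff diff_diff_eq2 add_diff_cancel_left')
    then show ?thesis using not_dvd_between[OF pos_gt_0 j] by blast
  qed
qed

text \<open>An odd multiple of \<open>2 ^ (3 * r - 1)\<close> is half the period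
  \<open>8 ^ r\<close>, up to whole periods, and a multiple of all shorter periods.\<close>

lemma half_period:
  assumes "odd q" "r > 0"
  shows "\<exists>c. int (q * 2 ^ (3 * r - 1)) = 4 * 8 ^ (r - 1) + c * 8 ^ r"
    "\<exists>c. int (q * 2 ^ (3 * r - 1)) = c * 8 ^ (r - 1)"
proof -
  obtain s where r: "r = Suc s" using assms(2) by (cases r) auto
  have "(2::nat) ^ (3 * r - 1) = 2 ^ (2 + 3 * s)" by (simp add: r)
  also have "\<dots> = 4 * 8 ^ s" by (simp only: power_add power_mult) simp
  finally have w: "int (q * 2 ^ (3 * r - 1)) = int q * (4 * 8 ^ s)" by simp
  obtain c where "q = 2 * c + 1" using assms(1) by (rule oddE)
  then have "int (q * 2 ^ (3 * r - 1)) = 4 * 8 ^ (r - 1) + int c * 8 ^ r"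
    unfolding w by (simp add: r algebra_simps)
  then show "\<exists>c. int (q * 2 ^ (3 * r - 1)) = 4 * 8 ^ (r - 1) + c * 8 ^ r" by blast
  show "\<exists>c. int (q * 2 ^ (3 * r - 1)) = c * 8 ^ (r - 1)"
    unfolding w by (intro exI[of _ "4 * int q"]) (simp add: r)
qed

text \<open>The translation is invisible at periods below \<open>8 ^ r\<close> and moves the
  position off its residue class at all others. With \<open>r = \<tau> j\<close> nothing remains,
  with \<open>r = \<rho> j\<close> only the last coordinate is lost.\<close>

lemma tv_half_period:
  assumes q: "odd q" and r: "d * j + 3 \<le> r"
  shows "tv (i, t) (pos j + int (q * 2 ^ (3 * r - 1))) = of_bool (i = j \<and> t \<in> \<Theta> j \<and> t < r)"
proof -
  let ?w = "int (q * 2 ^ (3 * r - 1))"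
  have r0: "r > 0" and p: "64 * pos j \<le> 8 ^ (r - 1)" using r pos_small by auto
  obtain c where c: "?w = 4 * 8 ^ (r - 1) + c * 8 ^ r" using half_period(1)[OF q r0] by blast
  obtain c' where c': "?w = c' * 8 ^ (r - 1)" using half_period(2)[OF q r0] by blast
  have dvd_w: "8 ^ t dvd ?w" if "t < r"
    unfolding c' using that by (intro dvd_mult le_imp_power_dvd) simp
  have "\<not> 8 ^ t dvd (pos j + ?w) - pos i" if "r \<le> t"
  proof
    assume "8 ^ t dvd (pos j + ?w) - pos i"
    from dvd_diff[OF dvd_trans[OF le_imp_power_dvd[OF that] this] dvd_triv_right[of "8 ^ r" c]]
    have "8 ^ r dvd (pos j + ?w) - pos i - c * 8 ^ r" .
    moreover have "(pos j + ?w) - pos i - c * 8 ^ r = (pos j + 4 * 8 ^ (r - 1)) - pos i"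
      unfolding c by linarith
    ultimately have *: "8 ^ r dvd (pos j + 4 * 8 ^ (r - 1)) - pos i" by (simp only:)
    have e: "(8::int) ^ r = 8 * 8 ^ (r - 1)" by (rule power_pred[OF r0])
    show False
      using pos_cases[of i "r - 1"]
    proof
      assume "pos i \<le> 8 ^ (r - 1)"
      then have "\<not> 8 ^ r dvd (pos j + 4 * 8 ^ (r - 1)) - pos i"
        using p pos_gt_0[of i] pos_gt_0[of j] e by (intro not_dvd_between) linarith+
      then show False using * by blast
    next
      assume "8 ^ Suc (r - 1) dvd pos i"
      then have "8 ^ r dvd pos i" using r0 by simp
      from dvd_add[OF * this] have "8 ^ r dvd (pos j + 4 * 8 ^ (r - 1)) - pos i + pos i" .
      moreover have "\<not> 8 ^ r dvd pos j + 4 * 8 ^ (r - 1)"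
        using p pos_gt_0[of j] e by (intro not_dvd_between) linarith+
      ultimately show False by simp
    qed
  qed
  moreover have "8 ^ t dvd (pos j + ?w) - pos i \<longleftrightarrow> i = j" if "t \<in> \<Theta> i" "t < r"
  proof -
    have "8 ^ t dvd (pos j + ?w) - pos i \<longleftrightarrow> 8 ^ t dvd pos j - pos i"
      using dvd_add_left_iff[OF dvd_w[OF that(2)], of "pos j - pos i"] by (simp add: algebra_simps)
    also have "\<dots> \<longleftrightarrow> i = j"
      using pos_cong_imp_eq[of t j i] \<Theta>_bounds(3)[OF that(1)] by auto
    finally show ?thesis .
  qed
  ultimately show ?thesis by (cases "t < r") (auto simp: tv_def)
qed

text \<open>For \<open>t \<le> r\<close> the point reduces to the check point of period
  \<open>8 ^ t\<close>; for larger \<open>t\<close> its octal digit 2 at place \<open>r\<close> is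
  missing. The result is the pattern of \<open>tv_half_period\<close> with
  \<open>r = \<rho> j\<close>, which makes an \<open>S\<close>-value equal to a translated
  \<open>T\<close>-value.\<close>

lemma sv_check_point:
  assumes r: "r = \<rho> j"
  shows "sv (i, t) (pos j + chk r) = of_bool (i = j \<and> t \<in> \<Theta> j \<and> t < r)"
proof -
  have r3: "d * j + 3 \<le> r" using r \<tau>_ge[of j] \<tau>_le_\<rho>[of j] by simp
  then have p: "64 * pos j \<le> 8 ^ r" using pos_small[of j "Suc r"] by simp
  have "\<not> 8 ^ t dvd (pos j + chk r) - pos i - chk t" if "r < t"
  proof
    assume "8 ^ t dvd (pos j + chk r) - pos i - chk t"
    from dvd_trans[OF le_imp_power_dvd[OF Suc_leI[OF that]] this]
    have "8 ^ Suc r dvd (pos j + chk r) - pos i - chk t" .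
    from dvd_add[OF this chk_mod[OF Suc_leI[OF that]]]
    have "8 ^ Suc r dvd ((pos j + chk r) - pos i - chk t) + (chk t - chk (Suc r))" .
    then have "8 ^ Suc r dvd - (((pos j + chk r) - pos i - chk t) + (chk t - chk (Suc r)))"
      unfolding dvd_minus_iff .
    moreover have "- (((pos j + chk r) - pos i - chk t) + (chk t - chk (Suc r))) =
        (2 * 8 ^ r - pos j) + pos i" unfolding chk.simps by linarith
    ultimately have *: "8 ^ Suc r dvd (2 * 8 ^ r - pos j) + pos i" by (simp only:)
    show False
      using pos_cases[of i r]
    proof
      assume "pos i \<le> 8 ^ r"
      then have "\<not> 8 ^ Suc r dvd (2 * 8 ^ r - pos j) + pos i"
        using p pos_gt_0[of i] pos_gt_0[of j] by (intro not_dvd_between) auto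
      then show False using * by blast
    next
      assume "8 ^ Suc r dvd pos i"
      then have "8 ^ Suc r dvd (2 * 8 ^ r - pos j)" using * by (simp add: dvd_add_left_iff)
      moreover have "\<not> 8 ^ Suc r dvd 2 * 8 ^ r - pos j"
        using p pos_gt_0[of j] by (intro not_dvd_between) auto
      ultimately show False by blast
    qed
  qed
  moreover have "8 ^ t dvd (pos j + chk r) - pos i - chk t \<longleftrightarrow> i = j" if "t \<in> \<Theta> i" "t \<le> r"
  proof -
    have "8 ^ t dvd (pos j + chk r) - pos i - chk t \<longleftrightarrow> 8 ^ t dvd pos j - pos i"
      using dvd_add_left_iff[OF chk_mod[OF that(2)], of "pos j - pos i"] by (simp add: algebra_simps)
    also have "\<dots> \<longleftrightarrow> i = j"
      using pos_cong_imp_eq[of t j i] \<Theta>_bounds(3)[OF that(1)] by auto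
    finally show ?thesis .
  qed
  ultimately show ?thesis using r \<Theta>_bounds(2)[of t i] by (cases "t \<le> r") (auto simp: sv_def)
qed

section \<open>Coordinates of bounded period and upper bounds\<close>

definition Y :: "nat \<Rightarrow> (nat \<times> nat) set" where
  "Y s = {(j, t). t \<in> \<Theta> j \<and> t \<le> s}"

lemma Y_subset: "Y s \<subseteq> {..s} \<times> {..s}"
proof -
  have "j \<le> s" if "t \<in> \<Theta> j" "t \<le> s" for j t
  proof -
    have "j \<le> d * j" using d by simp
    then show ?thesis using \<Theta>_bounds(3)[OF that(1)] that(2) by linarith
  qed
  then show ?thesis by (auto simp: Y_def)
qed

lemma finite_Y: "finite (Y s)"
  using Y_subset by (rule finite_subset) simp

lemma card_Y: "card (Y s) \<le> 8 ^ s"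
proof -
  have "card (Y s) \<le> card ({..s} \<times> {..s})" by (rule card_mono[OF _ Y_subset]) simp
  also have "\<dots> = (s + 1) ^ 2" by (simp add: card_cartesian_product power2_eq_square)
  also have "(s + 1) ^ 2 \<le> 8 ^ s"
    by (induction s) (simp_all add: power2_eq_square algebra_simps)
  finally show ?thesis .
qed

lemma periodic_Y: "periodic (8 ^ s) (Y s)"
proof -
  have "sv (j, t) (k + 8 ^ s) = sv (j, t) k" "tv (j, t) (k + 8 ^ s) = tv (j, t) k" if "t \<le> s" for j t k
  proof -
    have dv: "(8::int) ^ t dvd 8 ^ s" using that by (rule le_imp_power_dvd)
    have "8 ^ t dvd (k + 8 ^ s) - pos j \<longleftrightarrow> 8 ^ t dvd k - pos j"
      "8 ^ t dvd (k + 8 ^ s) - pos j - chk t \<longleftrightarrow> 8 ^ t dvd k - pos j - chk t"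
      using dvd_add_left_iff[OF dv, of "k - pos j"] dvd_add_left_iff[OF dv, of "k - pos j - chk t"]
      by (simp_all add: algebra_simps)
    then show "sv (j, t) (k + 8 ^ s) = sv (j, t) k" "tv (j, t) (k + 8 ^ s) = tv (j, t) k"
      by (simp_all add: sv_def tv_def)
  qed
  then show ?thesis by (auto simp: periodic_def Y_def)
qed

lemma not_in_Y:
  assumes "(j, t) \<notin> Y s" "sv (j, t) k \<noteq> 0 \<or> tv (j, t) k \<noteq> 0"
  shows "t \<in> \<Theta> j" "s < t"
  using assms by (auto simp: Y_def sv_iff_0 tv_iff_0)

lemma exponent_arith: "(8::nat) ^ s \<ge> 1" "x \<le> (2::nat) ^ x"
  by (simp_all add: less_imp_le)

text \<open>The four factors contribute the exponents \<open>2 * M\<close>, \<open>7 * M\<close>,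
  \<open>M\<close> and \<open>3 * M\<close>, whence the constant 13.\<close>

lemma cls_bound_le:
  assumes "P \<le> 2 * M" "y \<le> M" "P0 \<le> M" "M \<ge> 1"
  shows "cls_bound P y P0 \<le> 2 ^ (13 * M)"
proof -
  have "cls_bound P y P0 \<le> 2 ^ (2 * M) * 2 ^ (3 * (2 * M) + M) * (2 ^ M * 2 ^ (3 * M))"
    unfolding cls_bound_def
  proof (intro mult_mono)
    show "P \<le> 2 ^ (2 * M)" using assms(1) exponent_arith(2)[of "2 * M"] by linarith
    show "P0 \<le> 2 ^ M" using assms(3) exponent_arith(2)[of M] by linarith
    show "(2::nat) ^ (3 * P + y) \<le> 2 ^ (3 * (2 * M) + M)"
      using assms by (intro power_increasing) auto
    show "(2::nat) ^ (3 * P0) \<le> 2 ^ (3 * M)" using assms by (intro power_increasing) auto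
  qed auto
  also have "\<dots> = 2 ^ (13 * M)" by (simp flip: power_add)
  finally show ?thesis .
qed

text \<open>The modulus \<open>2 * M\<close> with \<open>M = 8 ^ \<rho> J\<close> resolves all
  coordinates of period up to \<open>M\<close>. The factor 5 in the bound on \<open>N\<close> covers
  the supports arising when the conjugator is corrected.\<close>

lemma conj_detect_upper:
  assumes N: "5 * int N \<le> pos J" and x: "x \<in> carrier G" "word_norm G gens x \<le> N"
    and y: "y \<in> carrier G" "word_norm G gens y \<le> N" and nc: "\<not> conjugate_in G x y"
  shows "conj_detect G x y (2 ^ (13 * 8 ^ \<rho> J))"
proof -
  define M :: nat where "M = 8 ^ \<rho> J"
  have "(8::nat) ^ \<rho> J = 2 ^ (3 * \<rho> J)" by (simp only: power_mult) simp
  then have M2: "M = 2 ^ (3 * \<rho> J)" by (simp add: M_def)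
  have "d * J + 3 \<le> \<rho> J" using \<tau>_ge[of J] \<tau>_le_\<rho>[of J] by simp
  then have posM: "64 * pos J \<le> 8 ^ (\<rho> J - 1)" and r0: "\<rho> J > 0" using pos_small by auto
  have intM: "int M = 8 * 8 ^ (\<rho> J - 1)" using power_pred[OF r0] by (simp add: M_def)
  have NM: "2 * int N < int M" using N posM intM pos_gt_0[of J] by linarith
  have M0: "M > 0" by (simp add: M_def)
  have per: "periodic M (Y (\<rho> J))" using periodic_Y by (simp add: M_def)
  have per2: "periodic (2 * M) (Y (\<rho> J))" using periodic_mult[OF per, of 2] by (simp add: mult.commute)
  have near: "sv \<xi> k = 0 \<and> tv \<xi> k = 0" if "\<xi> \<notin> Y (\<rho> J)" "\<bar>k\<bar> \<le> 5 * int N" for \<xi> k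
  proof (rule ccontr)
    obtain j t where \<xi>: "\<xi> = (j, t)" by (cases \<xi>)
    assume "\<not> (sv \<xi> k = 0 \<and> tv \<xi> k = 0)"
    then have t: "t \<in> \<Theta> j" "\<rho> J < t" using not_in_Y[of j t "\<rho> J" k] that(1) by (auto simp: \<xi>)
    then have "(8::int) ^ \<rho> J \<le> 8 ^ (t - 1)" by (intro power_increasing) auto
    moreover have "\<bar>k\<bar> \<le> 8 ^ \<rho> J" using that(2) N posM power_pred[OF r0] pos_gt_0[of J] by linarith
    ultimately have k: "\<bar>k\<bar> \<le> 8 ^ (t - 1)" by (rule order_trans[rotated])
    have "k = pos j"
      using \<open>\<not> (sv \<xi> k = 0 \<and> tv \<xi> k = 0)\<close> near_sv[OF t(1) k] near_tv[OF t(1) k]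
      by (auto simp: \<xi>)
    \<comment> \<open>A position this close to the origin belongs to a scale
      \<open>j \<le> J\<close>, all of whose periods are at most \<open>8 ^ \<rho> J\<close> and
      hence resolved by \<open>Y\<close>.\<close>
    then have "pos j \<le> pos J" using that(2) N by simp
    then have "\<rho> j \<le> \<rho> J" using \<rho>_mono by (simp add: pos_le_iff monoD)
    then show False using \<Theta>_bounds(2)[OF t(1)] t(2) by simp
  qed
  have far: "sv \<xi> k = 0 \<and> tv \<xi> k = 0"
    if "\<xi> \<notin> Y (\<rho> J)" "4 * int M \<le> k" "k \<le> 7 * int M" for \<xi> k
  proof (rule ccontr)
    obtain j t where \<xi>: "\<xi> = (j, t)" by (cases \<xi>)
    assume *: "\<not> (sv \<xi> k = 0 \<and> tv \<xi> k = 0)"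
    then have "\<rho> J < t" using not_in_Y[of j t "\<rho> J" k] that(1) by (auto simp: \<xi>)
    then show False using far_tv_sv[of "\<rho> J" t k j] that(2,3) * by (simp add: \<xi> M_def)
  qed
  define P0 where "P0 = nat (max 1 \<bar>fst x\<bar>)"
  have wx: "window (int N) x" "window (int N) y" using norm_window x y by auto
  have "conj_detect G x y (cls_bound (2 * M) (card (Y (\<rho> J))) P0)"
  proof (rule conj_detect_cong[OF per2 finite_Y _ _ x(1) y(1)])
    fix h assume "h \<in> carrier G" "cong (2 * M) (Y (\<rho> J)) (h \<otimes>\<^bsub>G\<^esub> x) (y \<otimes>\<^bsub>G\<^esub> h)"
      "cong P0 {} (h \<otimes>\<^bsub>G\<^esub> x) (y \<otimes>\<^bsub>G\<^esub> h)"
    then have "conjugate_in G x y"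
      using conjugate_lift[OF per M2 NM _ near far x(1) wx(1) y(1) wx(2), of h] by (simp add: P0_def)
    then show False using nc by blast
  qed (use M0 in \<open>simp_all add: P0_def\<close>)
  moreover have "cls_bound (2 * M) (card (Y (\<rho> J))) P0 \<le> 2 ^ (13 * M)"
  proof (rule cls_bound_le)
    have "\<bar>fst x\<bar> \<le> int N" using wx(1) by (cases x) simp
    then show "P0 \<le> M" using NM M0 by (auto simp: P0_def)
  qed (use card_Y M0 in \<open>simp_all add: M_def\<close>)
  ultimately show ?thesis unfolding conj_detect_def M_def by (meson le_trans)
qed

text \<open>Lamps and shift are determined modulo \<open>M\<close>. On the ball, central values at
  periods from \<open>8 ^ \<tau> e\<close> on depend only on whether \<open>pos j\<close> occurs in
  \<open>f'\<close>, so a nonzero value at a longer period forces one at \<open>\<tau> e\<close>,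
  where the quotient sees it.\<close>

lemma detect_upper:
  assumes N: "5 * int N \<le> pos e" and g: "g \<in> carrier G" "word_norm G gens g \<le> N" "g \<noteq> \<one>\<^bsub>G\<^esub>"
  shows "detect G g (2 ^ (13 * 8 ^ \<tau> e))"
proof -
  define M :: nat where "M = 8 ^ \<tau> e"
  have posM: "64 * pos e \<le> 8 ^ (\<tau> e - 1)" and r0: "\<tau> e > 0" using pos_small[OF \<tau>_ge] \<tau>_ge[of e] by auto
  have intM: "int M = 8 * 8 ^ (\<tau> e - 1)" using power_pred[OF r0] by (simp add: M_def)
  have NM: "2 * int N + 1 < int M" using N posM intM pos_gt_0[of e] by linarith
  have M0: "M > 0" by (simp add: M_def)
  obtain p u u' k \<alpha> where g_eq: "g = (p, u, u', k, \<alpha>)" by (cases g) auto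
  have w: "\<bar>p\<bar> \<le> int N" "keys u \<subseteq> {- int N..int N}" "keys u' \<subseteq> {- int N..int N}"
    "keys k \<subseteq> {- int N..int N}" "\<alpha> \<in> A_window (int N)"
    using norm_window[OF g(1,2)] by (simp_all add: g_eq)
  have "\<not> cong M (Y (\<tau> e)) g \<one>\<^bsub>G\<^esub>"
  proof
    assume "cong M (Y (\<tau> e)) g \<one>\<^bsub>G\<^esub>"
    then have c: "int M dvd p" "cyc M dvd u" "cyc M dvd u'" "cyc M dvd k" "\<And>\<xi>. \<xi> \<in> Y (\<tau> e) \<Longrightarrow> \<alpha> \<xi> = 0"
      by (simp_all add: g_eq)
    have "p = 0" using dvd_imp_le_int[of p "int M"] c(1) w(1) NM by force
    have zero: "f = 0" if "cyc M dvd f" "keys f \<subseteq> {- int N..int N}" for f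
    proof (rule cyc_dvd_short[OF that(1)])
      show "keys f \<subseteq> {- int N..<- int N + int M}"
        using that(2) by (rule subset_trans) (use NM in auto)
    qed
    obtain f f' where f: "\<alpha> = S f + T f'" "keys f \<subseteq> {- int N..int N}" "keys f' \<subseteq> {- int N..int N}"
      using w(5) by (auto simp: A_window_def)
    have val: "\<alpha> (j, t) = of_bool (pos j \<in> keys f')" if t: "t \<in> \<Theta> j" "\<tau> e \<le> t" for j t
    proof -
      have "(8::int) ^ (\<tau> e - 1) \<le> 8 ^ (t - 1)" using t(2) by (intro power_increasing) auto
      then have b: "int N \<le> 8 ^ (t - 1)" using N posM pos_gt_0[of e] by linarith
      have kb: "\<bar>i\<bar> \<le> 8 ^ (t - 1)" if "i \<in> keys f \<union> keys f'" for i
      proof -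
        have "i \<in> {- int N..int N}" using that f(2,3) by blast
        then have "\<bar>i\<bar> \<le> int N" by auto
        then show ?thesis using b by (rule order_trans)
      qed
      have "lin (sv (j, t)) f = 0" using near_sv[OF t(1) kb] by (intro lin_eq_0) auto
      moreover have "lin (tv (j, t)) f' = (\<Sum>i\<in>keys f'. of_bool (i = pos j))"
        unfolding lin_def using near_tv[OF t(1) kb] by (intro sum.cong) auto
      moreover have "(\<Sum>i\<in>keys f'. of_bool (i = pos j)) = (of_bool (pos j \<in> keys f') :: bit)"
        by (simp add: of_bool_def)
      ultimately show ?thesis by (simp add: f(1) S_def T_def)
    qed
    have "\<alpha> = 0"
    proof
      fix \<xi> :: "nat \<times> nat"
      obtain j t where \<xi>: "\<xi> = (j, t)" by (cases \<xi>)
      show "\<alpha> \<xi> = 0 \<xi>"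
      proof (cases "t \<in> \<Theta> j \<and> \<tau> e < t")
        case False
        then show ?thesis
        proof (cases "t \<in> \<Theta> j")
          case True
          then show ?thesis using c(5)[of \<xi>] False by (simp add: \<xi> Y_def)
        next
          case False
          then have "S f \<xi> = 0" "T f' \<xi> = 0"
            unfolding S_def T_def \<xi> by (intro lin_eq_0; simp add: sv_iff_0 tv_iff_0)+
          then show ?thesis by (simp add: f(1))
        qed
      next
        case True
        show ?thesis
        proof (rule ccontr)
          assume "\<alpha> \<xi> \<noteq> 0 \<xi>"
          then have pos: "pos j \<in> keys f'" using val[of t j] True by (auto simp: \<xi>)
          then have "pos j \<in> {- int N..int N}" using f(3) by blast
          then have "pos j \<le> pos e" using N pos_gt_0[of j] by simp
          then have "j \<le> e" by (simp add: pos_le_iff)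
          moreover have "\<tau> e < \<rho> j" using True \<Theta>_bounds(2)[of t j] by simp
          ultimately have \<Theta>: "\<tau> e \<in> \<Theta> j" by (auto simp: \<Theta>_def)
          then have "\<alpha> (j, \<tau> e) = 1" using val[of "\<tau> e" j] pos by simp
          moreover have "\<alpha> (j, \<tau> e) = 0" using \<Theta> by (intro c(5)) (simp add: Y_def)
          ultimately show False by simp
        qed
      qed
    qed
    then show False
      using g(3) \<open>p = 0\<close> zero[OF c(2) w(2)] zero[OF c(3) w(3)] zero[OF c(4) w(4)] by (simp add: g_eq)
  qed
  then have "detect G g (cls_bound M (card (Y (\<tau> e))) 1)"
    using periodic_Y[of "\<tau> e"] by (intro detect_cong[OF _ finite_Y M0 g(1)]) (simp_all add: M_def)
  moreover have "cls_bound M (card (Y (\<tau> e))) 1 \<le> 2 ^ (13 * M)"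
    using card_Y M0 by (intro cls_bound_le) (simp_all add: M_def)
  ultimately show ?thesis unfolding detect_def M_def by (meson le_trans)
qed

section \<open>Lower bounds\<close>

lemma T_pos_ne_0: "T (X (pos j)) \<noteq> 0"
proof
  assume "T (X (pos j)) = 0"
  then have "tv (j, \<rho> j) (pos j) = 0" by (simp add: T_def fun_eq_iff)
  then show False by (simp add: tv_iff_0 \<Theta>_def)
qed

text \<open>A quotient below the bound identifies the witness with a translate by an odd multiple of
  half its shortest period. That translate is zero.\<close>

lemma detect_lower:
  assumes "detect G (cen (T (X (pos j)))) m"
  shows "2 ^ (2 ^ (3 * \<tau> j - 1)) \<le> m"
proof (rule ccontr)
  assume *: "\<not> 2 ^ (2 ^ (3 * \<tau> j - 1)) \<le> m"
  obtain Q \<phi> where Q: "group Q" "finite (carrier (Q::nat monoid))" "\<phi> \<in> epi G Q"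
      "\<phi> (cen (T (X (pos j)))) \<noteq> \<one>\<^bsub>Q\<^esub>" "card (carrier Q) \<le> m"
    using assms detect_iff_hom[OF group_G cen_closed[OF A_T]] by blast
  have hom: "\<phi> \<in> hom G Q" using Q(3) by (simp add: epi_def)
  have "card (carrier Q) < 2 ^ (2 ^ (3 * \<tau> j - 1))" using Q(5) * by simp
  from small_quotient_periodic[OF Q(1,2) this hom] obtain q where q: "odd q"
    "\<And>k. \<phi> (cen (T (X (k + int (q * 2 ^ (3 * \<tau> j - 1)))))) = \<phi> (cen (T (X k)))" by metis
  have "T (X (pos j + int (q * 2 ^ (3 * \<tau> j - 1)))) = 0"
  proof
    fix \<xi> :: "nat \<times> nat"
    obtain i t where \<xi>: "\<xi> = (i, t)" by (cases \<xi>)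
    show "T (X (pos j + int (q * 2 ^ (3 * \<tau> j - 1)))) \<xi> = 0 \<xi>"
      using tv_half_period[OF q(1) \<tau>_ge[of j], of i t] \<Theta>_bounds(1)[of t j]
      by (auto simp: T_def \<xi> simp del: of_nat_mult)
  qed
  then have "\<phi> (cen (T (X (pos j)))) = \<phi> (cen 0)" using q(2)[of "pos j"] by (simp only:)
  also have "\<dots> = \<one>\<^bsub>Q\<^esub>" using hom_one[OF hom group_G Q(1)] by (simp add: cen_def)
  finally show False using Q(4) by blast
qed

abbreviation "lamp \<equiv> ((0, 1, 0, 0, 0) :: heis_elem)"

text \<open>Conjugation changes the centre of the lamp by some \<open>S k\<close>, which is zero in
  the last coordinate, where the witness is 1.\<close>

lemma lamp_not_conjugate: "\<not> conjugate_in G lamp (mul lamp (cen (T (X (pos j)))))"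
proof
  have mem: "lamp \<in> carrier G" "mul lamp (cen (T (X (pos j)))) \<in> carrier G"
    by (simp_all add: cen_def A_T)
  assume "conjugate_in G lamp (mul lamp (cen (T (X (pos j)))))"
  then obtain h where "mul h lamp = mul (mul lamp (cen (T (X (pos j))))) h"
    unfolding G.conjugate_in_iff[OF mem] by auto
  then obtain q v v' k \<gamma> where "mul (q, v, v', k, \<gamma>) lamp = mul (mul lamp (cen (T (X (pos j))))) (q, v, v', k, \<gamma>)"
    by (cases h) auto
  then have "\<gamma> = T (X (pos j)) + \<gamma> + S k" by (simp add: cen_def)
  then have "\<gamma> (j, \<rho> j) = (T (X (pos j)) + \<gamma> + S k) (j, \<rho> j)" by (rule arg_cong)
  moreover have "S k (j, \<rho> j) = 0" unfolding S_def by (intro lin_eq_0) (simp add: sv_iff_0)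
  moreover have "T (X (pos j)) (j, \<rho> j) = 1" by (simp add: T_def tv_iff \<Theta>_def)
  ultimately show False by (cases "\<gamma> (j, \<rho> j)") simp_all
qed

text \<open>Translating by an odd multiple of half the longest period removes exactly the last
  coordinate. What remains is the \<open>S\<close>-value at the check point, and this is a
  commutator of the lamp.\<close>

lemma conj_detect_lower:
  assumes "conj_detect G lamp (mul lamp (cen (T (X (pos j))))) m"
  shows "2 ^ (2 ^ (3 * \<rho> j - 1)) \<le> m"
proof (rule ccontr)
  let ?t = "T (X (pos j))"
  assume *: "\<not> 2 ^ (2 ^ (3 * \<rho> j - 1)) \<le> m"
  have mem: "lamp \<in> carrier G" "mul lamp (cen \<beta>) \<in> carrier G" if "\<beta> \<in> A" for \<beta>
    using that by (simp_all add: cen_def)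
  obtain Q \<phi> where Q: "group Q" "finite (carrier (Q::nat monoid))" "\<phi> \<in> epi G Q"
      "\<not> conjugate_in Q (\<phi> lamp) (\<phi> (mul lamp (cen ?t)))" "card (carrier Q) \<le> m"
    using assms conj_detect_iff_hom[OF group_G mem(1) mem(2)] A_T by blast
  have hom: "\<phi> \<in> hom G Q" using Q(3) by (simp add: epi_def)
  have mul_hom: "\<phi> (mul lamp (cen \<beta>)) = \<phi> lamp \<otimes>\<^bsub>Q\<^esub> \<phi> (cen \<beta>)" if "\<beta> \<in> A" for \<beta>
    using hom_mult[OF hom mem(1)[OF that] cen_closed[OF that]] by simp
  have "card (carrier Q) < 2 ^ (2 ^ (3 * \<rho> j - 1))" using Q(5) * by simp
  from small_quotient_periodic[OF Q(1,2) this hom] obtain q where q: "odd q"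
    "\<And>k. \<phi> (cen (T (X (k + int (q * 2 ^ (3 * \<rho> j - 1)))))) = \<phi> (cen (T (X k)))" by metis
  have r: "d * j + 3 \<le> \<rho> j" using \<tau>_ge[of j] \<tau>_le_\<rho>[of j] by simp
  let ?s = "X (pos j + chk (\<rho> j))"
  have "T (X (pos j + int (q * 2 ^ (3 * \<rho> j - 1)))) = S ?s"
  proof
    fix \<xi> :: "nat \<times> nat"
    obtain i t where \<xi>: "\<xi> = (i, t)" by (cases \<xi>)
    show "T (X (pos j + int (q * 2 ^ (3 * \<rho> j - 1)))) \<xi> = S ?s \<xi>"
      using tv_half_period[OF q(1) r, of i t] sv_check_point[OF refl, of i t j]
      by (simp add: T_def S_def \<xi> del: of_nat_mult)
  qed
  then have "\<phi> (cen ?t) = \<phi> (cen (S ?s))" using q(2)[of "pos j"] by (simp only:)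
  then have eq: "\<phi> (mul lamp (cen ?t)) = \<phi> (mul lamp (cen (S ?s)))"
    using mul_hom[OF A_T] mul_hom[OF A_S] by simp
  have "mul (0, 0, 0, ?s, 0) lamp = mul (mul lamp (cen (S ?s))) (0, 0, 0, ?s, 0)"
    by (simp add: cen_def)
  moreover have "(0, 0, 0, ?s, 0) \<in> carrier G" by simp
  ultimately have "conjugate_in G lamp (mul lamp (cen (S ?s)))"
    unfolding G.conjugate_in_iff[OF mem(1)[OF A_0] mem(2)[OF A_S]] by (metis G_simps(2))
  then have "conjugate_in Q (\<phi> lamp) (\<phi> (mul lamp (cen ?t)))"
    unfolding eq by (rule conjugate_in_hom[OF group_G Q(1) hom _ mem(1)[OF A_0]])
  then show False using Q(4) by blast
qed

end

section \<open>Matching the prescribed growth\<close>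

context tower
begin

text \<open>Separates group theory from the arithmetic of \<open>F1\<close> and \<open>F2\<close>:
  \<open>e\<close> is a scale whose position exceeds the ball, \<open>j\<close> one whose witness
  has norm of order \<open>n\<close>.\<close>

lemma ex_group_with_growth:
  fixes F1 F2 :: "nat \<Rightarrow> nat"
  assumes F1: "\<And>n. n \<ge> 1 \<Longrightarrow> F1 n \<ge> 1" and F2: "\<And>n. n \<ge> 1 \<Longrightarrow> F2 n \<ge> 1" and C: "C \<ge> 1" and C': "C' \<ge> 1"
    and up1: "\<And>n. n \<ge> 1 \<Longrightarrow> \<exists>e. 5 * n \<le> 8 ^ (d * e) \<and> 2 ^ (13 * 8 ^ \<tau> e) \<le> F1 (C * n)"
    and up2: "\<And>n. n \<ge> 1 \<Longrightarrow> \<exists>e. 5 * n \<le> 8 ^ (d * e) \<and> 2 ^ (13 * 8 ^ \<rho> e) \<le> F2 (C * n)"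
    and low1: "\<And>n. n \<ge> 1 \<Longrightarrow> \<exists>j. F1 n \<le> 2 ^ (2 ^ (3 * \<tau> j - 1)) \<and> 8 ^ (d * j) \<le> C' * n"
    and low2: "\<And>n. n \<ge> 1 \<Longrightarrow> \<exists>j. F2 n \<le> 2 ^ (2 ^ (3 * \<rho> j - 1)) \<and> 8 ^ (d * j) \<le> C' * n"
  shows "\<exists>G :: nat monoid. group G \<and> (\<exists>S. finite_generating_set G S) \<and> conjugacy_separable G \<and>
           (\<forall>S. finite_generating_set G S \<longrightarrow>
              growth_equiv (\<lambda>n. real (Rf_growth G S n)) (\<lambda>n. real (F1 n)) \<and>
              growth_equiv (\<lambda>n. real (Conj_growth G S n)) (\<lambda>n. real (F2 n)))"
proof -
  define H where "H = nat_copy G"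
  define f where "f = to_nat_on (carrier G)"
  define k where "k = inv_into (carrier G) f"
  have H: "group H" unfolding H_def using group_G countable_G by (rule nat_copy_group)
  interpret H: group H by (rule H)
  have f: "f \<in> iso G H" unfolding f_def H_def using group_G countable_G by (rule nat_copy_iso)
  have k: "k \<in> iso H G" unfolding k_def by (rule G.iso_set_sym[OF f])
  have bij: "bij_betw f (carrier G) (carrier H)" using f by (simp add: iso_def)
  have kf: "k (f x) = x" if "x \<in> carrier G" for x
    unfolding k_def using bij that by (simp add: bij_betw_inv_into_left)
  have fk: "f (k x) = x" if "x \<in> carrier H" for x
    unfolding k_def using bij that by (simp add: bij_betw_inv_into_right)
  have epi: "f \<in> epi G H" "k \<in> epi H G" using f k by (simp_all add: iso_iff_mon_epi)
  have hom: "f \<in> hom G H" "k \<in> hom H G" using f k by (simp_all add: iso_def)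
  have f_in: "f x \<in> carrier H" if "x \<in> carrier G" for x using hom(1) that by (auto simp: hom_def)
  have k_in: "k x \<in> carrier G" if "x \<in> carrier H" for x using hom(2) that by (auto simp: hom_def)
  have S0: "finite_generating_set H (f ` gens)"
    using group_G H epi(1) finite_generating_gens by (rule finite_generating_set_epi)
  have k_gens: "k ` f ` gens = gens"
  proof -
    have "k ` f ` gens = (\<lambda>x. x) ` gens"
      unfolding image_image by (rule image_cong[OF refl]) (rule kf[OF subsetD[OF gens_carrier]])
    then show ?thesis by simp
  qed
  have norm_f: "word_norm H (f ` gens) (f x) \<le> word_norm G gens x" if "x \<in> carrier G" for x
    using word_norm_hom[OF group_G H hom(1) finite_generating_gens that] .
  have norm_k: "word_norm G gens (k x) \<le> word_norm H (f ` gens) x" if "x \<in> carrier H" for x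
    using word_norm_hom[OF H group_G hom(2) S0 that] by (simp add: k_gens)
  have det: "detect H x m" if "x \<in> carrier H" "detect G (k x) m" for x m
    using detect_hom[OF H group_G epi(2) that] .
  have det': "detect G x m" if "x \<in> carrier G" "detect H (f x) m" for x m
    using detect_hom[OF group_G H epi(1) that] .
  have cdet: "conj_detect H x y m" if "x \<in> carrier H" "y \<in> carrier H" "conj_detect G (k x) (k y) m" for x y m
    using conj_detect_hom[OF H group_G epi(2) that] .
  have cdet': "conj_detect G x y m" if "x \<in> carrier G" "y \<in> carrier G" "conj_detect H (f x) (f y) m" for x y m
    using conj_detect_hom[OF group_G H epi(1) that] .
  have nc: "\<not> conjugate_in G (k x) (k y)" if "x \<in> carrier H" "y \<in> carrier H" "\<not> conjugate_in H x y" for x y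
    using conjugate_in_hom[OF group_G H hom(1) _ k_in[OF that(1)], of "k y"] that fk by auto
  have nc': "\<not> conjugate_in H (f x) (f y)" if "x \<in> carrier G" "y \<in> carrier G" "\<not> conjugate_in G x y" for x y
    using conjugate_in_hom[OF H group_G hom(2) _ f_in[OF that(1)], of "f y"] that kf by auto
  have mono_det: "detect H x m'" if "detect H x m" "m \<le> m'" for x m m'
    using that unfolding detect_def by (meson le_trans)
  have mono_cdet: "conj_detect H x y m'" if "conj_detect H x y m" "m \<le> m'" for x y m m'
    using that unfolding conj_detect_def by (meson le_trans)
  have pos_eq: "pos e = int (8 ^ (d * e))" for e by (simp add: pos_def)
  have cup: "conj_detect H x y (F2 (C * n))"
    if n: "n \<ge> 1" and xy: "x \<in> carrier H" "y \<in> carrier H" "\<not> conjugate_in H x y"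
      "word_norm H (f ` gens) x \<le> n" "word_norm H (f ` gens) y \<le> n" for n x y
  proof -
    obtain e where e: "5 * n \<le> 8 ^ (d * e)" "2 ^ (13 * 8 ^ \<rho> e) \<le> F2 (C * n)" using up2[OF n] by blast
    have "5 * int n \<le> pos e" unfolding pos_eq using e(1) by linarith
    then have "conj_detect G (k x) (k y) (2 ^ (13 * 8 ^ \<rho> e))"
      using k_in xy nc norm_k[of x] norm_k[of y] by (intro conj_detect_upper[of n]) auto
    then show ?thesis using cdet[OF xy(1,2)] mono_cdet e(2) by blast
  qed
  have up: "detect H g (F1 (C * n))"
    if n: "n \<ge> 1" and g: "g \<in> carrier H" "g \<noteq> \<one>\<^bsub>H\<^esub>" "word_norm H (f ` gens) g \<le> n" for n g
  proof -
    obtain e where e: "5 * n \<le> 8 ^ (d * e)" "2 ^ (13 * 8 ^ \<tau> e) \<le> F1 (C * n)" using up1[OF n] by blast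
    have "5 * int n \<le> pos e" unfolding pos_eq using e(1) by linarith
    moreover have "k g \<noteq> \<one>\<^bsub>G\<^esub>"
      using fk[OF g(1)] g(2) hom_one[OF hom(1) group_G H] by metis
    ultimately have "detect G (k g) (2 ^ (13 * 8 ^ \<tau> e))"
      using k_in g norm_k[of g] by (intro detect_upper[of n]) auto
    then show ?thesis using det[OF g(1)] mono_det e(2) by blast
  qed
  have sep: "conjugacy_separable H"
  proof (rule conjugacy_separableI[OF H])
    fix x y assume "x \<in> carrier H" "y \<in> carrier H" "\<not> conjugate_in H x y"
    then show "\<exists>m. conj_detect H x y m"
      using cup[of "Suc (word_norm H (f ` gens) x + word_norm H (f ` gens) y)" x y] by auto
  qed
  have "growth_equiv (\<lambda>n. real (Rf_growth H S n)) (\<lambda>n. real (F1 n))" if "finite_generating_set H S" for S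
  \<comment> \<open>The 9 comes from the norm bounds \<open>4 * 8 ^ (d * j) + 4\<close> and, for
    conjugacy, \<open>4 * 8 ^ (d * j) + 5\<close>.\<close>
  proof (rule H.growth_equiv_RfI[where F = F1 and c = C and c' = "9 * C'", OF S0 F1 C up _ _ that])
    fix n :: nat assume "n \<ge> 1"
    then obtain j where j: "F1 n \<le> 2 ^ (2 ^ (3 * \<tau> j - 1))" "8 ^ (d * j) \<le> C' * n" using low1 by blast
    let ?t = "cen (T (X (pos j)))"
    have t: "?t \<in> carrier G" by (rule cen_closed[OF A_T])
    have "?t \<noteq> \<one>\<^bsub>G\<^esub>" using T_pos_ne_0[of j] by (simp add: cen_def)
    then have "f ?t \<noteq> \<one>\<^bsub>H\<^esub>" using kf[OF t] hom_one[OF hom(2) H group_G] by metis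
    moreover have "word_norm H (f ` gens) (f ?t) \<le> 9 * C' * n"
    proof -
      have "word_norm G gens ?t \<le> 4 * 8 ^ (d * j) + 4" using norm_T(1)[of "8 ^ (d * j)"] by (simp only: pos_eq)
      also have "\<dots> \<le> 9 * 8 ^ (d * j)" using one_le_power[of "8::nat" "d * j"] by linarith
      also have "\<dots> \<le> 9 * C' * n" using j(2) by simp
      finally show ?thesis using norm_f[OF t] by simp
    qed
    moreover have "F1 n \<le> m" if "detect H (f ?t) m" for m
      using detect_lower[OF det'[OF t that]] j(1) by (rule order_trans[rotated])
    ultimately show "\<exists>g\<in>carrier H. g \<noteq> \<one>\<^bsub>H\<^esub> \<and> word_norm H (f ` gens) g \<le> 9 * C' * n \<and>
        (\<forall>m. detect H g m \<longrightarrow> F1 n \<le> m)"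
      using f_in[OF t] by blast
  qed (use C' in auto)
  moreover have "growth_equiv (\<lambda>n. real (Conj_growth H S n)) (\<lambda>n. real (F2 n))"
    if "finite_generating_set H S" for S
  proof (rule H.growth_equiv_ConjI[where F = F2 and c = C and c' = "9 * C'", OF S0 F2 C cup _ _ that])
    fix n :: nat assume "n \<ge> 1"
    then obtain j where j: "F2 n \<le> 2 ^ (2 ^ (3 * \<rho> j - 1))" "8 ^ (d * j) \<le> C' * n" using low2 by blast
    let ?y = "mul lamp (cen (T (X (pos j))))"
    have mem: "lamp \<in> carrier G" "?y \<in> carrier G" by (simp_all add: cen_def A_T)
    have "\<not> conjugate_in H (f lamp) (f ?y)" by (rule nc'[OF mem lamp_not_conjugate])
    moreover have "word_norm H (f ` gens) (f ?y) \<le> 9 * C' * n" "word_norm H (f ` gens) (f lamp) \<le> 9 * C' * n"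
    proof -
      have b: "9 * 8 ^ (d * j) \<le> 9 * C' * n" using j(2) by simp
      have "word_norm G gens ?y \<le> 4 * 8 ^ (d * j) + 5" using norm_T(2)[of "8 ^ (d * j)"] by (simp only: pos_eq)
      also have "\<dots> \<le> 9 * 8 ^ (d * j)" using one_le_power[of "8::nat" "d * j"] by linarith
      finally show "word_norm H (f ` gens) (f ?y) \<le> 9 * C' * n" using norm_f[OF mem(2)] b by linarith
      have "(1::nat) \<le> 8 ^ (d * j)" by simp
      then show "word_norm H (f ` gens) (f lamp) \<le> 9 * C' * n"
        using norm_f[OF mem(1)] norm_T(3) b by linarith
    qed
    moreover have "F2 n \<le> m" if "conj_detect H (f lamp) (f ?y) m" for m
      using conj_detect_lower[OF cdet'[OF mem that]] j(1) by (rule order_trans[rotated])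
    ultimately show "\<exists>x\<in>carrier H. \<exists>y\<in>carrier H. \<not> conjugate_in H x y \<and>
        word_norm H (f ` gens) x \<le> 9 * C' * n \<and> word_norm H (f ` gens) y \<le> 9 * C' * n \<and>
        (\<forall>m. conj_detect H x y m \<longrightarrow> F2 n \<le> m)"
      using f_in[OF mem(1)] f_in[OF mem(2)] by blast
  qed (use C' in auto)
  ultimately show ?thesis using H S0 sep by blast
qed

end

text \<open>From 9 on the logarithmic factors are at least their values at 9. These are positive
  because \<open>ln 9 = 2 * ln 3\<close> is at least 2.\<close>

lemma fast_growing_exp_linear:
  assumes "fast_growing F"
  obtains c :: real where "c > 0" "\<And>n. n \<ge> 9 \<Longrightarrow> exp (c * real n) \<le> real (F n)"
proof -
  obtain C \<epsilon> :: real where C: "C > 0" "\<epsilon> > 0"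
    "\<And>n. n \<ge> 3 \<Longrightarrow> exp (C * real n * (ln (real n))^2 * (ln (ln (real n))) powr (1 + \<epsilon>)) \<le> real (F n)"
    using assms unfolding fast_growing_def by blast
  define l :: real where "l = ln 9"
  have "ln (exp 1) \<le> ln (3::real)" using exp_le by (intro ln_mono) auto
  moreover have "l = ln (3 ^ 2)" by (simp add: l_def)
  then have "l = 2 * ln 3" by (simp only: ln_realpow)
  ultimately have l: "l > 1" by simp
  define c where "c = C * l\<^sup>2 * (ln l) powr (1 + \<epsilon>)"
  have lnl: "ln l > 0" using l by simp
  have "c > 0" using C(1) l lnl by (simp add: c_def)
  moreover have "exp (c * real n) \<le> real (F n)" if n: "n \<ge> 9" for n
  proof -
    have a: "l \<le> ln (real n)" using n by (simp add: l_def)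
    then have b: "ln l \<le> ln (ln (real n))" using l by simp
    have "l\<^sup>2 \<le> (ln (real n))\<^sup>2" using a l by (intro power_mono) auto
    moreover have "(ln l) powr (1 + \<epsilon>) \<le> (ln (ln (real n))) powr (1 + \<epsilon>)"
      using b lnl C(2) by (intro powr_mono2) auto
    ultimately have "l\<^sup>2 * (ln l) powr (1 + \<epsilon>) \<le> (ln (real n))\<^sup>2 * (ln (ln (real n))) powr (1 + \<epsilon>)"
      by (intro mult_mono) auto
    then have "(C * real n) * (l\<^sup>2 * (ln l) powr (1 + \<epsilon>)) \<le>
        (C * real n) * ((ln (real n))\<^sup>2 * (ln (ln (real n))) powr (1 + \<epsilon>))"
      using C(1) by (intro mult_left_mono) auto
    then have "exp (c * real n) \<le> exp (C * real n * (ln (real n))^2 * (ln (ln (real n))) powr (1 + \<epsilon>))"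
      by (simp add: c_def mult_ac)
    also have "\<dots> \<le> real (F n)" by (rule C(3)) (use n in simp)
    finally show ?thesis .
  qed
  ultimately show ?thesis using that by blast
qed

text \<open>Iteration raises the exponent to \<open>C1 ^ i\<close>, which eventually exceeds 8. An
  eighth power multiplies the logarithm by the base of the periods.\<close>

lemma power_dominated_octic:
  assumes "power_dominated F" and F: "\<And>n. n \<ge> 1 \<Longrightarrow> F n \<ge> 1"
  obtains K where "K \<ge> 1" "\<And>n. n \<ge> 1 \<Longrightarrow> F n ^ 8 \<le> F (K * n)"
proof -
  obtain C1 :: real and C2 :: nat where C: "C1 > 1" "C2 > 1"
    "\<And>n. n \<ge> 1 \<Longrightarrow> real (F n) powr C1 \<le> real (F (C2 * n))"
    using assms(1) unfolding power_dominated_def by blast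
  have iter: "real (F n) powr (C1 ^ i) \<le> real (F (C2 ^ i * n))" if n: "n \<ge> 1" for n i
  proof (induction i)
    case 0
    then show ?case using F[OF n] by simp
  next
    case (Suc i)
    have "real (F n) powr (C1 ^ Suc i) = (real (F n) powr (C1 ^ i)) powr C1"
      by (simp add: powr_powr mult.commute)
    also have "\<dots> \<le> real (F (C2 ^ i * n)) powr C1"
      using Suc C(1) by (intro powr_mono2) auto
    also have "\<dots> \<le> real (F (C2 * (C2 ^ i * n)))" using C(2) n by (intro C(3)) simp
    finally show ?case by (simp add: mult.assoc)
  qed
  obtain i where i: "8 < C1 ^ i" using real_arch_pow[OF C(1)] by blast
  have "F n ^ 8 \<le> F (C2 ^ i * n)" if n: "n \<ge> 1" for n
  proof -
    have "real (F n) ^ 8 = real (F n) powr 8"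
      using F[OF n] powr_realpow[of "real (F n)" 8] by simp
    also have "\<dots> \<le> real (F n) powr (C1 ^ i)" using i F[OF n] by (intro powr_mono) auto
    also have "\<dots> \<le> real (F (C2 ^ i * n))" by (rule iter[OF n])
    finally show ?thesis by (metis of_nat_le_iff of_nat_power)
  qed
  then show ?thesis using that[of "C2 ^ i"] C(2) by simp
qed

text \<open>For \<open>x \<ge> 2\<close> this is the integer part of
  \<open>log_8 (log_2 x)\<close>.\<close>

definition level :: "nat \<Rightarrow> nat" where
  "level x = (LEAST s. x < 2 ^ (8 ^ Suc s))"

lemma level:
  assumes "x \<ge> 2"
  shows "2 ^ (8 ^ level x) \<le> x" "x < 2 ^ (8 ^ Suc (level x))"
proof -
  have "x < 2 ^ x" by simp
  also have "\<dots> \<le> 2 ^ (8 ^ Suc x)"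
  proof (intro power_increasing)
    have "x < 2 ^ x" by simp
    also have "(2::nat) ^ x \<le> 8 ^ x" by (intro power_mono) auto
    finally show "x \<le> 8 ^ Suc x" by simp
  qed simp
  finally show "x < 2 ^ (8 ^ Suc (level x))" unfolding level_def by (rule LeastI)
  show "2 ^ (8 ^ level x) \<le> x"
  proof (cases "level x")
    case 0
    then show ?thesis using assms by simp
  next
    case (Suc s)
    then have "s < level x" by simp
    then have "\<not> x < 2 ^ (8 ^ Suc s)" unfolding level_def by (rule not_less_Least)
    then show ?thesis using Suc by simp
  qed
qed

lemma double_power_less_iff: "(2::nat) ^ (8 ^ s) < 2 ^ (8 ^ t) \<longleftrightarrow> s < t"
  by simp

lemma le_level:
  assumes "2 ^ (8 ^ s) \<le> x"
  shows "s \<le> level x"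
proof -
  have "(2::nat) ^ 1 \<le> 2 ^ (8 ^ s)" by (intro power_increasing) auto
  then have "2 \<le> x" using assms by simp
  then have "(2::nat) ^ (8 ^ s) < 2 ^ (8 ^ Suc (level x))" using level(2) assms by (meson le_less_trans)
  then show ?thesis unfolding double_power_less_iff by simp
qed

lemma level_mono: "2 \<le> x \<Longrightarrow> x \<le> y \<Longrightarrow> level x \<le> level y"
  using le_level level(1) by (meson le_trans)

lemma level_octic:
  assumes "x \<ge> 2"
  shows "Suc (level x) \<le> level (x ^ 8)"
proof (rule le_level)
  have "(2::nat) ^ (8 ^ Suc (level x)) = (2 ^ (8 ^ level x)) ^ 8"
    by (simp add: mult.commute flip: power_mult)
  also have "\<dots> \<le> x ^ 8" using level(1)[OF assms] by (intro power_mono) auto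
  finally show "2 ^ (8 ^ Suc (level x)) \<le> x ^ 8" .
qed

text \<open>By \<open>octic\<close>, one step of scale raises the level by at least one. The offset
  \<open>c\<close> in \<open>base\<close> gives the growth the head start that keeps positions small
  against periods.\<close>

locale scaled_growth =
  fixes F :: "nat \<Rightarrow> nat" and d c :: nat
  assumes F_ge: "\<And>n. n \<ge> 1 \<Longrightarrow> F n \<ge> 1" and F_mono: "mono_on {1..} F" and d: "d \<ge> 1"
    and octic: "\<And>n. n \<ge> 1 \<Longrightarrow> F n ^ 8 \<le> F (8 ^ d * n)"
    and base: "\<And>e. 2 ^ (8 ^ (d * e + 3)) \<le> F (8 ^ (d * (e + c)))"
begin

definition \<sigma> :: "nat \<Rightarrow> nat" where "\<sigma> e = level (F (8 ^ (d * (e + c))))"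

lemma F_le: "1 \<le> m \<Longrightarrow> m \<le> n \<Longrightarrow> F m \<le> F n"
  using F_mono by (auto simp: mono_on_def)

lemma F_ge_2: "2 \<le> F (8 ^ (d * (e + c)))"
proof -
  have "(2::nat) ^ 1 \<le> 2 ^ (8 ^ (d * e + 3))" by (intro power_increasing) auto
  then show ?thesis using base[of e] by simp
qed

lemma \<sigma>_ge: "d * e + 3 \<le> \<sigma> e"
  unfolding \<sigma>_def using base by (rule le_level)

lemma \<sigma>_Suc: "Suc (\<sigma> e) \<le> \<sigma> (Suc e)"
proof -
  have "Suc (\<sigma> e) \<le> level (F (8 ^ (d * (e + c))) ^ 8)"
    unfolding \<sigma>_def by (rule level_octic[OF F_ge_2])
  also have "\<dots> \<le> \<sigma> (Suc e)"
    unfolding \<sigma>_def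
  proof (rule level_mono)
    show "F (8 ^ (d * (e + c))) ^ 8 \<le> F (8 ^ (d * (Suc e + c)))"
      using octic[of "8 ^ (d * (e + c))"] by (simp add: power_add)
    show "2 \<le> F (8 ^ (d * (e + c))) ^ 8"
      using F_ge_2[of e] self_le_power[of "F (8 ^ (d * (e + c)))" 8] by simp
  qed
  finally show ?thesis .
qed

lemma strict_mono_\<sigma>: "strict_mono \<sigma>"
  using \<sigma>_Suc by (simp add: strict_mono_Suc_iff Suc_le_eq)

lemma scale_upper:
  assumes n: "n \<ge> 1"
  shows "\<exists>e. 5 * n \<le> 8 ^ (d * e) \<and> 2 ^ (13 * 8 ^ \<sigma> e) \<le> F (5 * 8 ^ (d * (c + 3)) * n)"
proof -
  define e where "e = (LEAST e. 5 * n \<le> 8 ^ (d * e))"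
  have "5 * n < 2 ^ (5 * n)" by simp
  also have "(2::nat) ^ (5 * n) \<le> 8 ^ (5 * n)" by (intro power_mono) auto
  also have "(8::nat) ^ (5 * n) \<le> 8 ^ (d * (5 * n))" using d by (intro power_increasing) auto
  finally have "5 * n \<le> 8 ^ (d * (5 * n))" by simp
  then have e: "5 * n \<le> 8 ^ (d * e)" unfolding e_def by (rule LeastI)
  then obtain e' where e': "e = Suc e'" using n by (cases e) auto
  then have "\<not> 5 * n \<le> 8 ^ (d * e')" unfolding e_def by (intro not_less_Least) (simp add: e_def)
  then have small: "8 ^ (d * e) \<le> 8 ^ d * (5 * n)" by (simp add: e' power_add)
  let ?m = "(8::nat) ^ (d * (e + c))"
  \<comment> \<open>Since 13 is at most 64, two uses of \<open>octic\<close> absorb the constant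
    into the argument.\<close>
  have "2 ^ (13 * 8 ^ \<sigma> e) \<le> ((2::nat) ^ (8 ^ \<sigma> e)) ^ 64"
    unfolding power_mult[symmetric] by (intro power_increasing) auto
  also have "\<dots> \<le> F ?m ^ 64" unfolding \<sigma>_def using level(1)[OF F_ge_2] by (intro power_mono) auto
  also have "\<dots> = (F ?m ^ 8) ^ 8" by (simp flip: power_mult)
  also have "\<dots> \<le> F (8 ^ d * ?m) ^ 8" by (intro power_mono octic) auto
  also have "\<dots> \<le> F (8 ^ d * (8 ^ d * ?m))" by (intro octic) auto
  also have "\<dots> \<le> F (5 * 8 ^ (d * (c + 3)) * n)"
  proof (rule F_le)
    have "8 ^ d * (8 ^ d * ?m) = 8 ^ (d * (c + 2)) * 8 ^ (d * e)"
      by (simp add: power_add[symmetric] algebra_simps)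
    also have "\<dots> \<le> 8 ^ (d * (c + 2)) * (8 ^ d * (5 * n))" using small by simp
    also have "(8::nat) ^ (d * (c + 2)) * (8 ^ d * (5 * n)) = 5 * (8 ^ (d * (c + 2)) * 8 ^ d) * n"
      by (simp only: ac_simps)
    also have "(8::nat) ^ (d * (c + 2)) * 8 ^ d = 8 ^ (d * (c + 3))"
      by (simp add: power_add[symmetric] algebra_simps)
    finally show "8 ^ d * (8 ^ d * ?m) \<le> 5 * 8 ^ (d * (c + 3)) * n" .
  qed simp
  finally show ?thesis using e by blast
qed

lemma scale_lower:
  assumes n: "n \<ge> 1"
  shows "\<exists>j. F n \<le> 2 ^ (2 ^ (3 * \<sigma> j - 1)) \<and> 8 ^ (d * j) \<le> 8 ^ (3 * d) * n"
proof -
  define e where "e = (LEAST e. n \<le> 8 ^ (d * (e + c)))"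
  have "n < 2 ^ n" by simp
  also have "(2::nat) ^ n \<le> 8 ^ n" by (intro power_mono) auto
  also have "(8::nat) ^ n \<le> 8 ^ (d * (n + c))"
  proof (intro power_increasing)
    have "1 * n \<le> d * (n + c)" using d by (intro mult_le_mono) auto
    then show "n \<le> d * (n + c)" by simp
  qed simp
  finally have "n \<le> 8 ^ (d * (n + c))" by simp
  then have e: "n \<le> 8 ^ (d * (e + c))" unfolding e_def by (rule LeastI)
  have "F n \<le> F (8 ^ (d * (e + c)))" using n e by (rule F_le)
  also have "\<dots> \<le> 2 ^ (8 ^ Suc (\<sigma> e))" using level(2)[OF F_ge_2] by (simp add: \<sigma>_def less_imp_le)
  \<comment> \<open>One step of scale would only guarantee the exponent
    \<open>3 * Suc (\<sigma> e) - 1\<close>, one too small; the second step makes up for the half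
    period.\<close>
  also have "\<dots> \<le> 2 ^ (2 ^ (3 * \<sigma> (e + 2) - 1))"
  proof (intro power_increasing)
    have "(8::nat) ^ Suc (\<sigma> e) = (2 ^ 3) ^ Suc (\<sigma> e)" by simp
    also have "\<dots> = 2 ^ (3 * Suc (\<sigma> e))" by (simp only: power_mult)
    also have "\<dots> \<le> 2 ^ (3 * \<sigma> (e + 2) - 1)"
      using \<sigma>_Suc[of e] \<sigma>_Suc[of "Suc e"] by (intro power_increasing) auto
    finally show "(8::nat) ^ Suc (\<sigma> e) \<le> 2 ^ (3 * \<sigma> (e + 2) - 1)" .
  qed simp
  finally have "F n \<le> 2 ^ (2 ^ (3 * \<sigma> (e + 2) - 1))" .
  moreover have "8 ^ (d * (e + 2)) \<le> 8 ^ (3 * d) * n"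
  proof (cases e)
    case 0
    have "(8::nat) ^ (d * 2) \<le> 8 ^ (3 * d)" by (intro power_increasing) auto
    also have "\<dots> \<le> 8 ^ (3 * d) * n" using n by simp
    finally show ?thesis by (simp only: 0 add_0)
  next
    case (Suc e')
    then have "\<not> n \<le> 8 ^ (d * (e' + c))" unfolding e_def by (intro not_less_Least) (simp add: e_def)
    then have "8 ^ (d * (e' + c)) \<le> n" by simp
    moreover have "(8::nat) ^ (d * e') \<le> 8 ^ (d * (e' + c))" by (intro power_increasing) auto
    ultimately have "8 ^ (d * e') \<le> n" by (rule order_trans[rotated])
    then have "8 ^ (3 * d) * 8 ^ (d * e') \<le> 8 ^ (3 * d) * n" by simp
    moreover have "(8::nat) ^ (d * (e + 2)) = 8 ^ (3 * d) * 8 ^ (d * e')"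
      by (simp add: Suc power_add[symmetric] algebra_simps)
    ultimately show ?thesis by simp
  qed
  ultimately show ?thesis by blast
qed

end

theorem theorem2:
  fixes F1 F2 :: "nat \<Rightarrow> nat"
  assumes "\<And>n. n \<ge> 1 \<Longrightarrow> F1 n \<ge> 1"
    and "\<And>n. n \<ge> 1 \<Longrightarrow> F2 n \<ge> 1"
    and "mono_on {1..} F1"
    and "mono_on {1..} F2"
    and "\<And>n. n \<ge> 1 \<Longrightarrow> F2 n \<ge> F1 n"
    and "fast_growing F1"
    and "fast_growing F2"
    and "power_dominated F1"
    and "power_dominated F2"
  shows "\<exists>G :: nat monoid. group G \<and> (\<exists>S. finite_generating_set G S) \<and> conjugacy_separable G \<and>
           (\<forall>S. finite_generating_set G S \<longrightarrow>
              growth_equiv (\<lambda>n. real (Rf_growth G S n)) (\<lambda>n. real (F1 n)) \<and>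
              growth_equiv (\<lambda>n. real (Conj_growth G S n)) (\<lambda>n. real (F2 n)))"
proof -
  obtain K1 where K1: "K1 \<ge> 1" "\<And>n. n \<ge> 1 \<Longrightarrow> F1 n ^ 8 \<le> F1 (K1 * n)"
    using power_dominated_octic[OF assms(8,1)] by blast
  obtain K2 where K2: "K2 \<ge> 1" "\<And>n. n \<ge> 1 \<Longrightarrow> F2 n ^ 8 \<le> F2 (K2 * n)"
    using power_dominated_octic[OF assms(9,2)] by blast
  \<comment> \<open>Both functions share one scale, so \<open>8 ^ d\<close> has to dominate both
    dilations.\<close>
  define d where "d = K1 + K2"
  have d: "d \<ge> 1" using K1(1) by (simp add: d_def)
  have "d < 2 ^ d" by simp
  also have "(2::nat) ^ d \<le> 8 ^ d" by (intro power_mono) auto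
  finally have K: "K1 \<le> 8 ^ d" "K2 \<le> 8 ^ d" by (simp_all add: d_def)
  have octic: "F n ^ 8 \<le> F (8 ^ d * n)"
    if "mono_on {1..} F" "K \<le> 8 ^ d" "K \<ge> 1" "\<And>n. n \<ge> 1 \<Longrightarrow> F n ^ 8 \<le> F (K * n)" "n \<ge> 1"
    for F :: "nat \<Rightarrow> nat" and K n
  proof -
    have "F (K * n) \<le> F (8 ^ d * n)" using that(2,3,5) by (intro mono_onD[OF that(1)]) auto
    then show ?thesis using that(4)[OF that(5)] by simp
  qed
  obtain c0 :: real where c0: "c0 > 0" "\<And>n. n \<ge> 9 \<Longrightarrow> exp (c0 * real n) \<le> real (F1 n)"
    using fast_growing_exp_linear[OF assms(6)] by blast
  \<comment> \<open>The offset has to turn \<open>c0 * 8 ^ (d * c)\<close> into at least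
    \<open>512 = 8 ^ 3\<close>, which yields the margin 3. The extra 2 in \<open>c\<close> pushes
    the arguments to at least 64, past the threshold 9.\<close>
  obtain c1 :: nat where c1: "512 / c0 < real c1" using reals_Archimedean2 by blast
  define c where "c = c1 + 2"
  have base: "2 ^ (8 ^ (d * e + 3)) \<le> F1 (8 ^ (d * (e + c)))" for e
  proof -
    have "c < 2 ^ c" by simp
    also have "(2::nat) ^ c \<le> 8 ^ c" by (intro power_mono) auto
    also have "(8::nat) ^ c \<le> 8 ^ (d * c)" using d by (intro power_increasing) auto
    finally have "real c \<le> 8 ^ (d * c)" by (metis less_imp_le of_nat_le_iff of_nat_numeral of_nat_power)
    then have "512 / c0 \<le> 8 ^ (d * c)" using c1 by (simp add: c_def)
    then have "512 \<le> c0 * 8 ^ (d * c)" using c0(1) by (simp add: field_simps)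
    then have "8 ^ (d * e) * 512 \<le> 8 ^ (d * e) * (c0 * 8 ^ (d * c))" by (intro mult_left_mono) auto
    then have A: "(8::real) ^ (d * e + 3) \<le> c0 * 8 ^ (d * (e + c))"
      by (simp add: power_add distrib_left mult_ac)
    have "1 * 2 \<le> d * (e + c)" using d by (intro mult_le_mono) (simp_all add: c_def)
    then have "8 ^ 2 \<le> (8::nat) ^ (d * (e + c))" by (intro power_increasing) simp_all
    then have nine: "9 \<le> (8::nat) ^ (d * (e + c))" by simp
    have "(2::real) ^ (8 ^ (d * e + 3)) \<le> exp 1 ^ (8 ^ (d * e + 3))"
      using exp_ge_add_one_self[of 1] by (intro power_mono) auto
    also have "\<dots> = exp (8 ^ (d * e + 3))" by (simp flip: exp_of_nat_mult)
    also have "\<dots> \<le> exp (c0 * 8 ^ (d * (e + c)))" using A by simp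
    also have "\<dots> \<le> real (F1 (8 ^ (d * (e + c))))" using c0(2)[OF nine] by simp
    finally show ?thesis by (metis of_nat_le_iff of_nat_numeral of_nat_power)
  qed
  interpret A: scaled_growth F1 d c
    using assms(1,3) d base octic[OF assms(3) K(1) K1] by unfold_locales auto
  have base2: "2 ^ (8 ^ (d * e + 3)) \<le> F2 (8 ^ (d * (e + c)))" for e
    using base[of e] assms(5)[of "8 ^ (d * (e + c))"] by simp
  interpret B: scaled_growth F2 d c
    using assms(2,4) d base2 octic[OF assms(4) K(2) K2] by unfold_locales auto
  \<comment> \<open>The comparison of \<open>F1\<close> with \<open>F2\<close> becomes the order of
    the first and last period of each scale.\<close>
  have "A.\<sigma> j \<le> B.\<sigma> j" for j
    unfolding A.\<sigma>_def B.\<sigma>_def using assms(5) by (intro level_mono A.F_ge_2) simp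
  then interpret tower d A.\<sigma> B.\<sigma>
    using d A.strict_mono_\<sigma> A.\<sigma>_ge strict_mono_mono[OF B.strict_mono_\<sigma>] by unfold_locales auto
  show ?thesis
    by (rule ex_group_with_growth[OF assms(1,2) _ _ A.scale_upper B.scale_upper A.scale_lower B.scale_lower])
      simp_all
qed

end
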